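(* Suppose that the following hold: (A1) $\sum_{i=1}^{\infty} w_i = \infty$ and $\sum_{i=1}^{\infty} w_i^2 < \infty$; (A2) the map $F\mapsto\int_\Theta p(x|\theta)\,F(d\theta)$ is injective; that is, the mixing distribution $F$ is identifiable from the mixture $\int_\Theta p(x|\theta)\,F(d\theta)$; (A3) for each $x\in\mathcal{X}$, the map $\theta\mapsto p(x|\theta)$ is bounded and continuous; (A4) for any $\varepsilon>0$ and any compact $\mathcal{X}_0\subset\mathcal{X}$, there exists a compact $\Theta_0\subset\Theta$ such that $\int_{\mathcal{X}_0}p(x|\theta)\,\nu(dx)<\varepsilon$ for all $\theta\notin\Theta_0$; (A5) there exists a constant $B<\infty$ such that, for every $\theta_1,\theta_2,\theta_3\in\Theta$, $$\int_{\mathcal{X}} \left(\frac{p(x|\theta_1)}{p(x|\theta_2)}\right)^2 p(x|\theta_3)\,\nu(dx) < B.$$ Then the permutation-averaged estimate $\bar f_n$ converges weakly to $f$ in probability.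
   Context: Setting. For each $\theta\in\Theta$, $p(\cdot|\theta)$ is a known sampling density on $\mathcal{X}$ with respect to a dominating $\sigma$-finite measure $\nu$. The mixing distribution $F$ is a probability measure on $\Theta$, absolutely continuous with respect to a $\sigma$-finite measure $\mu$ on $\Theta$, with density $f=dF/d\mu$. The observations $X_1,X_2,\ldots$ are i.i.d. with density (with respect to $\nu$) $$p(x)=\int_\Theta p(x|\theta)f(\theta)\,\mu(d\theta).$$ Recursive estimate. Fix an initial estimate $f_0$ (a density on $\Theta$ with respect to $\mu$) and a sequence of weights $w_1,w_2,\ldots\in(0,1)$. Given an ordered sample $x_1,\ldots,x_n\in\mathcal{X}$, define recursively, for $i=1,\ldots,n$, $$f_i(\theta)=(1-w_i)f_{i-1}(\theta)+w_i\,\frac{p(x_i|\theta)f_{i-1}(\theta)}{\int_\Theta p(x_i|\theta')f_{i-1}(\theta')\,\mu(d\theta')},\qquad \theta\in\Theta,$$ and take $f_n$ as the final estimate. Permutation-averaged estimate. Let $S_n$ be the permutation group on $\{1,\ldots,n\}$. For $s\in S_n$, let $f_{n,s}$ be the estimate $f_n$ produced by the recursion with the observations arranged as $X_{s(1)},\ldots,X_{s(n)}$. Define $$\bar f_n=\frac{1}{n!}\sum_{s\in S_n}f_{n,s}.$$ Compactness and continuity refer to the topologies of $\mathcal{X}$ and $\Theta$. In (A2), $F$ ranges over probability measures on $\Theta$. Weak convergence of densities means weak convergence of the corresponding probability measures $\bar f_n\,d\mu$ and $f\,d\mu$ on $\Theta$. Convergence in probability is with respect to the (metrizable) weak topology;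 equivalently, every subsequence of indices contains a further subsequence along which $\bar f_n$ converges weakly to $f$ almost surely.
   Formalization: Adds that F is absolutely continuous with respect to the initial distribution f_0 dμ (f=0 μ-a.e. where f_0=0); without this the claim is false, as every f_n vanishes where f_0 does. X is taken Polish and Θ separable metric, with Borel sets. *)

theory Defs
  imports "HOL-Probability.Probability" "HOL-Combinatorics.Permutations"
begin

definition is_density :: "'a measure \<Rightarrow> ('a \<Rightarrow> real) \<Rightarrow> bool" where
  "is_density M f \<longleftrightarrow>
     f \<in> borel_measurable M \<and> (\<forall>x. 0 \<le> f x) \<and> (\<integral>\<^sup>+x. ennreal (f x) \<partial>M) = 1"

definition borel_prob :: "('a::topological_space) measure set" where
  "borel_prob = {F. prob_space F \<and> sets F = sets borel}"

definition mixture :: "('x \<Rightarrow> 't \<Rightarrow> real) \<Rightarrow> 't measure \<Rightarrow> 'x \<Rightarrow> real" where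
  "mixture p F x = (LINT \<theta>|F. p x \<theta>)"

text \<open>Only the values \<open>w i\<close> and \<open>x i\<close> with \<open>i \<ge> 1\<close> are used.\<close>

primrec rec_est ::
  "('x \<Rightarrow> 't \<Rightarrow> real) \<Rightarrow> 't measure \<Rightarrow> (nat \<Rightarrow> real) \<Rightarrow> ('t \<Rightarrow> real) \<Rightarrow> (nat \<Rightarrow> 'x) \<Rightarrow> nat \<Rightarrow> 't \<Rightarrow> real"
where
  "rec_est p \<mu> w f0 x 0 = f0"
| "rec_est p \<mu> w f0 x (Suc i) = (\<lambda>\<theta>.
     (1 - w (Suc i)) * rec_est p \<mu> w f0 x i \<theta> +
     w (Suc i) * (p (x (Suc i)) \<theta> * rec_est p \<mu> w f0 x i \<theta> /
                  (LINT \<theta>'|\<mu>. p (x (Suc i)) \<theta>' * rec_est p \<mu> w f0 x i \<theta>')))"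

definition perm_avg_est ::
  "('x \<Rightarrow> 't \<Rightarrow> real) \<Rightarrow> 't measure \<Rightarrow> (nat \<Rightarrow> real) \<Rightarrow> ('t \<Rightarrow> real) \<Rightarrow> (nat \<Rightarrow> 'x) \<Rightarrow> nat \<Rightarrow> 't \<Rightarrow> real"
where
  "perm_avg_est p \<mu> w f0 x n \<theta> =
     (1 / fact n) * (\<Sum>s | s permutes {1..n}. rec_est p \<mu> w f0 (x \<circ> s) n \<theta>)"

definition weak_topology :: "('a::topological_space) measure topology" where
  "weak_topology = topology_generated_by
     {{F \<in> borel_prob. (LINT x|F. g x) \<in> V} | (g :: 'a \<Rightarrow> real) V.
        continuous_on UNIV g \<and> bounded (range g) \<and> open V}"

text \<open>Convergence in probability to a constant, in an arbitrary topological space. The events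
  \<open>Y n \<notin> U\<close> need not be measurable, so outer probability is used, through measurable
  covers \<open>A n\<close>.\<close>

definition tendsto_in_prob ::
  "'w measure \<Rightarrow> 'a topology \<Rightarrow> (nat \<Rightarrow> 'w \<Rightarrow> 'a) \<Rightarrow> 'a \<Rightarrow> bool"
where
  "tendsto_in_prob P T Y y \<longleftrightarrow> y \<in> topspace T \<and>
     (\<forall>U. openin T U \<and> y \<in> U \<longrightarrow>
        (\<exists>A. (\<forall>n. A n \<in> sets P \<and> {\<omega> \<in> space P. Y n \<omega> \<notin> U} \<subseteq> A n) \<and>
             (\<lambda>n. measure P (A n)) \<longlonglongrightarrow> 0))"

text \<open>Sanity check: convergence in \<open>weak_topology\<close> is the usual weak convergence.\<close>

lemma topspace_weak_topology [simp]: "topspace weak_topology = borel_prob"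
proof -
  have "{F \<in> borel_prob. (LINT x|F. (0::real)) \<in> UNIV} \<in>
     {{F \<in> borel_prob. (LINT x|F. g x) \<in> V} | (g :: 'a \<Rightarrow> real) V.
        continuous_on UNIV g \<and> bounded (range g) \<and> open V}"
    by (rule CollectI, rule exI[of _ "\<lambda>_. 0"], rule exI[of _ UNIV]) (auto simp: image_def)
  then show ?thesis
    unfolding weak_topology_def topology_generated_by_topspace by blast
qed

lemma limitin_weak_topology:
  fixes M :: "nat \<Rightarrow> ('a::topological_space) measure"
  assumes M: "\<And>n. M n \<in> borel_prob" and F: "F \<in> borel_prob"
  shows "limitin weak_topology M F sequentially \<longleftrightarrow>
    (\<forall>g :: 'a \<Rightarrow> real. continuous_on UNIV g \<and> bounded (range g) \<longrightarrow>
       (\<lambda>n. LINT x|M n. g x) \<longlonglongrightarrow> (LINT x|F. g x))" (is "?L \<longleftrightarrow> ?R")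
proof
  assume L: ?L
  show ?R
  proof (intro allI impI topological_tendstoI)
    fix g :: "'a \<Rightarrow> real" and V
    assume g: "continuous_on UNIV g \<and> bounded (range g)" and V: "open V" "(LINT x|F. g x) \<in> V"
    have "openin weak_topology {F \<in> borel_prob. (LINT x|F. g x) \<in> V}"
      unfolding weak_topology_def by (rule topology_generated_by_Basis) (use g V in blast)
    with L F V have "\<forall>\<^sub>F n in sequentially. M n \<in> {F \<in> borel_prob. (LINT x|F. g x) \<in> V}"
      unfolding limitin_def by blast
    then show "\<forall>\<^sub>F n in sequentially. (LINT x|M n. g x) \<in> V"
      by (rule eventually_mono) simp
  qed
next
  assume R: ?R
  have "\<forall>\<^sub>F n in sequentially. M n \<in> U" if "openin weak_topology U" "F \<in> U" for U
    using that unfolding weak_topology_def openin_topology_generated_by_iff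
  proof (induction U rule: generate_topology_on.induct)
    case (Int a b)
    then show ?case by (auto simp: eventually_conj_iff)
  next
    case (UN K)
    then obtain k where k: "k \<in> K" "F \<in> k" by blast
    with UN have "\<forall>\<^sub>F n in sequentially. M n \<in> k" by blast
    then show ?case by (rule eventually_mono) (use k in blast)
  next
    case (Basis s)
    then obtain g :: "'a \<Rightarrow> real" and V where
      "s = {F \<in> borel_prob. (LINT x|F. g x) \<in> V}" "open V"
      "continuous_on UNIV g \<and> bounded (range g)" by blast
    moreover from this R Basis have "\<forall>\<^sub>F n in sequentially. (LINT x|M n. g x) \<in> V"
      by (intro topological_tendstoD) auto
    ultimately show ?case using M by (auto elim: eventually_mono)
  qed simp
  then show ?L using F by (simp add: limitin_def)
qed

end

theory Submission
  imports Defs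
begin

text \<open>
Write \<open>m\<^sub>G\<close> for the mixture density of a mixing distribution \<open>G\<close>, \<open>F\<close> for the true mixing distribution
and \<open>G\<^sub>n\<close> for the distribution with density \<open>f\<^sub>n\<close>. The proof compares mixtures on the sample space:
the expectation of \<open>\<integral> \<bar>m\<^sub>F - m\<^sub>G\<^sub>n\<bar> d\<nu>\<close> tends to 0. By convexity, and because reordering
i.i.d. observations does not change their law, the same bound holds for the permutation average, and Markov's
inequality gives convergence in probability of its mixture in \<open>L\<^sup>1\<close>. Convergence in
probability being the aim, expectations suffice throughout.

\<^emph>\<open>From mixtures to mixing distributions.\<close> By (A4), mixing distributions whose mixtures are close
to \<open>m\<^sub>F\<close> are tight; by (A3) and Fatou's lemma every weak limit point has the mixture \<open>m\<^sub>F\<close>; by (A2) it is \<open>F\<close>.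
So every weak neighbourhood of \<open>F\<close> contains all \<open>G\<close> with \<open>\<integral> \<bar>m\<^sub>F - m\<^sub>G\<bar> d\<nu>\<close> small
(lemma \<open>weak_neighbourhood_contains_l1_ball\<close>, based on \<open>prokhorov_subsequence\<close>).

\<^emph>\<open>Why the risk is almost decreasing.\<close> The risk is the expectation of
\<open>KL(F, G\<^sub>n) = \<integral> m\<^sub>F ln (m\<^sub>F / m\<^sub>G\<^sub>n) d\<nu>\<close>, which controls the \<open>L\<^sup>1\<close> distance. One step moves the
mixture linearly, by the weight \<open>w\<close>, towards that of the posterior. Expanding the logarithm, the
first-order change of the risk is \<open>- w * (J - 1)\<close> with \<open>J \<ge> 1\<close> by the Cauchy-Schwarz inequality
(\<open>integral_posterior_ratio_ge\<close>), and the error is at most \<open>w\<^sup>2 / (1 - w) * (1 + B)\<close>. The uniform constant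
comes from (A5), which extends from points to mixtures by Jensen's inequality (\<open>ratio_mix\<close>). The
errors are summable, so it is enough that the risk comes arbitrarily close to 0 at late times.

\<^emph>\<open>Why the risk comes close to 0.\<close> The logarithm of the density of \<open>G\<^sub>n\<close> with respect
to the initial distribution, averaged over \<open>F\<close>, grows on average in each step by \<open>w\<close> times the expected
chi-square divergence of \<open>m\<^sub>F\<close> from \<open>m\<^sub>G\<^sub>n\<close>, which dominates the risk, up to a summable error. If this
average stays bounded, then divergence of the sum of the weights forces the risk to be small infinitely often.
It stays bounded if \<open>F\<close> has a bounded density \<open>r\<close> with respect to the initial distribution. In general \<open>r\<close> is
truncated at a high level, and the mass lost costs at most \<open>B\<close> times its amount, again by (A5)
(\<open>KL_le_truncated_gain\<close>, \<open>ex_truncated_drift\<close>).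
\<close>

section \<open>Compactness of tight sequences\<close>

text \<open>The digits 0 and 1 in base 3 leave gaps in the line: the tail behind a digit is worth at most half
of that digit. Nearby values therefore share their leading digits.\<close>

lemma ternary_expansion_separation:
  fixes b c :: "nat \<Rightarrow> real"
  assumes b: "\<And>i. b i \<in> {0, 1}" and c: "\<And>i. c i \<in> {0, 1}" and n: "b n \<noteq> c n"
  shows "(1/3)^n / 2 \<le> \<bar>(\<Sum>i. b i * (1/3)^i) - (\<Sum>i. c i * (1/3)^i)\<bar>"
proof -
  define e where "e i = b i - c i" for i
  have e1: "\<bar>e i\<bar> \<le> 1" for i
    using b[of i] c[of i] by (auto simp: e_def)
  have geo: "summable (\<lambda>i. (1/3::real)^i)"
    by (rule summable_geometric) simp
  have bound: "norm (b i * (1/3)^i) \<le> (1/3)^i" "norm (c i * (1/3)^i) \<le> (1/3)^i" for i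
    using b[of i] c[of i] by auto
  have sb: "summable (\<lambda>i. b i * (1/3)^i)" "summable (\<lambda>i. c i * (1/3)^i)"
    by (rule summable_comparison_test'[OF geo, of 0], rule bound)+
  have se: "summable (\<lambda>i. e i * (1/3)^i)"
    using summable_diff[OF sb] by (simp add: e_def algebra_simps)
  define m where "m = (LEAST i. b i \<noteq> c i)"
  have m: "b m \<noteq> c m"
    unfolding m_def by (rule LeastI[of "\<lambda>i. b i \<noteq> c i", OF n])
  have "m \<le> n"
    unfolding m_def by (rule Least_le[of "\<lambda>i. b i \<noteq> c i", OF n])
  have below: "e i = 0" if "i < m" for i
    using not_less_Least[of i "\<lambda>i. b i \<noteq> c i"] that by (simp add: e_def m_def)
  have "\<bar>e m\<bar> = 1"
    using b[of m] c[of m] m by (auto simp: e_def)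
  have split: "(\<Sum>i. e i * (1/3)^i) = (\<Sum>i. e (i + Suc m) * (1/3)^(i + Suc m)) + e m * (1/3)^m"
    using suminf_split_initial_segment[OF se, of "Suc m"] below by simp
  have tail: "\<bar>\<Sum>i. e (i + Suc m) * (1/3)^(i + Suc m)\<bar> \<le> (1/3)^m / 2"
  proof -
    have "summable (\<lambda>i. (1/3::real)^i * (1/3)^Suc m)"
      using geo by (rule summable_mult2)
    moreover have "norm (e (i + Suc m) * (1/3)^(i + Suc m)) \<le> (1/3)^i * (1/3)^Suc m" for i
      using mult_right_mono[OF e1[of "i + Suc m"], of "(1/3)^(i + Suc m)"]
      by (simp add: abs_mult power_add)
    ultimately have "\<bar>\<Sum>i. e (i + Suc m) * (1/3)^(i + Suc m)\<bar> \<le> (\<Sum>i. (1/3::real)^i * (1/3)^Suc m)"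
      unfolding real_norm_def[symmetric] by (intro norm_suminf_le)
    also have "\<dots> = (1/3)^m / 2"
      using suminf_mult2[OF geo, of "(1/3)^Suc m"] suminf_geometric[of "1/3::real"] by simp
    finally show ?thesis .
  qed
  have "(1/3::real)^n / 2 \<le> (1/3)^m / 2"
    using \<open>m \<le> n\<close> by (simp add: power_decreasing)
  also have "\<dots> \<le> \<bar>\<Sum>i. e i * (1/3)^i\<bar>"
  proof -
    have "\<bar>e m * (1/3)^m\<bar> = (1/3)^m"
      using \<open>\<bar>e m\<bar> = 1\<close> by (simp add: abs_mult)
    then show ?thesis
      using tail unfolding split by arith
  qed
  also have "(\<Sum>i. e i * (1/3)^i) = (\<Sum>i. b i * (1/3)^i) - (\<Sum>i. c i * (1/3)^i)"
    unfolding suminf_diff[OF sb] by (simp add: e_def algebra_simps)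
  finally show ?thesis .
qed

text \<open>Recording in base 3 which sets of a countable base contain a point codes the space by real numbers.
The code is only Borel measurable, but its inverse extends to limits: if \<open>t\<close> is the limit of
codes of points tending to \<open>x\<close> and of points tending to \<open>y\<close>, then the two sequences eventually
agree on membership in any given base set, and this rules out \<open>x \<noteq> y\<close>. The third property says
that the closure of the graph of the code is the graph of a partial decoding function.\<close>

lemma ex_ternary_code:
  obtains \<sigma> :: "'a::{metric_space, second_countable_topology} \<Rightarrow> real"
  where "\<sigma> \<in> borel_measurable borel" "\<And>x. \<sigma> x \<in> {0..2}"
    "\<And>t x y. (t, x) \<in> closure (range (\<lambda>x. (\<sigma> x, x))) \<Longrightarrow> (t, y) \<in> closure (range (\<lambda>x. (\<sigma> x, x))) \<Longrightarrow> x = y"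
proof -
  obtain B :: "'a set set" where B: "countable B" "topological_basis B"
    using ex_countable_basis by blast
  have "B \<noteq> {}"
    using topological_basisE[OF B(2) open_UNIV UNIV_I] by blast
  define U where "U = from_nat_into B"
  have UB: "U n \<in> B" for n
    using \<open>B \<noteq> {}\<close> by (simp add: U_def from_nat_into)
  then have openU: "open (U n)" for n
    using B(2) topological_basis_open by blast
  define \<sigma> where "\<sigma> x = (\<Sum>n. indicator (U n) x * (1/3::real)^n)" for x
  have geo: "summable (\<lambda>i. (1/3::real)^i)"
    by (rule summable_geometric) simp
  have sb: "summable (\<lambda>n. indicator (U n) x * (1/3::real)^n)" for x
    by (intro summable_comparison_test'[OF geo, of 0]) (simp add: indicator_def)
  have meas: "\<sigma> \<in> borel_measurable borel"
  proof -
    have [measurable]: "U n \<in> sets borel" for n using openU by simp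
    show ?thesis unfolding \<sigma>_def[abs_def] by measurable
  qed
  have range: "\<sigma> x \<in> {0..2}" for x
  proof -
    have "\<sigma> x \<le> (\<Sum>i. (1/3::real)^i)"
      unfolding \<sigma>_def by (intro suminf_le sb geo) (simp add: indicator_def)
    moreover have "0 \<le> \<sigma> x"
      unfolding \<sigma>_def by (intro suminf_nonneg sb) simp
    ultimately show ?thesis
      using suminf_geometric[of "1/3::real"] by simp
  qed
  have uniq: "x = y"
    if x: "(t, x) \<in> closure (range (\<lambda>x. (\<sigma> x, x)))" and y: "(t, y) \<in> closure (range (\<lambda>x. (\<sigma> x, x)))"
    for t x y
  proof (rule ccontr)
    assume "x \<noteq> y"
    define d where "d = dist x y / 2"
    have "d > 0" using \<open>x \<noteq> y\<close> by (simp add: d_def)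
    obtain V where V: "V \<in> B" "x \<in> V" "V \<subseteq> ball x d"
      using topological_basisE[OF B(2) open_ball[of x d]] \<open>d > 0\<close> by (metis centre_in_ball)
    obtain n where n: "V = U n"
      using V(1) B(1) from_nat_into_surj unfolding U_def by metis
    define \<epsilon> where "\<epsilon> = (1/3::real)^n / 4"
    have "\<epsilon> > 0" by (simp add: \<epsilon>_def)
    have hit: "\<exists>u. \<bar>\<sigma> u - t\<bar> < \<epsilon> \<and> u \<in> W"
      if "(t, z) \<in> closure (range (\<lambda>x. (\<sigma> x, x)))" "open W" "z \<in> W" for z W
    proof -
      have "open (ball t \<epsilon> \<times> W)"
        using \<open>open W\<close> by (simp add: open_Times)
      moreover have "(t, z) \<in> (ball t \<epsilon> \<times> W) \<inter> closure (range (\<lambda>x. (\<sigma> x, x)))"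
        using that \<open>\<epsilon> > 0\<close> by simp
      ultimately have "(ball t \<epsilon> \<times> W) \<inter> range (\<lambda>x. (\<sigma> x, x)) \<noteq> {}"
        using open_Int_closure_eq_empty by blast
      then show ?thesis
        by (auto simp: dist_real_def abs_minus_commute)
    qed
    obtain u where u: "\<bar>\<sigma> u - t\<bar> < \<epsilon>" "u \<in> U n"
      using hit[OF x openU[of n]] V(2) n by blast
    obtain v where v: "\<bar>\<sigma> v - t\<bar> < \<epsilon>" "dist y v < d"
      using hit[OF y open_ball[of y d]] \<open>d > 0\<close> by auto
    have "v \<notin> U n"
    proof
      assume "v \<in> U n"
      then have "dist x v < d" using V n by auto
      with v(2) show False
        using dist_triangle2[of x y v] by (simp add: d_def)
    qed
    with u(2) have "(1/3::real)^n / 2 \<le> \<bar>\<sigma> u - \<sigma> v\<bar>"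
      unfolding \<sigma>_def by (intro ternary_expansion_separation) (auto simp: indicator_def)
    with u(1) v(1) show False
      unfolding \<epsilon>_def by arith
  qed
  show ?thesis
    using that[OF meas range uniq] .
qed

text \<open>The compactness half of Prokhorov's theorem, for a separable metric space. The code
reduces it to Helly's selection theorem on the line: the image measures on \<open>[0, 2]\<close> have a weakly
convergent subsequence, and the limit is carried back by the decoding function \<open>\<phi>\<close>. On the closure
\<open>C j\<close> of the codes of a compact set \<open>K j\<close> the decoding is continuous, because its graph is a closed
part of \<open>C j \<times> K j\<close>, and tightness leaves little mass outside \<open>C j\<close>, before and in the limit.\<close>

lemma prokhorov_subsequence:
  fixes M :: "nat \<Rightarrow> ('a::{metric_space, second_countable_topology}) measure"
  assumes M: "\<And>n. M n \<in> borel_prob"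
    and tight: "\<And>\<eta>. \<eta> > 0 \<Longrightarrow> \<exists>K. compact K \<and> (\<forall>\<^sub>F n in sequentially. 1 - \<eta> \<le> measure (M n) K)"
  obtains r N where "strict_mono (r :: nat \<Rightarrow> nat)" "N \<in> borel_prob"
    "\<And>g :: 'a \<Rightarrow> real. continuous_on UNIV g \<Longrightarrow> bounded (range g) \<Longrightarrow>
       (\<lambda>n. LINT x|M (r n). g x) \<longlonglongrightarrow> (LINT x|N. g x)"
proof -
  obtain \<sigma> :: "'a \<Rightarrow> real" where meas[measurable]: "\<sigma> \<in> borel_measurable borel"
    and range: "\<And>x. \<sigma> x \<in> {0..2}"
    and uniq: "\<And>t x y. (t, x) \<in> closure (range (\<lambda>x. (\<sigma> x, x))) \<Longrightarrow>
      (t, y) \<in> closure (range (\<lambda>x. (\<sigma> x, x))) \<Longrightarrow> x = y"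
    by (rule ex_ternary_code) (rule that)
  define \<Gamma> where "\<Gamma> = closure (range (\<lambda>x. (\<sigma> x, x)))"
  have self: "(\<sigma> x, x) \<in> \<Gamma>" for x
    unfolding \<Gamma>_def by (rule subsetD[OF closure_subset rangeI])
  have prob: "prob_space (M n)" and sets[measurable_cong, simp]: "sets (M n) = sets borel" for n
    using M[of n] by (auto simp: borel_prob_def)
  have space[simp]: "space (M n) = UNIV" for n
    using sets_eq_imp_space_eq[OF sets] by simp
  define H where "H n = distr (M n) borel \<sigma>" for n
  have rd: "real_distribution (H n)" for n
  proof -
    interpret prob_space "M n" by (rule prob)
    show ?thesis
      unfolding H_def by (rule real_distribution_distr) simp
  qed
  have "tight H"
    unfolding tight_def
  proof (intro conjI allI impI)
    fix \<epsilon> :: real assume "\<epsilon> > 0"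
    have "measure (H n) {-1<..2} = 1" for n
    proof -
      have "measure (H n) {-1<..2} = measure (M n) (\<sigma> -` {-1<..2} \<inter> space (M n))"
        unfolding H_def by (rule measure_distr) simp_all
      also have "\<sigma> -` {-1<..2} \<inter> space (M n) = space (M n)"
        using greaterThanAtMost_iff range by fastforce
      finally show ?thesis
        using prob_space.prob_space[OF prob] by simp
    qed
    with \<open>\<epsilon> > 0\<close> show "\<exists>a b. a < b \<and> (\<forall>n. 1 - \<epsilon> < measure (H n) {a<..b})"
      by (intro exI[of _ "-1"] exI[of _ "2"]) simp
  qed (rule rd)
  from tight_imp_convergent_subsubsequence[OF this strict_mono_id]
  obtain r N' where r: "strict_mono r" and N': "real_distribution N'"
    and weak: "weak_conv_m (\<lambda>n. H (r n)) N'"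
    unfolding o_def id_def by blast
  interpret N': real_distribution N' by (rule N')
  have conv: "(\<lambda>n. LINT t|H (r n). h t) \<longlonglongrightarrow> (LINT t|N'. h t)"
    if "continuous_on UNIV h" "\<And>t. \<bar>h t\<bar> \<le> b" for h :: "real \<Rightarrow> real" and b
    by (rule weak_conv_imp_integral_bdd_continuous_conv[OF rd N' weak])
      (use that in \<open>simp_all add: continuous_on_eq_continuous_at\<close>)
  have distr_int: "(LINT t|H n. h t) = (LINT x|M n. h (\<sigma> x))"
    if "h \<in> borel_measurable borel" for h :: "real \<Rightarrow> real" and n
    unfolding H_def using that by (intro integral_distr) simp_all
  have "\<exists>K. \<forall>j. compact (K j) \<and> (\<forall>\<^sub>F n in sequentially. 1 - 1 / real (Suc j) \<le> measure (M n) (K j))"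
    using tight[of "1 / real (Suc j)" for j] by (intro choice allI) simp
  then obtain K where K: "\<And>j. compact (K j)"
    and massK: "\<And>j. \<forall>\<^sub>F n in sequentially. 1 - 1 / real (Suc j) \<le> measure (M n) (K j)"
    by blast
  have [measurable]: "K j \<in> sets borel" for j
    using compact_imp_closed[OF K] by simp
  define C where "C j = closure (\<sigma> ` K j)" for j
  have closedC: "closed (C j)" for j by (simp add: C_def)
  have [measurable]: "C j \<in> sets borel" for j using closedC by simp
  have inC: "\<exists>x\<in>K j. (t, x) \<in> \<Gamma>" if "t \<in> C j" for t j
  proof -
    from that obtain s where s: "\<And>i. s i \<in> \<sigma> ` K j" "s \<longlonglongrightarrow> t"
      unfolding C_def closure_sequential by blast
    then have "\<exists>x. \<forall>i. x i \<in> K j \<and> s i = \<sigma> (x i)"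
      by (intro choice) blast
    then obtain x where x: "\<And>i. x i \<in> K j" "\<And>i. s i = \<sigma> (x i)"
      by blast
    have "seq_compact (K j)"
      using K by (simp add: compact_eq_seq_compact_metric)
    then have "\<exists>l\<in>K j. \<exists>q::nat\<Rightarrow>nat. strict_mono q \<and> (x \<circ> q) \<longlonglongrightarrow> l"
      unfolding seq_compact_def by (elim allE[of _ x] impE) (simp add: x(1))
    then obtain l and q :: "nat \<Rightarrow> nat" where l: "l \<in> K j" "strict_mono q" "(x \<circ> q) \<longlonglongrightarrow> l"
      by (elim bexE exE conjE)
    have "(\<lambda>i. (\<sigma> (x (q i)), x (q i))) \<longlonglongrightarrow> (t, l)"
      using l LIMSEQ_subseq_LIMSEQ[OF s(2) l(2)] by (intro tendsto_Pair) (auto simp: o_def x(2))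
    then have "(t, l) \<in> \<Gamma>"
      unfolding \<Gamma>_def closure_sequential by (intro exI[of _ "\<lambda>i. (\<sigma> (x (q i)), x (q i))"]) simp
    with l show ?thesis by blast
  qed
  define \<phi> where "\<phi> t = (if t \<in> (\<Union>j. C j) then THE x. (t, x) \<in> \<Gamma> else undefined)" for t
  have \<phi>: "\<phi> t = x" if "t \<in> C j" "(t, x) \<in> \<Gamma>" for t x j
    using that uniq unfolding \<phi>_def \<Gamma>_def by (auto intro!: the_equality)
  have \<sigma>C: "\<sigma> x \<in> C j" if "x \<in> K j" for x j
    using that closure_subset[of "\<sigma> ` K j"] by (auto simp: C_def)
  have \<phi>\<sigma>: "\<phi> (\<sigma> x) = x" if "x \<in> K j" for x j
    using \<phi>[OF \<sigma>C[OF that] self] .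
  have \<phi>K: "\<phi> t \<in> K j" "(t, \<phi> t) \<in> \<Gamma>" if "t \<in> C j" for t j
    using inC[OF that] \<phi>[OF that] by auto
  have compactC: "compact (C j)" for j
  proof -
    have "C j \<subseteq> {0..2}"
      unfolding C_def using range by (intro closure_minimal) auto
    then show ?thesis
      using closedC[of j] by (metis closed_Int_compact compact_Icc inf.absorb1)
  qed
  have cont: "continuous_on (C j) \<phi>" for j
    unfolding continuous_on_closed_vimage[OF closedC]
  proof (intro allI impI)
    fix A :: "'a set" assume "closed A"
    have "compact ((C j \<times> K j) \<inter> (\<Gamma> \<inter> UNIV \<times> A))"
      using \<open>closed A\<close> by (intro compact_Int_closed compact_Times compactC K closed_Int closed_Times) (auto simp: \<Gamma>_def)
    then have "compact (fst ` ((C j \<times> K j) \<inter> (\<Gamma> \<inter> UNIV \<times> A)))"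
      by (intro compact_continuous_image continuous_intros)
    also have "fst ` ((C j \<times> K j) \<inter> (\<Gamma> \<inter> UNIV \<times> A)) = \<phi> -` A \<inter> C j"
    proof (intro equalityI subsetI)
      fix t assume "t \<in> \<phi> -` A \<inter> C j"
      then have "(t, \<phi> t) \<in> (C j \<times> K j) \<inter> (\<Gamma> \<inter> UNIV \<times> A)"
        using \<phi>K by auto
      then show "t \<in> fst ` ((C j \<times> K j) \<inter> (\<Gamma> \<inter> UNIV \<times> A))"
        by (metis fst_conv imageI)
    qed (use \<phi> in auto)
    finally show "closed (\<phi> -` A \<inter> C j)"
      by (rule compact_imp_closed)
  qed
  have [measurable]: "\<phi> \<in> borel_measurable borel"
  proof (rule measurable_piecewise_restrict[of "insert (- (\<Union>j. C j)) (range C)"])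
    show "\<phi> \<in> borel_measurable (restrict_space borel \<Omega>)" if \<Omega>: "\<Omega> \<in> insert (- (\<Union>j. C j)) (range C)" for \<Omega>
    proof (cases "\<Omega> \<in> range C")
      case True
      then show ?thesis
        using cont by (auto intro: borel_measurable_continuous_on_restrict)
    next
      case False
      then have "\<Omega> = - (\<Union>j. C j)" using \<Omega> by blast
      then show ?thesis
        by (intro measurable_cong[THEN iffD1, OF _ measurable_const[of undefined]])
          (auto simp: \<phi>_def space_restrict_space)
    qed
  qed auto
  \<comment> \<open>The limit keeps the mass of the closed set \<open>C j\<close>, whose indicator is a decreasing limit of the continuous functions \<open>h m\<close>.\<close>
  have massC: "1 - 1 / real (Suc j) \<le> measure N' (C j)" for j
  proof (cases "C j = {}")
    case True
    then have "K j = {}" by (simp add: C_def)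
    then show ?thesis using massK[of j] True by simp
  next
    case False
    define h where "h m t = max 0 (1 - real m * infdist t (C j))" for m t
    have h01: "0 \<le> h m t" "h m t \<le> 1" for m t
      using infdist_nonneg[of t "C j"] by (auto simp: h_def)
    have h1: "h m t = 1" if "t \<in> C j" for m t
      using that by (simp add: h_def)
    have hcont: "continuous_on UNIV (h m)" for m
      unfolding h_def[abs_def] by (intro continuous_intros)
    have [measurable]: "h m \<in> borel_measurable borel" for m
      by (rule borel_measurable_continuous_onI[OF hcont])
    have "1 - 1 / real (Suc j) \<le> (LINT t|N'. h m t)" for m
    proof (rule tendsto_lowerbound[OF conv[of "h m" 1]])
      have "\<forall>\<^sub>F n in sequentially. 1 - 1 / real (Suc j) \<le> measure (M (r n)) (K j)"
        using massK[of j] r by (rule eventually_compose_filterlim[OF _ filterlim_subseq])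
      then show "\<forall>\<^sub>F n in sequentially. 1 - 1 / real (Suc j) \<le> (LINT t|H (r n). h m t)"
      proof eventually_elim
        case (elim n)
        interpret prob_space "M (r n)" by (rule prob)
        have "measure (M (r n)) (K j) = (LINT x|M (r n). indicator (K j) x)"
          by simp
        also have "\<dots> \<le> (LINT x|M (r n). h m (\<sigma> x))"
          using \<sigma>C h01 h1 by (intro integral_mono integrable_const_bound[of _ 1])
            (auto simp: indicator_def)
        also have "\<dots> = (LINT t|H (r n). h m t)"
          by (rule distr_int[symmetric]) simp
        finally show ?case using elim by simp
      qed
    qed (use h01 hcont in \<open>auto simp: abs_of_nonneg\<close>)
    moreover have "(\<lambda>m. LINT t|N'. h m t) \<longlonglongrightarrow> (LINT t|N'. indicator (C j) t)"
    proof (rule integral_dominated_convergence[where w = "\<lambda>_. 1"])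
      show "AE t in N'. (\<lambda>m. h m t) \<longlonglongrightarrow> indicator (C j) t"
      proof (rule AE_I2)
        fix t
        show "(\<lambda>m. h m t) \<longlonglongrightarrow> indicator (C j) t"
        proof (cases "t \<in> C j")
          case True
          then show ?thesis by (simp add: h_def)
        next
          case not_in: False
          then have pos: "infdist t (C j) > 0"
            using in_closed_iff_infdist_zero[OF closedC False] infdist_nonneg[of t "C j"] by force
          have "\<forall>\<^sub>F m in sequentially. 1 / infdist t (C j) < real m"
            using filterlim_real_sequentially by (simp add: filterlim_at_top_dense)
          then have "\<forall>\<^sub>F m in sequentially. h m t = 0"
            by eventually_elim (use pos in \<open>simp add: h_def field_simps\<close>)
          then show ?thesis
            using not_in by (auto intro: tendsto_eventually)
        qed
      qed
    qed (use h01 in auto)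
    ultimately have "1 - 1 / real (Suc j) \<le> (LINT t|N'. indicator (C j) t)"
      by (intro LIMSEQ_le_const) auto
    then show ?thesis by simp
  qed
  define N where "N = distr N' borel \<phi>"
  have "N \<in> borel_prob"
    unfolding N_def borel_prob_def by (auto intro!: N'.prob_space_distr)
  moreover have "(\<lambda>n. LINT x|M (r n). g x) \<longlonglongrightarrow> (LINT x|N. g x)"
    if g: "continuous_on UNIV g" and bdd: "bounded (range g)" for g :: "'a \<Rightarrow> real"
  proof (rule LIMSEQ_I)
    fix \<epsilon> :: real assume "\<epsilon> > 0"
    obtain b where b: "\<And>x. \<bar>g x\<bar> \<le> b"
      using bdd by (auto simp: bounded_iff)
    have "b \<ge> 0" using b[of undefined] by simp
    have [measurable]: "g \<in> borel_measurable borel"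
      using g by (rule borel_measurable_continuous_onI)
    have "(\<lambda>j. 2 * b / real (Suc j)) \<longlonglongrightarrow> 0"
      using tendsto_mult_right_zero[OF LIMSEQ_inverse_real_of_nat, of "2 * b"] by (simp add: divide_inverse)
    then have "\<forall>\<^sub>F j in sequentially. 2 * b / real (Suc j) < \<epsilon> / 3"
      using \<open>\<epsilon> > 0\<close> by (intro order_tendstoD) auto
    then obtain j where j: "2 * b / real (Suc j) < \<epsilon> / 3"
      by (auto simp: eventually_sequentially)
    \<comment> \<open>\<open>g \<circ> \<phi>\<close> is continuous on \<open>C j\<close> only; Tietze extends it, within the same bound, to a test function on the line.\<close>
    obtain h :: "real \<Rightarrow> real" where hcont: "continuous_on UNIV h"
      and hg: "\<And>t. t \<in> C j \<Longrightarrow> h t = g (\<phi> t)" and hb: "\<And>t. \<bar>h t\<bar> \<le> b"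
    proof (rule Tietze[of "C j" "\<lambda>t. g (\<phi> t)" UNIV b])
      show "continuous_on (C j) (\<lambda>t. g (\<phi> t))"
        by (rule continuous_on_compose2[OF g cont]) simp
      show "norm (g (\<phi> t)) \<le> b" for t using b by simp
    qed (use closedC \<open>b \<ge> 0\<close> in auto)
    have [measurable]: "h \<in> borel_measurable borel"
      using hcont by (rule borel_measurable_continuous_onI)
    have close: "\<bar>(LINT x|Q. u x) - (LINT x|Q. v x)\<bar> < \<epsilon> / 3"
      if Q: "prob_space Q" and A: "A \<in> sets Q" "1 - 1 / real (Suc j) \<le> measure Q A"
        and [measurable]: "u \<in> borel_measurable Q" "v \<in> borel_measurable Q"
        and uv: "\<And>x. \<bar>u x\<bar> \<le> b" "\<And>x. \<bar>v x\<bar> \<le> b" "\<And>x. x \<in> A \<Longrightarrow> u x = v x"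
      for Q :: "'c measure" and A and u v :: "'c \<Rightarrow> real"
    proof -
      interpret prob_space Q by (rule Q)
      have [measurable]: "A \<in> sets Q" by (rule A)
      have iu: "integrable Q u" "integrable Q v"
        using uv by (auto intro!: integrable_const_bound[of _ b])
      have "\<bar>(LINT x|Q. u x) - (LINT x|Q. v x)\<bar> = \<bar>LINT x|Q. u x - v x\<bar>"
        using iu by simp
      also have "\<dots> \<le> (LINT x|Q. \<bar>u x - v x\<bar>)"
        by (rule integral_abs_bound)
      also have "\<dots> \<le> (LINT x|Q. 2 * b * indicator (space Q - A) x)"
      proof (rule integral_mono)
        show "integrable Q (\<lambda>x. 2 * b * indicator (space Q - A) x)"
          by (intro integrable_mult_right) (auto intro!: integrable_const_bound[of _ 1] simp: indicator_def)
        show "\<bar>u x - v x\<bar> \<le> 2 * b * indicator (space Q - A) x" if "x \<in> space Q" for x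
          using uv(1)[of x] uv(2)[of x] uv(3)[of x] that by (auto simp: indicator_def)
      qed (use iu in auto)
      also have "\<dots> = 2 * b * measure Q (space Q - A)"
        by simp
      also have "\<dots> \<le> 2 * b * (1 / real (Suc j))"
        using A \<open>b \<ge> 0\<close> by (intro mult_left_mono) (auto simp: prob_compl)
      finally show ?thesis using j by simp
    qed
    have limN: "\<bar>(LINT t|N'. h t) - (LINT x|N. g x)\<bar> < \<epsilon> / 3"
    proof -
      have "(LINT x|N. g x) = (LINT t|N'. g (\<phi> t))"
        unfolding N_def by (intro integral_distr) auto
      with close[OF N'.prob_space_axioms _ massC, of h "\<lambda>t. g (\<phi> t)"] show ?thesis
        using hb b hg by auto
    qed
    have "(\<lambda>n. LINT t|H (r n). h t) \<longlonglongrightarrow> (LINT t|N'. h t)"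
      by (rule conv[OF hcont hb])
    then have "\<forall>\<^sub>F n in sequentially. dist (LINT t|H (r n). h t) (LINT t|N'. h t) < \<epsilon> / 3"
      by (rule tendstoD) (use \<open>\<epsilon> > 0\<close> in simp)
    moreover have "\<forall>\<^sub>F n in sequentially. 1 - 1 / real (Suc j) \<le> measure (M (r n)) (K j)"
      using massK[of j] r by (rule eventually_compose_filterlim[OF _ filterlim_subseq])
    ultimately have "\<forall>\<^sub>F n in sequentially. norm ((LINT x|M (r n). g x) - (LINT x|N. g x)) < \<epsilon>"
    proof eventually_elim
      case (elim n)
      have "\<bar>(LINT x|M (r n). g x) - (LINT x|M (r n). h (\<sigma> x))\<bar> < \<epsilon> / 3"
        using close[OF prob _ elim(2), of g "\<lambda>x. h (\<sigma> x)"] b hb \<sigma>C hg \<phi>\<sigma> by auto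
      moreover have "(LINT t|H (r n). h t) = (LINT x|M (r n). h (\<sigma> x))"
        by (rule distr_int) simp
      ultimately show ?case
        using elim(1) limN unfolding dist_real_def real_norm_def by arith
    qed
    then show "\<exists>no. \<forall>n\<ge>no. norm ((LINT x|M (r n). g x) - (LINT x|N. g x)) < \<epsilon>"
      by (simp add: eventually_sequentially)
  qed
  ultimately show ?thesis
    by (rule that[OF r])
qed

section \<open>Mixtures and the ratio bound\<close>

text \<open>Rounding \<open>\<theta>\<close> to the first point of a dense sequence within \<open>1 / (m + 1)\<close> turns \<open>p\<close> into a countable
case distinction, and continuity in \<open>\<theta>\<close> recovers \<open>p\<close> as \<open>m\<close> tends to infinity.\<close>

lemma caratheodory_measurable:
  fixes p :: "'x \<Rightarrow> 't::{metric_space, second_countable_topology} \<Rightarrow> real"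
  assumes meas[measurable]: "\<And>\<theta>. (\<lambda>x. p x \<theta>) \<in> borel_measurable N"
    and cont: "\<And>x. continuous_on UNIV (p x)"
  shows "(\<lambda>(x, \<theta>). p x \<theta>) \<in> borel_measurable (N \<Otimes>\<^sub>M borel)"
proof -
  obtain D :: "'t set" where D: "countable D" "\<And>X. open X \<Longrightarrow> X \<noteq> {} \<Longrightarrow> \<exists>d\<in>D. d \<in> X"
    by (rule countable_dense_setE) (rule that)
  have "D \<noteq> {}" using D(2)[of UNIV] by auto
  define q where "q = from_nat_into D"
  define ix where "ix m \<theta> = (LEAST i. dist \<theta> (q i) < 1 / real (Suc m))" for m \<theta>
  have ix: "dist \<theta> (q (ix m \<theta>)) < 1 / real (Suc m)" for m \<theta>
  proof -
    obtain d where d: "d \<in> D" "dist \<theta> d < 1 / real (Suc m)"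
      using D(2)[OF open_ball[of \<theta> "1 / real (Suc m)"]] by fastforce
    then obtain i where "q i = d"
      using from_nat_into_surj[OF D(1)] unfolding q_def by metis
    then show ?thesis
      unfolding ix_def using d(2) LeastI[of "\<lambda>i. dist \<theta> (q i) < 1 / real (Suc m)" i] by blast
  qed
  have [measurable]: "ix m \<in> measurable borel (count_space UNIV)" for m
    unfolding ix_def[abs_def] by measurable
  have approx: "(\<lambda>z. p (fst z) (q (ix m (snd z)))) \<in> borel_measurable (N \<Otimes>\<^sub>M borel)" for m
    by (rule measurable_compose_countable[where f = "\<lambda>i z. p (fst z) (q i)"]) measurable
  have "(\<lambda>z. p (fst z) (snd z)) \<in> borel_measurable (N \<Otimes>\<^sub>M borel)"
  proof (rule borel_measurable_LIMSEQ_real[OF _ approx])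
    fix z :: "'x \<times> 't"
    have "(\<lambda>m. dist (q (ix m (snd z))) (snd z)) \<longlonglongrightarrow> 0"
    proof (rule tendsto_sandwich[of "\<lambda>_. 0"])
      show "\<forall>\<^sub>F m in sequentially. dist (q (ix m (snd z))) (snd z) \<le> 1 / real (Suc m)"
        using ix[of "snd z"] by (intro always_eventually allI less_imp_le) (simp add: dist_commute)
      show "(\<lambda>m. 1 / real (Suc m)) \<longlonglongrightarrow> 0"
        using LIMSEQ_inverse_real_of_nat by (simp add: inverse_eq_divide)
    qed auto
    then have "(\<lambda>m. q (ix m (snd z))) \<longlonglongrightarrow> snd z"
      by (rule tendsto_dist_iff[THEN iffD2])
    then show "(\<lambda>m. p (fst z) (q (ix m (snd z)))) \<longlonglongrightarrow> p (fst z) (snd z)"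
      by (rule continuous_on_tendsto_compose[OF cont]) simp_all
  qed
  then show ?thesis
    by (simp add: case_prod_unfold)
qed

lemma (in prob_space) nn_integral_power2_le:
  assumes [measurable]: "f \<in> borel_measurable M"
  shows "(\<integral>\<^sup>+x. f x \<partial>M)\<^sup>2 \<le> (\<integral>\<^sup>+x. (f x)\<^sup>2 \<partial>M)"
  using Cauchy_Schwarz_nn_integral[of f M "\<lambda>_. 1"] by (simp add: emeasure_space_1)

text \<open>Jensen's inequality for the convex function \<open>1 / t\<close>, with values in \<open>[0, \<infinity>]\<close>, by integration of the
tangent inequality at the mean.\<close>

lemma (in prob_space) inverse_nn_integral_le:
  fixes f :: "'a \<Rightarrow> ennreal"
  assumes [measurable]: "f \<in> borel_measurable M"
  shows "inverse (\<integral>\<^sup>+x. f x \<partial>M) \<le> (\<integral>\<^sup>+x. inverse (f x) \<partial>M)"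
proof (cases "\<integral>\<^sup>+x. f x \<partial>M")
  case (real c)
  show ?thesis
  proof (cases "c = 0")
    case True
    then have "AE x in M. f x = 0"
      using real by (simp add: nn_integral_0_iff_AE)
    then have "(\<integral>\<^sup>+x. inverse (f x) \<partial>M) = (\<integral>\<^sup>+x. \<top> \<partial>M)"
      by (intro nn_integral_cong_AE) auto
    then show ?thesis by (simp add: emeasure_space_1)
  next
    case False
    then have "c > 0" using real by simp
    have tangent: "ennreal (2 / c) \<le> inverse t + t * ennreal (1 / c^2)" for t
    proof (cases t)
      case (real s)
      show ?thesis
      proof (cases "s = 0")
        case False
        then have "s > 0" using real by simp
        have "0 \<le> (s - c)\<^sup>2 / (s * c^2)" using \<open>s > 0\<close> by simp
        also have "\<dots> = 1 / s + s * (1 / c^2) - 2 / c"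
          using \<open>s > 0\<close> \<open>c > 0\<close> by (simp add: field_simps power2_eq_square)
        finally show ?thesis
          using real \<open>s > 0\<close> \<open>c > 0\<close>
          by (simp add: inverse_ennreal ennreal_mult[symmetric] ennreal_plus[symmetric] inverse_eq_divide
              ennreal_le_iff del: ennreal_plus)
      qed (use real in simp)
    qed (use \<open>c > 0\<close> in \<open>simp add: ennreal_top_mult\<close>)
    have "ennreal (2 / c) = (\<integral>\<^sup>+x. ennreal (2 / c) \<partial>M)"
      by (simp add: emeasure_space_1)
    also have "\<dots> \<le> (\<integral>\<^sup>+x. inverse (f x) + f x * ennreal (1 / c^2) \<partial>M)"
      by (intro nn_integral_mono tangent)
    also have "\<dots> = (\<integral>\<^sup>+x. inverse (f x) \<partial>M) + ennreal c * ennreal (1 / c^2)"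
      using real by (simp add: nn_integral_add nn_integral_multc)
    also have "ennreal c * ennreal (1 / c^2) = ennreal (1 / c)"
      using \<open>c > 0\<close> by (simp add: ennreal_mult[symmetric] power2_eq_square)
    also have "ennreal (2 / c) = ennreal (1 / c) + ennreal (1 / c)"
      using \<open>c > 0\<close> by (simp add: ennreal_plus[symmetric] del: ennreal_plus)
    finally have "ennreal (1 / c) + ennreal (1 / c) \<le> ennreal (1 / c) + (\<integral>\<^sup>+x. inverse (f x) \<partial>M)"
      by (simp only: add.commute)
    then have "ennreal (1 / c) \<le> (\<integral>\<^sup>+x. inverse (f x) \<partial>M)"
      by (simp add: ennreal_add_left_cancel_le)
    then show ?thesis
      using real \<open>c > 0\<close> by (simp add: inverse_ennreal inverse_eq_divide)
  qed
qed simp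

lemma nn_integral_eq_1_if_density_in_borel_prob:
  assumes "density M h \<in> borel_prob" "h \<in> borel_measurable M"
  shows "(\<integral>\<^sup>+x. h x \<partial>M) = 1"
proof -
  have "(\<integral>\<^sup>+x. h x \<partial>M) = (\<integral>\<^sup>+x. h x * indicator (space M) x \<partial>M)"
    by (intro nn_integral_cong) simp
  also have "\<dots> = emeasure (density M h) (space (density M h))"
    using assms(2) by (simp add: emeasure_density)
  also have "\<dots> = 1"
    using assms(1) by (intro prob_space.emeasure_space_1) (simp add: borel_prob_def)
  finally show ?thesis .
qed

locale mixture_model =
  fixes \<nu> :: "'x measure" and p :: "'x \<Rightarrow> 't::{metric_space, second_countable_topology} \<Rightarrow> real"
  assumes nu: "sigma_finite_measure \<nu>"
    and sampling_density: "\<And>\<theta>. is_density \<nu> (\<lambda>x. p x \<theta>)"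
    and cont: "\<And>x. bounded (range (p x)) \<and> continuous_on UNIV (p x)"
begin

sublocale nu: sigma_finite_measure \<nu> by (rule nu)

definition law :: "'t measure \<Rightarrow> 'x measure" where
  "law G = density \<nu> (\<lambda>x. ennreal (mixture p G x))"

lemma p_nonneg [simp]: "0 \<le> p x \<theta>"
  using sampling_density[of \<theta>] by (auto simp: is_density_def)

lemma nn_integral_p: "(\<integral>\<^sup>+x. ennreal (p x \<theta>) \<partial>\<nu>) = 1"
  using sampling_density[of \<theta>] by (auto simp: is_density_def)

lemma measurable_p [measurable (raw)]:
  assumes [measurable]: "f \<in> N \<rightarrow>\<^sub>M \<nu>" "g \<in> N \<rightarrow>\<^sub>M borel"
  shows "(\<lambda>z. p (f z) (g z)) \<in> borel_measurable N"
proof -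
  have [measurable]: "(\<lambda>(x, \<theta>). p x \<theta>) \<in> borel_measurable (\<nu> \<Otimes>\<^sub>M borel)"
    using cont sampling_density by (intro caratheodory_measurable) (auto simp: is_density_def)
  have "(\<lambda>z. (\<lambda>(x, \<theta>). p x \<theta>) (f z, g z)) \<in> borel_measurable N"
    by measurable
  then show ?thesis by simp
qed

lemma measurable_p_param [measurable]: "p x \<in> borel_measurable borel"
  using cont by (intro borel_measurable_continuous_onI) blast

lemma ex_p_bound: "\<exists>b\<ge>0. \<forall>\<theta>. p x \<theta> \<le> b"
proof -
  obtain b where "\<And>\<theta>. \<bar>p x \<theta>\<bar> \<le> b"
    using cont[of x] by (auto simp: bounded_iff)
  then have "\<And>\<theta>. p x \<theta> \<le> max b 0"
    by (simp add: le_max_iff_disj)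
  then show ?thesis
    by (intro exI[of _ "max b 0"]) auto
qed

lemma borel_probD:
  assumes "G \<in> borel_prob"
  shows "prob_space G" "sets G = sets borel" "space G = UNIV"
  using assms sets_eq_imp_space_eq[of G borel] by (auto simp: borel_prob_def)

lemma integrable_p:
  assumes "finite_measure G" "sets G = sets borel"
  shows "integrable G (p x)"
proof -
  interpret finite_measure G by (rule assms)
  note [measurable_cong] = assms(2)
  obtain b where "\<forall>\<theta>. p x \<theta> \<le> b" using ex_p_bound by blast
  then show ?thesis
    by (intro integrable_const_bound[of _ b]) auto
qed

lemma mix_nonneg [simp]: "0 \<le> mixture p G x"
  unfolding mixture_def by simp

lemma ennreal_mix:
  assumes "G \<in> borel_prob"
  shows "ennreal (mixture p G x) = (\<integral>\<^sup>+\<theta>. ennreal (p x \<theta>) \<partial>G)"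
  using borel_probD[OF assms] unfolding mixture_def
  by (subst nn_integral_eq_integral) (auto intro!: integrable_p prob_space.finite_measure)

lemma measurable_mix_parametric [measurable (raw)]:
  assumes G: "G \<in> borel_prob" and [measurable]: "f \<in> N \<rightarrow>\<^sub>M \<nu>"
  shows "(\<lambda>z. mixture p G (f z)) \<in> borel_measurable N"
proof -
  note [measurable_cong] = borel_probD(2)[OF G]
  interpret prob_space G by (rule borel_probD[OF G])
  show ?thesis unfolding mixture_def by measurable
qed

lemma nn_integral_mix_mult:
  assumes G: "G \<in> borel_prob" and [measurable]: "h \<in> borel_measurable \<nu>"
  shows "(\<integral>\<^sup>+x. h x * ennreal (mixture p G x) \<partial>\<nu>) = (\<integral>\<^sup>+\<theta>. (\<integral>\<^sup>+x. h x * ennreal (p x \<theta>) \<partial>\<nu>) \<partial>G)"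
proof -
  note [measurable_cong] = borel_probD(2)[OF G]
  interpret G: prob_space G by (rule borel_probD[OF G])
  interpret pair_sigma_finite G \<nu> ..
  have "(\<integral>\<^sup>+x. h x * ennreal (mixture p G x) \<partial>\<nu>) = (\<integral>\<^sup>+x. (\<integral>\<^sup>+\<theta>. h x * ennreal (p x \<theta>) \<partial>G) \<partial>\<nu>)"
    by (simp add: ennreal_mix[OF G] nn_integral_cmult)
  also have "\<dots> = (\<integral>\<^sup>+\<theta>. (\<integral>\<^sup>+x. h x * ennreal (p x \<theta>) \<partial>\<nu>) \<partial>G)"
    by (rule Fubini') measurable
  finally show ?thesis .
qed

lemma nn_integral_mix:
  assumes G: "G \<in> borel_prob"
  shows "(\<integral>\<^sup>+x. ennreal (mixture p G x) \<partial>\<nu>) = 1"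
  using nn_integral_mix_mult[OF G, of "\<lambda>_. 1"] borel_probD(1)[OF G]
  by (simp add: nn_integral_p prob_space.emeasure_space_1)

lemma sets_law [simp, measurable_cong]: "sets (law G) = sets \<nu>"
  by (simp add: law_def)

lemma space_law [simp]: "space (law G) = space \<nu>"
  by (simp add: law_def)

lemma prob_space_law:
  assumes "G \<in> borel_prob" shows "prob_space (law G)"
  by (rule prob_spaceI)
    (use assms in \<open>auto simp: law_def emeasure_density nn_integral_mix cong: nn_integral_cong\<close>)

lemma nn_integral_law:
  assumes "G \<in> borel_prob" "h \<in> borel_measurable \<nu>"
  shows "(\<integral>\<^sup>+x. h x \<partial>law G) = (\<integral>\<^sup>+x. h x * ennreal (mixture p G x) \<partial>\<nu>)"
  using assms unfolding law_def by (subst nn_integral_density) (auto simp: mult.commute)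

lemma integral_law:
  fixes h :: "'x \<Rightarrow> real"
  assumes "G \<in> borel_prob" "h \<in> borel_measurable \<nu>"
  shows "(LINT x|law G. h x) = (LINT x|\<nu>. mixture p G x * h x)"
  using assms unfolding law_def by (subst integral_density) auto

lemma integrable_mix: "G \<in> borel_prob \<Longrightarrow> integrable \<nu> (mixture p G)"
  by (intro integrableI_nonneg) (auto simp: nn_integral_mix)

lemma integral_mix: "G \<in> borel_prob \<Longrightarrow> (LINT x|\<nu>. mixture p G x) = 1"
  by (subst integral_eq_nn_integral) (auto simp: nn_integral_mix)

lemma return_in_borel_prob: "return borel \<theta> \<in> borel_prob"
  by (simp add: borel_prob_def prob_space_return)

lemma mix_return [simp]: "mixture p (return borel \<theta>) x = p x \<theta>"
  unfolding mixture_def by (simp add: integral_return)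

lemma mix_density:
  assumes G: "G \<in> borel_prob" and "h \<in> borel_measurable borel" "\<And>\<theta>. 0 \<le> h \<theta>"
  shows "mixture p (density G (\<lambda>\<theta>. ennreal (h \<theta>))) x = (LINT \<theta>|G. h \<theta> * p x \<theta>)"
proof -
  note [measurable_cong] = borel_probD(2)[OF G]
  show ?thesis
    unfolding mixture_def using assms by (subst integral_density) auto
qed

end

text \<open>The constant \<open>B\<close> is the one of assumption (A5). In the extended nonnegative reals \<open>a / 0 = \<infinity>\<close> for \<open>a > 0\<close>
and \<open>0 / 0 = 0\<close>, so the bound also says that all sampling densities are positive on the
same part of the sample space, up to a null set for each pair of parameters.\<close>

locale bounded_ratio_model = mixture_model +
  fixes B :: real
  assumes ratio: "\<And>\<theta>1 \<theta>2 \<theta>3.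
    (\<integral>\<^sup>+x. (ennreal (p x \<theta>1) / ennreal (p x \<theta>2))\<^sup>2 * ennreal (p x \<theta>3) \<partial>\<nu>) \<le> ennreal B"
begin

lemma one_le_B: "1 \<le> B"
proof -
  have "(ennreal a / ennreal a)\<^sup>2 * ennreal a = ennreal a" if "0 \<le> a" for a :: real
    using that by (cases "a = 0") (auto simp: divide_ennreal)
  then have "1 \<le> ennreal B"
    using ratio[of undefined undefined undefined] by (simp add: nn_integral_p)
  then show ?thesis by simp
qed

text \<open>The bound passes from points of the parameter space to arbitrary mixtures, one argument at a time. The
integrand is convex in the numerator (as \<open>t\<^sup>2\<close>), convex in the denominator (as \<open>1 / t\<^sup>2\<close>) and
linear in the last factor; it is not jointly convex.\<close>

lemma ratio_mix:
  assumes G: "G1 \<in> borel_prob" "G2 \<in> borel_prob" "G3 \<in> borel_prob"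
  shows "(\<integral>\<^sup>+x. (ennreal (mixture p G1 x) / ennreal (mixture p G2 x))\<^sup>2 * ennreal (mixture p G3 x) \<partial>\<nu>)
    \<le> ennreal B"
proof -
  note [measurable_cong] = borel_probD(2)[OF G(1)] borel_probD(2)[OF G(2)] borel_probD(2)[OF G(3)]
  note [measurable] = G
  interpret G1: prob_space G1 by (rule borel_probD[OF G(1)])
  interpret G2: prob_space G2 by (rule borel_probD[OF G(2)])
  interpret G3: prob_space G3 by (rule borel_probD[OF G(3)])
  interpret N1: pair_sigma_finite G1 \<nu> ..
  interpret N2: pair_sigma_finite G2 \<nu> ..
  have bound_avg: "(\<integral>\<^sup>+\<theta>. u \<theta> \<partial>G) \<le> ennreal B" if "prob_space G" "\<And>\<theta>. u \<theta> \<le> ennreal B" for G :: "'t measure" and u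
  proof -
    interpret prob_space G by (rule that)
    show ?thesis
      using nn_integral_mono[of G u "\<lambda>_. ennreal B"] that(2) by (simp add: emeasure_space_1)
  qed
  have 1: "(\<integral>\<^sup>+x. (ennreal (p x \<theta>1) / ennreal (p x \<theta>2))\<^sup>2 * ennreal (mixture p G3 x) \<partial>\<nu>) \<le> ennreal B" for \<theta>1 \<theta>2
    by (subst nn_integral_mix_mult) (auto intro!: bound_avg G3.prob_space_axioms ratio G)
  have 2: "(\<integral>\<^sup>+x. (ennreal (p x \<theta>1) / ennreal (mixture p G2 x))\<^sup>2 * ennreal (mixture p G3 x) \<partial>\<nu>) \<le> ennreal B" for \<theta>1
  proof -
    have "(\<integral>\<^sup>+x. (ennreal (p x \<theta>1) / ennreal (mixture p G2 x))\<^sup>2 * ennreal (mixture p G3 x) \<partial>\<nu>)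
      \<le> (\<integral>\<^sup>+x. (\<integral>\<^sup>+\<theta>2. (ennreal (p x \<theta>1) / ennreal (p x \<theta>2))\<^sup>2 * ennreal (mixture p G3 x) \<partial>G2) \<partial>\<nu>)"
    proof (intro nn_integral_mono)
      fix x
      have "(inverse (ennreal (mixture p G2 x)))\<^sup>2 \<le> (\<integral>\<^sup>+\<theta>2. inverse (ennreal (p x \<theta>2)) \<partial>G2)\<^sup>2"
        unfolding ennreal_mix[OF G(2)] by (intro power_mono G2.inverse_nn_integral_le) auto
      also have "\<dots> \<le> (\<integral>\<^sup>+\<theta>2. (inverse (ennreal (p x \<theta>2)))\<^sup>2 \<partial>G2)"
        by (rule G2.nn_integral_power2_le) measurable
      finally have "(ennreal (p x \<theta>1))\<^sup>2 * (inverse (ennreal (mixture p G2 x)))\<^sup>2 * ennreal (mixture p G3 x)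
        \<le> (ennreal (p x \<theta>1))\<^sup>2 * (\<integral>\<^sup>+\<theta>2. (inverse (ennreal (p x \<theta>2)))\<^sup>2 \<partial>G2) * ennreal (mixture p G3 x)"
        by (intro mult_mono order_refl) auto
      also have "\<dots> = (\<integral>\<^sup>+\<theta>2. (ennreal (p x \<theta>1) / ennreal (p x \<theta>2))\<^sup>2 * ennreal (mixture p G3 x) \<partial>G2)"
        unfolding divide_ennreal_def power_mult_distrib by (simp add: nn_integral_multc nn_integral_cmult)
      finally show "(ennreal (p x \<theta>1) / ennreal (mixture p G2 x))\<^sup>2 * ennreal (mixture p G3 x)
        \<le> (\<integral>\<^sup>+\<theta>2. (ennreal (p x \<theta>1) / ennreal (p x \<theta>2))\<^sup>2 * ennreal (mixture p G3 x) \<partial>G2)"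
        unfolding divide_ennreal_def power_mult_distrib .
    qed
    also have "\<dots> = (\<integral>\<^sup>+\<theta>2. (\<integral>\<^sup>+x. (ennreal (p x \<theta>1) / ennreal (p x \<theta>2))\<^sup>2 * ennreal (mixture p G3 x) \<partial>\<nu>) \<partial>G2)"
      by (rule N2.Fubini') measurable
    also have "\<dots> \<le> ennreal B"
      by (intro bound_avg G2.prob_space_axioms 1)
    finally show ?thesis .
  qed
  have "(\<integral>\<^sup>+x. (ennreal (mixture p G1 x) / ennreal (mixture p G2 x))\<^sup>2 * ennreal (mixture p G3 x) \<partial>\<nu>)
    \<le> (\<integral>\<^sup>+x. (\<integral>\<^sup>+\<theta>1. (ennreal (p x \<theta>1) / ennreal (mixture p G2 x))\<^sup>2 * ennreal (mixture p G3 x) \<partial>G1) \<partial>\<nu>)"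
  proof (intro nn_integral_mono)
    fix x
    have "(ennreal (mixture p G1 x))\<^sup>2 \<le> (\<integral>\<^sup>+\<theta>1. (ennreal (p x \<theta>1))\<^sup>2 \<partial>G1)"
      unfolding ennreal_mix[OF G(1)] by (rule G1.nn_integral_power2_le) measurable
    then have "(ennreal (mixture p G1 x))\<^sup>2 * ((inverse (ennreal (mixture p G2 x)))\<^sup>2 * ennreal (mixture p G3 x))
      \<le> (\<integral>\<^sup>+\<theta>1. (ennreal (p x \<theta>1))\<^sup>2 \<partial>G1) * ((inverse (ennreal (mixture p G2 x)))\<^sup>2 * ennreal (mixture p G3 x))"
      by (intro mult_mono order_refl) auto
    also have "\<dots> = (\<integral>\<^sup>+\<theta>1. (ennreal (p x \<theta>1))\<^sup>2 * ((inverse (ennreal (mixture p G2 x)))\<^sup>2 * ennreal (mixture p G3 x)) \<partial>G1)"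
      by (simp add: nn_integral_multc)
    finally show "(ennreal (mixture p G1 x) / ennreal (mixture p G2 x))\<^sup>2 * ennreal (mixture p G3 x)
      \<le> (\<integral>\<^sup>+\<theta>1. (ennreal (p x \<theta>1) / ennreal (mixture p G2 x))\<^sup>2 * ennreal (mixture p G3 x) \<partial>G1)"
      unfolding divide_ennreal_def power_mult_distrib by (simp add: mult.assoc)
  qed
  also have "\<dots> = (\<integral>\<^sup>+\<theta>1. (\<integral>\<^sup>+x. (ennreal (p x \<theta>1) / ennreal (mixture p G2 x))\<^sup>2 * ennreal (mixture p G3 x) \<partial>\<nu>) \<partial>G1)"
    by (rule N1.Fubini') measurable
  also have "\<dots> \<le> ennreal B"
    by (intro bound_avg G1.prob_space_axioms 2)
  finally show ?thesis .
qed

text \<open>A point of positive density under \<open>F\<close> and zero density under \<open>G\<close> contributes \<open>\<infinity>\<close> to the integral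
of \<open>ratio_mix\<close>.\<close>

lemma AE_mix_pos:
  assumes F: "F \<in> borel_prob" and G: "G \<in> borel_prob"
  shows "AE x in law F. 0 < mixture p G x"
proof -
  note [measurable] = F G
  have "(\<integral>\<^sup>+x. (ennreal (mixture p F x) / ennreal (mixture p G x))\<^sup>2 * ennreal (mixture p F x) \<partial>\<nu>) \<noteq> \<infinity>"
    using ratio_mix[OF F G F] by (auto simp: top_unique)
  then have "AE x in \<nu>. (ennreal (mixture p F x) / ennreal (mixture p G x))\<^sup>2 * ennreal (mixture p F x) \<noteq> \<infinity>"
    by (intro nn_integral_noteq_infinite) measurable
  then have "AE x in \<nu>. 0 < ennreal (mixture p F x) \<longrightarrow> 0 < mixture p G x"
  proof eventually_elim
    case (elim x)
    show ?case
    proof (intro impI, rule ccontr)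
      assume *: "0 < ennreal (mixture p F x)" "\<not> 0 < mixture p G x"
      then have "mixture p G x = 0" using mix_nonneg[of G x] by linarith
      with * elim show False
        by (auto simp: ennreal_divide_zero power2_eq_square ennreal_mult_eq_top_iff ennreal_top_mult)
    qed
  qed
  then show ?thesis
    unfolding law_def by (subst AE_density) auto
qed

lemma le_one_plus_square: "t \<le> 1 + t\<^sup>2" for t :: real
  using zero_le_power2[of "t - 1/2"] by (simp add: power2_eq_square algebra_simps)

lemma
  assumes F: "F \<in> borel_prob" and H: "H \<in> borel_prob" and G: "G \<in> borel_prob"
  shows integrable_ratio_sq: "integrable (law F) (\<lambda>x. (mixture p H x / mixture p G x)\<^sup>2)"
    and integral_ratio_sq: "(LINT x|law F. (mixture p H x / mixture p G x)\<^sup>2) \<le> B"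
    and integrable_ratio: "integrable (law F) (\<lambda>x. mixture p H x / mixture p G x)"
    and integral_ratio: "(LINT x|law F. mixture p H x / mixture p G x) \<le> 1 + B"
proof -
  note [measurable] = F G H
  interpret prob_space "law F" by (rule prob_space_law[OF F])
  have le: "(\<integral>\<^sup>+x. ennreal ((mixture p H x / mixture p G x)\<^sup>2) \<partial>law F) \<le> ennreal B"
  proof -
    have "(\<integral>\<^sup>+x. ennreal ((mixture p H x / mixture p G x)\<^sup>2) \<partial>law F)
      = (\<integral>\<^sup>+x. ennreal ((mixture p H x / mixture p G x)\<^sup>2) * ennreal (mixture p F x) \<partial>\<nu>)"
      by (intro nn_integral_law F) measurable
    also have "\<dots> \<le> (\<integral>\<^sup>+x. (ennreal (mixture p H x) / ennreal (mixture p G x))\<^sup>2 * ennreal (mixture p F x) \<partial>\<nu>)"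
    proof (intro nn_integral_mono mult_right_mono)
      show "ennreal ((mixture p H x / mixture p G x)\<^sup>2) \<le> (ennreal (mixture p H x) / ennreal (mixture p G x))\<^sup>2" for x
      proof (cases "mixture p G x = 0")
        case False
        then have "0 < mixture p G x" using mix_nonneg[of G x] by linarith
        then show ?thesis by (simp add: divide_ennreal ennreal_power)
      qed simp
    qed simp
    finally show ?thesis
      using ratio_mix[OF H G F] by (rule order_trans)
  qed
  show sq: "integrable (law F) (\<lambda>x. (mixture p H x / mixture p G x)\<^sup>2)"
    using le by (intro integrableI_nonneg) (auto simp: top_unique intro: le_less_trans)
  show le': "(LINT x|law F. (mixture p H x / mixture p G x)\<^sup>2) \<le> B"
    using le one_le_B by (subst integral_eq_nn_integral) (auto simp: enn2real_leI)
  show int: "integrable (law F) (\<lambda>x. mixture p H x / mixture p G x)"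
    by (rule Bochner_Integration.integrable_bound[OF Bochner_Integration.integrable_add[OF integrable_const[of 1] sq]])
      (use le_one_plus_square in auto)
  have "(LINT x|law F. mixture p H x / mixture p G x) \<le> (LINT x|law F. 1 + (mixture p H x / mixture p G x)\<^sup>2)"
    by (intro integral_mono int Bochner_Integration.integrable_add sq le_one_plus_square) simp
  also have "\<dots> \<le> 1 + B"
    using le' by (simp add: sq prob_space[simplified])
  finally show "(LINT x|law F. mixture p H x / mixture p G x) \<le> 1 + B" .
qed

end

section \<open>Divergences and a single Bayes step\<close>

text \<open>A lower bound for the integrand of the Kullback-Leibler divergence that controls the \<open>L\<^sup>1\<close> distance.
It follows from \<open>ln s \<le> s - 1\<close> at \<open>s = sqrt v\<close>.\<close>

lemma ln_ge_quadratic: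
  fixes v :: real
  assumes "v > 0"
  shows "(1 - v) + (max 0 (1 - v))\<^sup>2 / 4 \<le> - ln v"
proof -
  define s where "s = sqrt v"
  have s: "s > 0" "v = s\<^sup>2" using assms by (auto simp: s_def)
  have "ln v = 2 * ln s"
    using s by (simp add: ln_realpow)
  moreover have "ln s \<le> s - 1"
    using s by (intro ln_le_minus_one) auto
  moreover have "(1 - s\<^sup>2) + (max 0 (1 - s\<^sup>2))\<^sup>2 / 4 \<le> 2 * (1 - s)"
  proof (cases "s \<le> 1")
    case True
    have "1 - s\<^sup>2 = (1 - s) * (1 + s)" by (simp add: power2_eq_square algebra_simps)
    then have "0 \<le> 1 - s\<^sup>2" "1 - s\<^sup>2 \<le> 2 * (1 - s)"
      using True s mult_left_mono[of "1 + s" 2 "1 - s"] by auto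
    then have "(max 0 (1 - s\<^sup>2))\<^sup>2 \<le> (2 * (1 - s))\<^sup>2"
      by (intro power_mono) auto
    also have "\<dots> = 4 * (2 * (1 - s) - (1 - s\<^sup>2))"
      by (simp add: power2_eq_square algebra_simps)
    finally show ?thesis by simp
  next
    case False
    then have "max 0 (1 - s\<^sup>2) = 0" by (simp add: max_def power_le_one_iff)
    then show ?thesis
      using zero_le_power2[of "1 - s"] by (simp add: power2_eq_square algebra_simps)
  qed
  ultimately show ?thesis
    using s by simp
qed

text \<open>The logarithmic change produced by one step of size \<open>w\<close>, whose new-to-old ratio is \<open>1 - w + w * u\<close>,
is \<open>w * (u - 1)\<close> up to an error of second order in \<open>w\<close>.\<close>

lemma ln_convex_step_ge:
  fixes u w :: real
  assumes "0 \<le> u" "0 \<le> w" "w < 1"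
  shows "w * (u - 1) - w\<^sup>2 / (1 - w) * (1 + u\<^sup>2) \<le> ln (1 - w + w * u)"
proof -
  define t where "t = w * (u - 1)"
  have eq: "1 - w + w * u = 1 + t" by (simp add: t_def algebra_simps)
  have pos: "0 < 1 - w" "1 - w \<le> 1 + t"
    using assms by (auto simp: eq[symmetric])
  have "t\<^sup>2 = w\<^sup>2 * (u - 1)\<^sup>2" by (simp add: t_def power_mult_distrib)
  also have "(u - 1)\<^sup>2 \<le> 1 + u\<^sup>2"
    using assms by (simp add: power2_eq_square algebra_simps)
  finally have sq: "t\<^sup>2 \<le> w\<^sup>2 * (1 + u\<^sup>2)"
    by (simp add: mult_left_mono)
  have "t\<^sup>2 / (1 + t) \<le> t\<^sup>2 / (1 - w)"
    using pos by (intro divide_left_mono) auto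
  also have "\<dots> \<le> w\<^sup>2 * (1 + u\<^sup>2) / (1 - w)"
    using sq pos by (intro divide_right_mono) auto
  finally have "t - w\<^sup>2 * (1 + u\<^sup>2) / (1 - w) \<le> t - t\<^sup>2 / (1 + t)"
    by simp
  also have "\<dots> = 1 - 1 / (1 + t)"
    using pos by (simp add: field_simps power2_eq_square)
  also have "\<dots> \<le> ln (1 + t)"
  proof -
    have "ln (1 / (1 + t)) \<le> 1 / (1 + t) - 1"
      using pos by (intro ln_le_minus_one) auto
    then show ?thesis using pos by (simp add: ln_div)
  qed
  finally show ?thesis
    unfolding eq by (simp add: t_def)
qed

context mixture_model
begin

text \<open>The divergence is taken between mixtures, not between mixing distributions.\<close>

definition KL :: "'t measure \<Rightarrow> 't measure \<Rightarrow> real" where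
  "KL F G = (LINT x|law F. ln (mixture p F x / mixture p G x))"

definition posterior :: "'t measure \<Rightarrow> 'x \<Rightarrow> 't measure" where
  "posterior G y = density G (\<lambda>\<theta>. ennreal (p y \<theta> / mixture p G y))"

definition bayes_step :: "real \<Rightarrow> 't measure \<Rightarrow> 'x \<Rightarrow> 't measure" where
  "bayes_step w G y = density G (\<lambda>\<theta>. ennreal (1 - w + w * (p y \<theta> / mixture p G y)))"

text \<open>A Bayes step of weight \<open>w\<close> multiplies the density at \<open>\<theta>\<close> by \<open>1 - w + w * u\<close> with
\<open>u = p y \<theta> / mixture p G y\<close>. The gain is the mean of \<open>u\<close> under the true sampling law.\<close>

definition gain :: "'t measure \<Rightarrow> 't measure \<Rightarrow> 't \<Rightarrow> real" where
  "gain F G \<theta> = (LINT y|law F. p y \<theta> / mixture p G y)"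

lemma density_in_borel_prob:
  assumes "G \<in> borel_prob" "h \<in> borel_measurable borel" "(\<integral>\<^sup>+\<theta>. h \<theta> \<partial>G) = 1"
  shows "density G h \<in> borel_prob"
  using assms borel_probD[OF assms(1)]
  by (auto simp: borel_prob_def intro!: prob_spaceI simp: emeasure_density cong: nn_integral_cong)

lemma nn_integral_posterior_density:
  assumes G: "G \<in> borel_prob" and pos: "0 < mixture p G y"
  shows "(\<integral>\<^sup>+\<theta>. ennreal (p y \<theta> / mixture p G y) \<partial>G) = 1"
proof -
  note [measurable_cong] = borel_probD(2)[OF G]
  have "(\<integral>\<^sup>+\<theta>. ennreal (p y \<theta> / mixture p G y) \<partial>G)
    = (\<integral>\<^sup>+\<theta>. ennreal (p y \<theta>) * ennreal (1 / mixture p G y) \<partial>G)"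
    by (intro nn_integral_cong) (simp add: ennreal_mult[symmetric])
  also have "\<dots> = ennreal (mixture p G y) * ennreal (1 / mixture p G y)"
    by (simp add: nn_integral_multc ennreal_mix[OF G])
  also have "\<dots> = 1"
    using pos by (simp add: ennreal_mult[symmetric])
  finally show ?thesis .
qed

lemma posterior_in_borel_prob:
  assumes G: "G \<in> borel_prob" and "0 < mixture p G y"
  shows "posterior G y \<in> borel_prob"
  unfolding posterior_def using assms
  by (intro density_in_borel_prob nn_integral_posterior_density) auto

lemma bayes_step_in_borel_prob:
  assumes G: "G \<in> borel_prob" and pos: "0 < mixture p G y" and w: "0 \<le> w" "w \<le> 1"
  shows "bayes_step w G y \<in> borel_prob"
  unfolding bayes_step_def
proof (rule density_in_borel_prob[OF G])
  note [measurable_cong] = borel_probD(2)[OF G]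
  interpret prob_space G by (rule borel_probD[OF G])
  have "(\<integral>\<^sup>+\<theta>. ennreal (1 - w + w * (p y \<theta> / mixture p G y)) \<partial>G)
    = (\<integral>\<^sup>+\<theta>. ennreal (1 - w) + ennreal w * ennreal (p y \<theta> / mixture p G y) \<partial>G)"
    using w by (intro nn_integral_cong) (simp add: ennreal_mult[symmetric] ennreal_plus[symmetric] del: ennreal_plus)
  also have "\<dots> = ennreal (1 - w) + ennreal w"
    by (simp add: nn_integral_add nn_integral_cmult nn_integral_posterior_density[OF G pos] emeasure_space_1)
  also have "\<dots> = 1"
    using w by (simp add: ennreal_plus[symmetric] del: ennreal_plus)
  finally show "(\<integral>\<^sup>+\<theta>. ennreal (1 - w + w * (p y \<theta> / mixture p G y)) \<partial>G) = 1" .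
qed measurable

lemma integrable_p_mult:
  assumes G: "G \<in> borel_prob"
  shows "integrable G (\<lambda>\<theta>. p y \<theta> * p x \<theta>)"
proof -
  note [measurable_cong] = borel_probD(2)[OF G]
  interpret prob_space G by (rule borel_probD[OF G])
  obtain a b where "\<forall>\<theta>. p x \<theta> \<le> a" "\<forall>\<theta>. p y \<theta> \<le> b" "0 \<le> b"
    using ex_p_bound by metis
  then show ?thesis
    by (intro integrable_const_bound[of _ "b * a"]) (auto intro!: mult_mono)
qed

lemma mix_posterior:
  assumes G: "G \<in> borel_prob"
  shows "mixture p (posterior G y) x = (LINT \<theta>|G. p y \<theta> * p x \<theta>) / mixture p G y"
  unfolding posterior_def using G by (subst mix_density) auto

lemma mix_bayes_step_eq:
  assumes G: "G \<in> borel_prob" and w: "0 \<le> w" "w \<le> 1"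
  shows "mixture p (bayes_step w G y) x = (LINT \<theta>|G. (1 - w + w * (p y \<theta> / mixture p G y)) * p x \<theta>)"
  unfolding bayes_step_def using G w by (subst mix_density) auto

text \<open>On the sample space a Bayes step moves the mixture along a straight line towards the mixture of the
posterior.\<close>

lemma mix_bayes_step:
  assumes G: "G \<in> borel_prob" and w: "0 \<le> w" "w \<le> 1"
  shows "mixture p (bayes_step w G y) x = (1 - w) * mixture p G x + w * mixture p (posterior G y) x"
proof -
  have [simp]: "integrable G (p x)"
    using borel_probD[OF G] by (intro integrable_p prob_space.finite_measure)
  have "(LINT \<theta>|G. (1 - w + w * (p y \<theta> / mixture p G y)) * p x \<theta>)
    = (LINT \<theta>|G. (1 - w) * p x \<theta> + w / mixture p G y * (p y \<theta> * p x \<theta>))"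
    by (intro Bochner_Integration.integral_cong refl) (simp add: algebra_simps)
  also have "\<dots> = (1 - w) * mixture p G x + w * mixture p (posterior G y) x"
    using integrable_p_mult[OF G, of y x] unfolding mix_posterior[OF G] by (simp add: mixture_def)
  finally show ?thesis
    by (simp add: mix_bayes_step_eq assms)
qed

end

context bounded_ratio_model
begin

lemma gain_bounds:
  assumes F: "F \<in> borel_prob" and G: "G \<in> borel_prob"
  shows "integrable (law F) (\<lambda>y. p y \<theta> / mixture p G y)" "0 \<le> gain F G \<theta>" "gain F G \<theta> \<le> 1 + B"
  using integrable_ratio[OF F return_in_borel_prob G, of \<theta>] integral_ratio[OF F return_in_borel_prob G, of \<theta>]
  unfolding gain_def by auto

lemma measurable_gain [measurable]:
  assumes F: "F \<in> borel_prob" and G: "G \<in> borel_prob"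
  shows "gain F G \<in> borel_measurable borel"
proof -
  note [measurable] = F G
  interpret prob_space "law F" by (rule prob_space_law[OF F])
  show ?thesis unfolding gain_def[abs_def] by measurable
qed

lemma integrable_KL:
  assumes F: "F \<in> borel_prob" and G: "G \<in> borel_prob"
  shows "integrable (law F) (\<lambda>x. ln (mixture p F x / mixture p G x))"
proof (rule Bochner_Integration.integrable_bound)
  note [measurable] = F G
  show "integrable (law F) (\<lambda>x. mixture p F x / mixture p G x + mixture p G x / mixture p F x)"
    by (intro Bochner_Integration.integrable_add integrable_ratio F G)
  show "AE x in law F. norm (ln (mixture p F x / mixture p G x))
      \<le> norm (mixture p F x / mixture p G x + mixture p G x / mixture p F x)"
    using AE_mix_pos[OF F F] AE_mix_pos[OF F G]
  proof eventually_elim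
    case (elim x)
    define t where "t = mixture p F x / mixture p G x"
    have t: "t > 0" "mixture p G x / mixture p F x = 1 / t" using elim by (auto simp: t_def)
    have "ln t \<le> t - 1" "- ln t \<le> 1 / t - 1"
      using t ln_le_minus_one[of t] ln_le_minus_one[of "1 / t"] by (auto simp: ln_div)
    moreover have "0 < 1 / t" using t by simp
    ultimately have "\<bar>ln t\<bar> \<le> t + 1 / t"
      using t(1) unfolding abs_le_iff by linarith
    then show ?case
      using t by (simp add: t_def[symmetric])
  qed
  show "(\<lambda>x. ln (mixture p F x / mixture p G x)) \<in> borel_measurable (law F)"
    by measurable
qed

lemma integral_inverse_ratio_le:
  assumes F: "F \<in> borel_prob" and G: "G \<in> borel_prob"
  shows "(LINT x|law F. mixture p G x / mixture p F x) \<le> 1"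
proof -
  note [measurable] = F G
  have "(\<integral>\<^sup>+x. ennreal (mixture p G x / mixture p F x) \<partial>law F)
    = (\<integral>\<^sup>+x. ennreal (mixture p G x / mixture p F x) * ennreal (mixture p F x) \<partial>\<nu>)"
    by (intro nn_integral_law F) measurable
  also have "\<dots> \<le> (\<integral>\<^sup>+x. ennreal (mixture p G x) \<partial>\<nu>)"
    by (intro nn_integral_mono) (simp add: ennreal_mult[symmetric])
  finally have "(\<integral>\<^sup>+x. ennreal (mixture p G x / mixture p F x) \<partial>law F) \<le> ennreal 1"
    by (simp add: nn_integral_mix[OF G])
  then show ?thesis
    by (subst integral_eq_nn_integral) (auto simp: enn2real_leI)
qed

lemma KL_nonneg:
  assumes F: "F \<in> borel_prob" and G: "G \<in> borel_prob"
  shows "0 \<le> KL F G"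
proof -
  interpret prob_space "law F" by (rule prob_space_law[OF F])
  have "0 \<le> (LINT x|law F. 1 - mixture p G x / mixture p F x)"
    using integral_inverse_ratio_le[OF F G] prob_space by (simp add: integrable_ratio F G)
  also have "\<dots> \<le> KL F G"
    unfolding KL_def
  proof (rule integral_mono_AE)
    show "AE x in law F. 1 - mixture p G x / mixture p F x \<le> ln (mixture p F x / mixture p G x)"
      using AE_mix_pos[OF F F] AE_mix_pos[OF F G]
    proof eventually_elim
      case (elim x)
      then have "ln (mixture p G x / mixture p F x) \<le> mixture p G x / mixture p F x - 1"
        by (intro ln_le_minus_one) simp
      with elim show ?case by (simp add: ln_div)
    qed
  qed (auto intro!: integrable_KL integrable_ratio F G)
  finally show ?thesis .
qed

lemma KL_le_chi_square:
  assumes F: "F \<in> borel_prob" and G: "G \<in> borel_prob"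
  shows "KL F G \<le> (LINT x|law F. mixture p F x / mixture p G x) - 1"
proof -
  interpret prob_space "law F" by (rule prob_space_law[OF F])
  have "KL F G \<le> (LINT x|law F. mixture p F x / mixture p G x - 1)"
    unfolding KL_def
  proof (rule integral_mono_AE)
    show "AE x in law F. ln (mixture p F x / mixture p G x) \<le> mixture p F x / mixture p G x - 1"
      using AE_mix_pos[OF F F] AE_mix_pos[OF F G]
      by eventually_elim (intro ln_le_minus_one, simp)
  qed (auto intro!: integrable_KL integrable_ratio F G)
  also have "\<dots> = (LINT x|law F. mixture p F x / mixture p G x) - 1"
    using prob_space by (simp add: integrable_ratio F G)
  finally show ?thesis .
qed

lemma KL_le_B:
  assumes F: "F \<in> borel_prob" and G: "G \<in> borel_prob"
  shows "KL F G \<le> B"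
  using KL_le_chi_square[OF F G] integral_ratio[OF F F G] by simp

text \<open>A form of Pinsker's inequality that is linear in the divergence, so that expectations over
the sample pass through it; the best choice is \<open>\<epsilon> = sqrt (KL F G)\<close>.\<close>

lemma L1_le_KL:
  assumes F: "F \<in> borel_prob" and G: "G \<in> borel_prob" and "\<epsilon> > 0"
  shows "(LINT x|\<nu>. \<bar>mixture p F x - mixture p G x\<bar>) \<le> 2 * (\<epsilon> + KL F G / \<epsilon>)"
proof -
  note [measurable] = F G
  interpret prob_space "law F" by (rule prob_space_law[OF F])
  have int_max: "integrable \<nu> (\<lambda>x. max 0 (mixture p F x - mixture p G x))"
    by (intro integrable_max Bochner_Integration.integrable_diff integrable_mix F G) simp
  \<comment> \<open>Both densities integrate to 1, so the positive part carries half of the distance.\<close>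
  have "(LINT x|\<nu>. \<bar>mixture p F x - mixture p G x\<bar>)
    = (LINT x|\<nu>. 2 * max 0 (mixture p F x - mixture p G x) - (mixture p F x - mixture p G x))"
    by (intro Bochner_Integration.integral_cong refl) (auto simp: max_def abs_if)
  also have "\<dots> = 2 * (LINT x|\<nu>. max 0 (mixture p F x - mixture p G x))"
    using int_max by (simp add: integrable_mix integral_mix F G)
  also have "(LINT x|\<nu>. max 0 (mixture p F x - mixture p G x))
    = (LINT x|\<nu>. mixture p F x * max 0 (1 - mixture p G x / mixture p F x))"
  proof (intro Bochner_Integration.integral_cong refl)
    fix x
    show "max 0 (mixture p F x - mixture p G x) = mixture p F x * max 0 (1 - mixture p G x / mixture p F x)"
    proof (cases "mixture p F x = 0")
      case False
      then have "0 < mixture p F x" using mix_nonneg[of F x] by linarith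
      then show ?thesis
        by (simp add: max_mult_distrib_left right_diff_distrib)
    qed simp
  qed
  also have "\<dots> = (LINT x|law F. max 0 (1 - mixture p G x / mixture p F x))"
    by (rule integral_law[symmetric, OF F]) measurable
  also have "\<dots> \<le> (LINT x|law F. \<epsilon> + (ln (mixture p F x / mixture p G x) - (1 - mixture p G x / mixture p F x)) / \<epsilon>)"
  proof (rule integral_mono_AE)
    show "AE x in law F. max 0 (1 - mixture p G x / mixture p F x)
        \<le> \<epsilon> + (ln (mixture p F x / mixture p G x) - (1 - mixture p G x / mixture p F x)) / \<epsilon>"
      using AE_mix_pos[OF F F] AE_mix_pos[OF F G]
    proof eventually_elim
      case (elim x)
      define v where "v = mixture p G x / mixture p F x"
      define m where "m = max 0 (1 - v)"
      have "v > 0" using elim by (simp add: v_def)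
      have "m * \<epsilon> \<le> \<epsilon> * \<epsilon> + m\<^sup>2 / 4"
        using zero_le_power2[of "\<epsilon> - m / 2"] by (simp add: power2_eq_square algebra_simps)
      also have "m\<^sup>2 / 4 \<le> - ln v - (1 - v)"
        using ln_ge_quadratic[OF \<open>v > 0\<close>] by (simp add: m_def)
      also have "- ln v = ln (mixture p F x / mixture p G x)"
        using elim by (simp add: v_def ln_div)
      finally have "m \<le> \<epsilon> + (ln (mixture p F x / mixture p G x) - (1 - v)) / \<epsilon>"
        using \<open>\<epsilon> > 0\<close> by (simp add: field_simps)
      then show ?case by (simp add: m_def v_def)
    qed
    show "integrable (law F) (\<lambda>x. max 0 (1 - mixture p G x / mixture p F x))"
      by (intro integrable_max Bochner_Integration.integrable_diff integrable_ratio F G) auto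
    show "integrable (law F) (\<lambda>x. \<epsilon> + (ln (mixture p F x / mixture p G x) - (1 - mixture p G x / mixture p F x)) / \<epsilon>)"
      by (intro Bochner_Integration.integrable_add Bochner_Integration.integrable_diff integrable_divide
          integrable_KL integrable_ratio F G) auto
  qed
  also have "\<dots> = \<epsilon> + (KL F G - (1 - (LINT x|law F. mixture p G x / mixture p F x))) / \<epsilon>"
    using prob_space by (simp add: KL_def integrable_KL integrable_ratio F G)
  also have "\<dots> \<le> \<epsilon> + KL F G / \<epsilon>"
    using integral_inverse_ratio_le[OF F G] \<open>\<epsilon> > 0\<close> by (simp add: divide_right_mono)
  finally show ?thesis by simp
qed

text \<open>Since the step is a convex combination, the first-order change of the divergence is read off from
the ratio of the mixture of the posterior to the current mixture; the second-order error is
bounded uniformly in \<open>G\<close> and \<open>y\<close> by the ratio bound.\<close>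

lemma KL_bayes_step_le:
  assumes F: "F \<in> borel_prob" and G: "G \<in> borel_prob" and pos: "0 < mixture p G y"
    and w: "0 \<le> w" "w < 1"
  shows "KL F (bayes_step w G y)
    \<le> KL F G - w * ((LINT x|law F. mixture p (posterior G y) x / mixture p G x) - 1) + w\<^sup>2 / (1 - w) * (1 + B)"
proof -
  interpret prob_space "law F" by (rule prob_space_law[OF F])
  have post: "posterior G y \<in> borel_prob"
    by (rule posterior_in_borel_prob[OF G pos])
  have step: "bayes_step w G y \<in> borel_prob"
    using w by (intro bayes_step_in_borel_prob[OF G pos]) auto
  define u where "u x = mixture p (posterior G y) x / mixture p G x" for x
  have int: "integrable (law F) u" "integrable (law F) (\<lambda>x. (u x)\<^sup>2)" "(LINT x|law F. (u x)\<^sup>2) \<le> B"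
    unfolding u_def using integrable_ratio[OF F post G] integrable_ratio_sq[OF F post G] integral_ratio_sq[OF F post G]
    by auto
  have "KL F (bayes_step w G y) \<le> (LINT x|law F. ln (mixture p F x / mixture p G x)
      - (w * (u x - 1) - w\<^sup>2 / (1 - w) * (1 + (u x)\<^sup>2)))"
    unfolding KL_def
  proof (rule integral_mono_AE)
    show "AE x in law F. ln (mixture p F x / mixture p (bayes_step w G y) x)
        \<le> ln (mixture p F x / mixture p G x) - (w * (u x - 1) - w\<^sup>2 / (1 - w) * (1 + (u x)\<^sup>2))"
      using AE_mix_pos[OF F F] AE_mix_pos[OF F G]
    proof eventually_elim
      case (elim x)
      have "mixture p (bayes_step w G y) x = mixture p G x * (1 - w + w * u x)"
        using elim w by (simp add: mix_bayes_step G u_def field_simps)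
      moreover have "0 \<le> u x" by (simp add: u_def)
      moreover have "0 < 1 - w + w * u x"
        using w \<open>0 \<le> u x\<close> by (intro add_pos_nonneg) auto
      ultimately show ?case
        using elim ln_convex_step_ge[of "u x" w] w by (simp add: ln_div ln_mult)
    qed
  qed (use int in \<open>auto intro!: integrable_KL F G step\<close>)
  also have "\<dots> = KL F G - w * ((LINT x|law F. u x) - 1) + w\<^sup>2 / (1 - w) * (1 + (LINT x|law F. (u x)\<^sup>2))"
    using int prob_space by (simp add: KL_def integrable_KL F G algebra_simps add_divide_distrib)
  also have "\<dots> \<le> KL F G - w * ((LINT x|law F. u x) - 1) + w\<^sup>2 / (1 - w) * (1 + B)"
    using int(3) w by (intro add_left_mono mult_left_mono) auto
  finally show ?thesis by (simp add: u_def)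
qed

text \<open>On average over the observation the first-order change has the right sign. By Fubini the double integral is
\<open>\<integral> (gain F G)\<^sup>2 dG\<close>, which is at least \<open>(\<integral> gain F G dG)\<^sup>2 = 1\<close>.\<close>

lemma
  assumes F: "F \<in> borel_prob" and G: "G \<in> borel_prob"
  shows integrable_posterior_ratio:
      "integrable (law F) (\<lambda>y. LINT x|law F. mixture p (posterior G y) x / mixture p G x)"
    and integral_posterior_ratio_ge:
      "1 \<le> (LINT y|law F. LINT x|law F. mixture p (posterior G y) x / mixture p G x)"
proof -
  note [measurable] = F G and [measurable_cong] = borel_probD(2)[OF G]
  interpret D: prob_space "law F" by (rule prob_space_law[OF F])
  interpret G: prob_space G by (rule borel_probD[OF G])
  interpret DG: pair_sigma_finite "law F" G ..
  interpret GD: pair_sigma_finite G "law F" ..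
  define A where "A x \<theta> = ennreal (p x \<theta> / mixture p G x)" for x \<theta>
  have [measurable]: "(\<lambda>z. A (f z) (g z)) \<in> borel_measurable N"
    if [measurable]: "f \<in> N \<rightarrow>\<^sub>M \<nu>" "g \<in> N \<rightarrow>\<^sub>M borel" for f g and N :: "'z measure"
    unfolding A_def by measurable
  have A_swap[measurable]: "(\<lambda>z. A (snd z) (fst z)) \<in> borel_measurable (G \<Otimes>\<^sub>M law F)"
    unfolding A_def by measurable
  have A_pair[measurable]: "(\<lambda>z. A (fst z) (snd z)) \<in> borel_measurable (law F \<Otimes>\<^sub>M G)"
    unfolding A_def by measurable
  define J where "J y = (LINT x|law F. mixture p (posterior G y) x / mixture p G x)" for y
  have J_bounds: "AE y in law F. 0 \<le> J y \<and> J y \<le> 1 + B"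
    using AE_mix_pos[OF F G]
    by eventually_elim (auto simp: J_def intro!: integral_ratio posterior_in_borel_prob F G)
  have [measurable]: "J \<in> borel_measurable \<nu>"
    unfolding J_def[abs_def] mix_posterior[OF G] by measurable
  show int: "integrable (law F) J"
    by (rule D.integrable_const_bound[of _ "1 + B"]) (use J_bounds in auto)
  have "1 = (\<integral>\<^sup>+x. 1 \<partial>law F)\<^sup>2"
    by (simp add: D.emeasure_space_1[simplified])
  also have "(\<integral>\<^sup>+x. 1 \<partial>law F) = (\<integral>\<^sup>+x. (\<integral>\<^sup>+\<theta>. A x \<theta> \<partial>G) \<partial>law F)"
    using AE_mix_pos[OF F G]
    by (intro nn_integral_cong_AE; eventually_elim) (simp add: A_def nn_integral_posterior_density[OF G])
  also have "\<dots> = (\<integral>\<^sup>+\<theta>. (\<integral>\<^sup>+x. A x \<theta> \<partial>law F) \<partial>G)"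
    by (rule GD.Fubini') (simp add: case_prod_unfold)
  also have "(\<dots>)\<^sup>2 \<le> (\<integral>\<^sup>+\<theta>. (\<integral>\<^sup>+x. A x \<theta> \<partial>law F)\<^sup>2 \<partial>G)"
    by (rule G.nn_integral_power2_le) measurable
  also have "\<dots> = (\<integral>\<^sup>+\<theta>. (\<integral>\<^sup>+y. A y \<theta> * (\<integral>\<^sup>+x. A x \<theta> \<partial>law F) \<partial>law F) \<partial>G)"
    by (simp add: power2_eq_square nn_integral_multc)
  also have "\<dots> = (\<integral>\<^sup>+y. (\<integral>\<^sup>+\<theta>. A y \<theta> * (\<integral>\<^sup>+x. A x \<theta> \<partial>law F) \<partial>G) \<partial>law F)"
    by (rule DG.Fubini') measurable
  also have "\<dots> = (\<integral>\<^sup>+y. (\<integral>\<^sup>+\<theta>. (\<integral>\<^sup>+x. A y \<theta> * A x \<theta> \<partial>law F) \<partial>G) \<partial>law F)"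
    by (simp add: nn_integral_cmult)
  also have "\<dots> = (\<integral>\<^sup>+y. (\<integral>\<^sup>+x. (\<integral>\<^sup>+\<theta>. A y \<theta> * A x \<theta> \<partial>G) \<partial>law F) \<partial>law F)"
    by (intro nn_integral_cong DG.Fubini') measurable
  also have "\<dots> = (\<integral>\<^sup>+y. ennreal (J y) \<partial>law F)"
  proof (rule nn_integral_cong_AE)
    show "AE y in law F. (\<integral>\<^sup>+x. (\<integral>\<^sup>+\<theta>. A y \<theta> * A x \<theta> \<partial>G) \<partial>law F) = ennreal (J y)"
      using AE_mix_pos[OF F G]
    proof eventually_elim
      case (elim y)
      have post: "posterior G y \<in> borel_prob" by (rule posterior_in_borel_prob[OF G elim])
      have "(\<integral>\<^sup>+x. (\<integral>\<^sup>+\<theta>. A y \<theta> * A x \<theta> \<partial>G) \<partial>law F)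
        = (\<integral>\<^sup>+x. ennreal (mixture p (posterior G y) x / mixture p G x) \<partial>law F)"
      proof (rule nn_integral_cong)
        fix x
        have "(\<integral>\<^sup>+\<theta>. A y \<theta> * A x \<theta> \<partial>G) = (\<integral>\<^sup>+\<theta>. A y \<theta> * ennreal (p x \<theta>) * ennreal (1 / mixture p G x) \<partial>G)"
          by (intro nn_integral_cong) (simp add: A_def ennreal_mult[symmetric] mult.assoc)
        also have "\<dots> = (\<integral>\<^sup>+\<theta>. A y \<theta> * ennreal (p x \<theta>) \<partial>G) * ennreal (1 / mixture p G x)"
          by (rule nn_integral_multc) (simp add: A_def)
        also have "(\<integral>\<^sup>+\<theta>. A y \<theta> * ennreal (p x \<theta>) \<partial>G) = ennreal (mixture p (posterior G y) x)"
          unfolding ennreal_mix[OF post] by (simp add: posterior_def nn_integral_density A_def)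
        finally show "(\<integral>\<^sup>+\<theta>. A y \<theta> * A x \<theta> \<partial>G) = ennreal (mixture p (posterior G y) x / mixture p G x)"
          by (simp add: ennreal_mult[symmetric])
      qed
      also have "\<dots> = ennreal (J y)"
        unfolding J_def by (intro nn_integral_eq_integral integrable_ratio F G post) auto
      finally show ?case .
    qed
  qed
  also have "\<dots> = ennreal (LINT y|law F. J y)"
    using J_bounds by (intro nn_integral_eq_integral int) auto
  finally show "1 \<le> (LINT y|law F. J y)"
    by simp
qed

lemma measurable_KL_bayes_step [measurable]:
  assumes F: "F \<in> borel_prob" and G: "G \<in> borel_prob" and w: "0 \<le> w" "w \<le> 1"
  shows "(\<lambda>y. KL F (bayes_step w G y)) \<in> borel_measurable \<nu>"
proof -
  note [measurable] = F G and [measurable_cong] = borel_probD(2)[OF G]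
  interpret D: prob_space "law F" by (rule prob_space_law[OF F])
  interpret G: prob_space G by (rule borel_probD[OF G])
  show ?thesis
    unfolding KL_def mix_bayes_step_eq[OF G w] by measurable
qed

text \<open>Hence the expected divergence is almost decreasing along the recursion.\<close>

lemma integral_KL_bayes_step_le:
  assumes F: "F \<in> borel_prob" and G: "G \<in> borel_prob" and w: "0 \<le> w" "w < 1"
  shows "(LINT y|law F. KL F (bayes_step w G y)) \<le> KL F G + w\<^sup>2 / (1 - w) * (1 + B)"
proof -
  note [measurable] = F G
  interpret prob_space "law F" by (rule prob_space_law[OF F])
  define J where "J y = (LINT x|law F. mixture p (posterior G y) x / mixture p G x)" for y
  have J: "integrable (law F) J" "1 \<le> (LINT y|law F. J y)"
    unfolding J_def using integrable_posterior_ratio[OF F G] integral_posterior_ratio_ge[OF F G] by auto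
  have "(LINT y|law F. KL F (bayes_step w G y))
    \<le> (LINT y|law F. KL F G - w * (J y - 1) + w\<^sup>2 / (1 - w) * (1 + B))"
  proof (rule integral_mono_AE)
    show "AE y in law F. KL F (bayes_step w G y) \<le> KL F G - w * (J y - 1) + w\<^sup>2 / (1 - w) * (1 + B)"
      using AE_mix_pos[OF F G] unfolding J_def by eventually_elim (intro KL_bayes_step_le F G w)
    have "AE y in law F. norm (KL F (bayes_step w G y)) \<le> B"
      using AE_mix_pos[OF F G]
    proof eventually_elim
      case (elim y)
      have "bayes_step w G y \<in> borel_prob"
        using w by (intro bayes_step_in_borel_prob[OF G elim]) auto
      then show ?case using KL_nonneg[OF F] KL_le_B[OF F] by simp
    qed
    then show "integrable (law F) (\<lambda>y. KL F (bayes_step w G y))"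
      using w F G by (intro integrable_const_bound[of _ B]) auto
  qed (use J in auto)
  also have "\<dots> = KL F G - w * ((LINT y|law F. J y) - 1) + w\<^sup>2 / (1 - w) * (1 + B)"
    using J prob_space by simp
  also have "\<dots> \<le> KL F G + w\<^sup>2 / (1 - w) * (1 + B)"
    using J w by simp
  finally show ?thesis .
qed

lemma integral_gain:
  assumes F: "F \<in> borel_prob" and G: "G \<in> borel_prob"
  shows "(LINT x|law F. mixture p F x / mixture p G x) = (LINT \<theta>|F. gain F G \<theta>)"
proof -
  note [measurable] = F G and [measurable_cong] = borel_probD(2)[OF F]
  interpret D: prob_space "law F" by (rule prob_space_law[OF F])
  interpret F: prob_space F by (rule borel_probD[OF F])
  interpret pair_sigma_finite F "law F" ..
  have intg: "integrable F (gain F G)"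
    using gain_bounds[OF F G] by (intro F.integrable_const_bound[of _ "1 + B"]) auto
  have "ennreal (LINT x|law F. mixture p F x / mixture p G x)
    = (\<integral>\<^sup>+x. ennreal (mixture p F x / mixture p G x) \<partial>law F)"
    by (intro nn_integral_eq_integral[symmetric] integrable_ratio F G) simp
  also have "\<dots> = (\<integral>\<^sup>+x. (\<integral>\<^sup>+\<theta>. ennreal (p x \<theta> / mixture p G x) \<partial>F) \<partial>law F)"
  proof (rule nn_integral_cong)
    fix x
    have "(\<integral>\<^sup>+\<theta>. ennreal (p x \<theta> / mixture p G x) \<partial>F) = (\<integral>\<^sup>+\<theta>. ennreal (p x \<theta>) * ennreal (1 / mixture p G x) \<partial>F)"
      by (intro nn_integral_cong) (simp add: ennreal_mult[symmetric])
    also have "\<dots> = ennreal (mixture p F x) * ennreal (1 / mixture p G x)"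
      by (simp add: nn_integral_multc ennreal_mix[OF F])
    finally show "ennreal (mixture p F x / mixture p G x) = (\<integral>\<^sup>+\<theta>. ennreal (p x \<theta> / mixture p G x) \<partial>F)"
      by (simp add: ennreal_mult[symmetric])
  qed
  also have "\<dots> = (\<integral>\<^sup>+\<theta>. (\<integral>\<^sup>+x. ennreal (p x \<theta> / mixture p G x) \<partial>law F) \<partial>F)"
    by (rule Fubini') measurable
  also have "\<dots> = (\<integral>\<^sup>+\<theta>. ennreal (gain F G \<theta>) \<partial>F)"
    unfolding gain_def
    by (intro nn_integral_cong nn_integral_eq_integral gain_bounds F G) simp
  also have "\<dots> = ennreal (LINT \<theta>|F. gain F G \<theta>)"
    using gain_bounds[OF F G] by (intro nn_integral_eq_integral intg) auto
  finally show ?thesis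
    using gain_bounds[OF F G] by (subst (asm) ennreal_inj) (auto intro!: integral_nonneg)
qed

text \<open>By Fubini \<open>\<integral> (gain F G - 1) dF\<close> is the chi-square divergence of the mixtures, which dominates the
Kullback-Leibler divergence. Replacing the density \<open>r\<close> of \<open>F\<close> by a smaller \<open>s\<close> costs at most
\<open>B\<close> times the lost mass, because \<open>gain F G - 1 \<le> B\<close>.\<close>

lemma KL_le_truncated_gain:
  assumes F: "F \<in> borel_prob" and G: "G \<in> borel_prob" and G0: "G0 \<in> borel_prob"
    and [measurable]: "r \<in> borel_measurable borel" "s \<in> borel_measurable borel"
    and rs: "\<And>\<theta>. 0 \<le> s \<theta>" "\<And>\<theta>. s \<theta> \<le> r \<theta>"
    and Fr: "F = density G0 (\<lambda>\<theta>. ennreal (r \<theta>))"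
  shows "KL F G \<le> (LINT \<theta>|G0. s \<theta> * (gain F G \<theta> - 1)) + B * (1 - (LINT \<theta>|G0. s \<theta>))"
proof -
  note [measurable] = F G and [measurable_cong] = borel_probD(2)[OF F] borel_probD(2)[OF G0]
  interpret F: prob_space F by (rule borel_probD[OF F])
  have r0: "0 \<le> r \<theta>" for \<theta> using rs[of \<theta>] by linarith
  have nnr: "(\<integral>\<^sup>+\<theta>. ennreal (r \<theta>) \<partial>G0) = 1"
    using F unfolding Fr by (intro nn_integral_eq_1_if_density_in_borel_prob) auto
  then have r: "integrable G0 r" "(LINT \<theta>|G0. r \<theta>) = 1"
    using r0 by (auto intro!: integrableI_nonneg simp: integral_eq_nn_integral)
  have s: "integrable G0 s"
    using rs r0 by (intro Bochner_Integration.integrable_bound[OF r(1)]) (auto simp: abs_of_nonneg)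
  note gb = gain_bounds[OF F G]
  have gabs: "\<bar>gain F G \<theta> - 1\<bar> \<le> 1 + B" for \<theta>
    using gb(2,3)[of \<theta>] one_le_B by (auto simp: abs_if)
  have intw: "integrable G0 (\<lambda>\<theta>. v \<theta> * (gain F G \<theta> - 1))"
    if "integrable G0 v" and [measurable]: "v \<in> borel_measurable borel" for v
  proof (rule Bochner_Integration.integrable_bound)
    show "integrable G0 (\<lambda>\<theta>. v \<theta> * (1 + B))" using that by simp
    show "AE \<theta> in G0. norm (v \<theta> * (gain F G \<theta> - 1)) \<le> norm (v \<theta> * (1 + B))"
      using gabs one_le_B by (intro AE_I2) (auto simp: abs_mult intro!: mult_left_mono)
  qed measurable
  have "KL F G \<le> (LINT \<theta>|F. gain F G \<theta>) - 1"
    using KL_le_chi_square[OF F G] by (simp add: integral_gain F G)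
  also have "\<dots> = (LINT \<theta>|F. gain F G \<theta> - 1)"
    using gb F.prob_space F.integrable_const_bound[of "gain F G" "1 + B"] by simp
  also have "\<dots> = (LINT \<theta>|G0. r \<theta> * (gain F G \<theta> - 1))"
    unfolding Fr using r0 by (subst integral_density) (auto simp: Fr[symmetric])
  also have "\<dots> \<le> (LINT \<theta>|G0. s \<theta> * (gain F G \<theta> - 1) + B * (r \<theta> - s \<theta>))"
  proof (rule integral_mono)
    fix \<theta>
    have "(r \<theta> - s \<theta>) * (gain F G \<theta> - 1) \<le> (r \<theta> - s \<theta>) * B"
      using rs(2)[of \<theta>] gb(3)[of \<theta>] by (intro mult_left_mono) auto
    then show "r \<theta> * (gain F G \<theta> - 1) \<le> s \<theta> * (gain F G \<theta> - 1) + B * (r \<theta> - s \<theta>)"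
      by (simp add: algebra_simps)
  qed (use intw r s in auto)
  also have "\<dots> = (LINT \<theta>|G0. s \<theta> * (gain F G \<theta> - 1)) + B * (1 - (LINT \<theta>|G0. s \<theta>))"
    using intw r s by simp
  finally show ?thesis .
qed

text \<open>On the parameter space: the logarithm of the density of the estimate, averaged over a subprobability \<open>S\<close>,
grows on average by \<open>w * \<integral> (gain F G - 1) dS\<close> in a Bayes step, up to a second-order error.\<close>

lemma
  assumes F: "F \<in> borel_prob" and G: "G \<in> borel_prob"
    and S: "finite_measure S" "sets S = sets borel" "measure S (space S) \<le> 1"
    and w: "0 \<le> w" "w < 1"
  shows integrable_ln_bayes_step:
      "integrable (law F) (\<lambda>y. LINT \<theta>|S. ln (1 - w + w * (p y \<theta> / mixture p G y)))"
    and integral_ln_bayes_step_ge: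
      "w * (LINT \<theta>|S. gain F G \<theta> - 1) - w\<^sup>2 / (1 - w) * (1 + B)
        \<le> (LINT y|law F. LINT \<theta>|S. ln (1 - w + w * (p y \<theta> / mixture p G y)))"
proof -
  note [measurable] = F G and [measurable_cong] = S(2)
  interpret D: prob_space "law F" by (rule prob_space_law[OF F])
  interpret S: finite_measure S by (rule S)
  interpret P: pair_sigma_finite "law F" S ..
  interpret PF: finite_measure "law F \<Otimes>\<^sub>M S"
    by (intro finite_measure_pair_measure D.finite_measure_axioms S)
  define u where "u z = p (fst z) (snd z) / mixture p G (fst z)" for z
  have u0: "0 \<le> u z" for z by (simp add: u_def)
  have [measurable]: "u \<in> borel_measurable (law F \<Otimes>\<^sub>M S)"
    unfolding u_def[abs_def] by measurable
  have sq: "(\<integral>\<^sup>+y. ennreal ((u (y, \<theta>))\<^sup>2) \<partial>law F) \<le> ennreal B" for \<theta>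
    using integrable_ratio_sq[OF F return_in_borel_prob[of \<theta>] G] integral_ratio_sq[OF F return_in_borel_prob[of \<theta>] G]
    unfolding u_def by (subst nn_integral_eq_integral) (auto simp: ennreal_leI)
  have "(\<integral>\<^sup>+z. ennreal ((u z)\<^sup>2) \<partial>(law F \<Otimes>\<^sub>M S)) = (\<integral>\<^sup>+\<theta>. (\<integral>\<^sup>+y. ennreal ((u (y, \<theta>))\<^sup>2) \<partial>law F) \<partial>S)"
    by (rule P.nn_integral_snd[symmetric]) measurable
  also have "\<dots> \<le> (\<integral>\<^sup>+\<theta>. ennreal B \<partial>S)"
    by (intro nn_integral_mono sq)
  also have "\<dots> < \<infinity>"
    by (simp add: ennreal_mult_less_top S.emeasure_eq_measure)
  finally have int2: "integrable (law F \<Otimes>\<^sub>M S) (\<lambda>z. (u z)\<^sup>2)"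
    by (intro integrableI_nonneg) auto
  have int1: "integrable (law F \<Otimes>\<^sub>M S) u"
    using u0 le_one_plus_square by (intro Bochner_Integration.integrable_bound[OF Bochner_Integration.integrable_add[OF PF.integrable_const[of 1] int2]])
      auto
  have intln: "integrable (law F \<Otimes>\<^sub>M S) (\<lambda>z. ln (1 - w + w * u z))"
  proof (rule Bochner_Integration.integrable_bound)
    show "integrable (law F \<Otimes>\<^sub>M S) (\<lambda>z. \<bar>ln (1 - w)\<bar> + u z)"
      using int1 by simp
    show "AE z in law F \<Otimes>\<^sub>M S. norm (ln (1 - w + w * u z)) \<le> norm (\<bar>ln (1 - w)\<bar> + u z)"
    proof (rule AE_I2)
      fix z
      have wu: "0 \<le> w * u z" "w * u z \<le> 1 * u z"
        using w u0[of z] mult_right_mono[of w 1 "u z"] by auto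
      have "ln (1 - w) \<le> ln (1 - w + w * u z)"
        using w wu by (intro ln_mono) auto
      moreover have "ln (1 - w + w * u z) \<le> (1 - w + w * u z) - 1"
        using w wu by (intro ln_le_minus_one) auto
      ultimately show "norm (ln (1 - w + w * u z)) \<le> norm (\<bar>ln (1 - w)\<bar> + u z)"
        using wu w u0[of z] unfolding real_norm_def by arith
    qed
  qed measurable
  define l where "l z = w * (u z - 1) - w\<^sup>2 / (1 - w) * (1 + (u z)\<^sup>2)" for z
  have intl: "integrable (law F \<Otimes>\<^sub>M S) l"
    unfolding l_def[abs_def] using int1 int2 by simp
  have "w * (LINT \<theta>|S. gain F G \<theta> - 1) - w\<^sup>2 / (1 - w) * (1 + B)
    \<le> (LINT \<theta>|S. w * (gain F G \<theta> - 1) - w\<^sup>2 / (1 - w) * (1 + B))"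
  proof -
    have "integrable S (gain F G)"
      using gain_bounds[OF F G] by (intro S.integrable_const_bound[of _ "1 + B"]) auto
    then have "(LINT \<theta>|S. w * (gain F G \<theta> - 1) - w\<^sup>2 / (1 - w) * (1 + B))
      = w * (LINT \<theta>|S. gain F G \<theta> - 1) - measure S (space S) * (w\<^sup>2 / (1 - w) * (1 + B))"
      by simp
    moreover have "measure S (space S) * (w\<^sup>2 / (1 - w) * (1 + B)) \<le> 1 * (w\<^sup>2 / (1 - w) * (1 + B))"
      using S(3) w one_le_B by (intro mult_right_mono) auto
    ultimately show ?thesis by simp
  qed
  also have "\<dots> \<le> (LINT \<theta>|S. LINT y|law F. l (y, \<theta>))"
  proof (rule integral_mono)
    fix \<theta>
    have iu: "integrable (law F) (\<lambda>y. u (y, \<theta>))" "(LINT y|law F. u (y, \<theta>)) = gain F G \<theta>"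
      using gain_bounds[OF F G] by (auto simp: u_def gain_def)
    have iu2: "integrable (law F) (\<lambda>y. (u (y, \<theta>))\<^sup>2)" "(LINT y|law F. (u (y, \<theta>))\<^sup>2) \<le> B"
      using integrable_ratio_sq[OF F return_in_borel_prob[of \<theta>] G] integral_ratio_sq[OF F return_in_borel_prob[of \<theta>] G]
      by (auto simp: u_def)
    have "(LINT y|law F. l (y, \<theta>)) = w * (gain F G \<theta> - 1) - w\<^sup>2 / (1 - w) * (1 + (LINT y|law F. (u (y, \<theta>))\<^sup>2))"
      using iu iu2(1) D.prob_space by (simp add: l_def)
    moreover have "w\<^sup>2 / (1 - w) * (1 + (LINT y|law F. (u (y, \<theta>))\<^sup>2)) \<le> w\<^sup>2 / (1 - w) * (1 + B)"
      using iu2 w by (intro mult_left_mono) auto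
    ultimately show "w * (gain F G \<theta> - 1) - w\<^sup>2 / (1 - w) * (1 + B) \<le> (LINT y|law F. l (y, \<theta>))"
      by simp
    show "integrable S (\<lambda>\<theta>. w * (gain F G \<theta> - 1) - w\<^sup>2 / (1 - w) * (1 + B))"
      using gain_bounds[OF F G] S.integrable_const_bound[of "gain F G" "1 + B"] by simp
  qed (use P.integrable_snd[of "\<lambda>y \<theta>. l (y, \<theta>)"] intl in simp)
  also have "\<dots> = integral\<^sup>L (law F \<Otimes>\<^sub>M S) l"
    using P.integral_snd[of "\<lambda>y \<theta>. l (y, \<theta>)"] intl by simp
  also have "\<dots> \<le> (LINT z|(law F \<Otimes>\<^sub>M S). ln (1 - w + w * u z))"
    unfolding l_def using w u0 by (intro integral_mono intln intl[unfolded l_def[abs_def]] ln_convex_step_ge)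
  also have "\<dots> = (LINT y|law F. LINT \<theta>|S. ln (1 - w + w * (p y \<theta> / mixture p G y)))"
    using P.integral_fst'[OF intln] by (simp add: u_def)
  finally show "w * (LINT \<theta>|S. gain F G \<theta> - 1) - w\<^sup>2 / (1 - w) * (1 + B)
    \<le> (LINT y|law F. LINT \<theta>|S. ln (1 - w + w * (p y \<theta> / mixture p G y)))" .
  show "integrable (law F) (\<lambda>y. LINT \<theta>|S. ln (1 - w + w * (p y \<theta> / mixture p G y)))"
    using P.integrable_fst'[OF intln] by (simp add: u_def)
qed

end

section \<open>The risk of the recursive estimate\<close>

text \<open>A nonnegative sequence that is decreasing up to summable errors converges to 0 once it comes arbitrarily close to 0
infinitely often. The latter follows from a drift argument: if \<open>b n \<ge> \<epsilon>\<close> from some point on,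
divergence of the weights would drive \<open>L\<close> above its bound.\<close>

lemma almost_decreasing_tendsto_0:
  fixes k a w :: "nat \<Rightarrow> real"
  assumes k0: "\<And>n. 0 \<le> k n" and dec: "\<And>n. k (Suc n) \<le> k n + a (Suc n)"
    and a0: "\<And>n. 0 \<le> a (Suc n)" and suma: "summable (\<lambda>n. a (Suc n))"
    and sumw: "filterlim (\<lambda>n. \<Sum>i=1..n. w i) at_top sequentially"
    and w0: "\<And>i. i \<ge> 1 \<Longrightarrow> 0 < w i"
    and small: "\<And>\<epsilon>. \<epsilon> > 0 \<Longrightarrow> \<exists>b L C. (\<forall>n. k n \<le> b n + \<epsilon>) \<and>
      (\<forall>n. L n + w (Suc n) * b n - a (Suc n) \<le> L (Suc n)) \<and> (\<forall>n. L n \<le> (C::real))"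
  shows "k \<longlonglongrightarrow> 0"
proof (rule LIMSEQ_I)
  fix \<epsilon> :: real assume "\<epsilon> > 0"
  then have e3: "\<epsilon> / 3 > 0" by simp
  obtain b L C where b: "\<And>n. k n \<le> b n + \<epsilon> / 3"
    and L: "\<And>n. L n + w (Suc n) * b n - a (Suc n) \<le> L (Suc n)" "\<And>n. L n \<le> C"
    using small[OF e3] by auto
  obtain N where N: "\<And>m n. m \<ge> N \<Longrightarrow> \<bar>\<Sum>i=m..<n. a (Suc i)\<bar> < \<epsilon> / 3"
    using suma e3 unfolding summable_Cauchy real_norm_def by blast
  have "\<exists>m\<ge>N. b m < \<epsilon> / 3"
  proof (rule ccontr)
    assume "\<not> (\<exists>m\<ge>N. b m < \<epsilon> / 3)"
    then have bN: "\<And>m. m \<ge> N \<Longrightarrow> \<epsilon> / 3 \<le> b m" by force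
    have grow: "L N + \<epsilon> / 3 * (\<Sum>i=N..<N+n. w (Suc i)) - (\<Sum>i=N..<N+n. a (Suc i)) \<le> L (N + n)" for n
    proof (induction n)
      case (Suc n)
      have "w (Suc (N + n)) * (\<epsilon> / 3) \<le> w (Suc (N + n)) * b (N + n)"
        using bN[of "N + n"] w0[of "Suc (N + n)"] by (intro mult_left_mono) auto
      with Suc L(1)[of "N + n"] show ?case by (simp add: algebra_simps)
    qed simp
    have ub: "(\<Sum>i=1..N+n. w i) \<le> (\<Sum>i=1..N. w i) + (C + \<epsilon> / 3 - L N) / (\<epsilon> / 3)" for n
    proof -
      have "(\<Sum>i=1..N+n. w i) = (\<Sum>i=1..N. w i) + (\<Sum>i=N..<N+n. w (Suc i))"
      proof (induction n)
        case (Suc n)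
        then show ?case by (simp add: sum.atLeast_Suc_atMost)
      qed simp
      moreover have "\<epsilon> / 3 * (\<Sum>i=N..<N+n. w (Suc i)) \<le> C + \<epsilon> / 3 - L N"
        using grow[of n] L(2)[of "N + n"] N[of N "N + n"] by (auto simp: abs_if split: if_splits)
      ultimately show ?thesis
        using e3 by (simp add: pos_le_divide_eq mult.commute)
    qed
    have "\<forall>\<^sub>F n in sequentially. (\<Sum>i=1..N. w i) + (C + \<epsilon> / 3 - L N) / (\<epsilon> / 3) < (\<Sum>i=1..n. w i)"
      using sumw by (simp add: filterlim_at_top_dense)
    then obtain n0 where "\<And>n. n \<ge> n0 \<Longrightarrow>
        (\<Sum>i=1..N. w i) + (C + \<epsilon> / 3 - L N) / (\<epsilon> / 3) < (\<Sum>i=1..n. w i)"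
      unfolding eventually_sequentially by blast
    from this[of "N + n0"] ub[of n0] show False by simp
  qed
  then obtain m where m: "m \<ge> N" "b m < \<epsilon> / 3" by blast
  have km: "k (m + n) \<le> k m + (\<Sum>i=m..<m+n. a (Suc i))" for n
  proof (induction n)
    case (Suc n)
    with dec[of "m + n"] show ?case by simp
  qed simp
  have "k m < 2 * \<epsilon> / 3" using b[of m] m by simp
  then have "k (m + n) < \<epsilon>" for n
    using N[OF m(1), of "m + n"] km[of n] by arith
  then have "\<forall>n\<ge>m. norm (k n - 0) < \<epsilon>"
    using k0 by (metis abs_of_nonneg diff_zero le_add_diff_inverse real_norm_def)
  then show "\<exists>no. \<forall>n\<ge>no. norm (k n - 0) < \<epsilon>" by blast
qed

text \<open>The recursion is started from the constant density 1 with respect to the initial distribution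
\<open>G0\<close>. Then every estimate is bounded below by a positive constant, so its logarithm is
harmless even where the initial density vanishes.
The function \<open>r\<close> is the density of the true mixing distribution \<open>F\<close>.\<close>

locale recursive_mixture = bounded_ratio_model \<nu> p B
  for \<nu> :: "'x measure" and p :: "'x \<Rightarrow> 't::{metric_space, second_countable_topology} \<Rightarrow> real" and B +
  fixes F G0 :: "'t measure" and r :: "'t \<Rightarrow> real" and w :: "nat \<Rightarrow> real"
  assumes F: "F \<in> borel_prob" and G0: "G0 \<in> borel_prob"
    and measurable_r [measurable]: "r \<in> borel_measurable borel" and r_nonneg: "\<And>\<theta>. 0 \<le> r \<theta>"
    and F_density: "F = density G0 (\<lambda>\<theta>. ennreal (r \<theta>))"
    and weights: "\<And>i. i \<ge> 1 \<Longrightarrow> 0 < w i \<and> w i < 1"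
begin

declare F[measurable] G0[measurable]

definition est :: "(nat \<Rightarrow> 'x) \<Rightarrow> nat \<Rightarrow> 't \<Rightarrow> real" where
  "est x n = rec_est p G0 w (\<lambda>_. 1) x n"

definition est_measure :: "(nat \<Rightarrow> 'x) \<Rightarrow> nat \<Rightarrow> 't measure" where
  "est_measure x n = density G0 (\<lambda>\<theta>. ennreal (est x n \<theta>))"

definition sample_law :: "nat \<Rightarrow> (nat \<Rightarrow> 'x) measure" where
  "sample_law n = PiM {1..n} (\<lambda>_. law F)"

text \<open>On good samples no denominator of the recursion vanishes, and all estimates are probability densities. A
vanishing denominator would make the posterior 0, by the convention \<open>a / 0 = 0\<close>, and mass would be lost.\<close>

definition good :: "(nat \<Rightarrow> 'x) \<Rightarrow> nat \<Rightarrow> bool" where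
  "good x n \<longleftrightarrow> (\<forall>i\<in>{1..n}. 0 < mixture p F (x i))"

sublocale D: prob_space "law F" by (rule prob_space_law[OF F])
sublocale G0: prob_space G0 by (rule borel_probD[OF G0])

lemma sets_G0 [measurable_cong]: "sets G0 = sets borel"
  by (rule borel_probD[OF G0])

lemma est_0 [simp]: "est x 0 = (\<lambda>_. 1)"
  by (simp add: est_def)

lemma est_Suc:
  "est x (Suc n) \<theta> = est x n \<theta> *
     (1 - w (Suc n) + w (Suc n) * (p (x (Suc n)) \<theta> / (LINT \<theta>'|G0. est x n \<theta>' * p (x (Suc n)) \<theta>')))"
  by (simp add: est_def algebra_simps)

lemma measurable_est_param [measurable]: "est x n \<in> borel_measurable borel"
proof (induction n)
  case (Suc n)
  note [measurable] = Suc
  show ?case unfolding est_Suc[abs_def] by measurable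
qed simp

lemma est_lower: "0 < (\<Prod>i=1..n. 1 - w i) \<and> (\<Prod>i=1..n. 1 - w i) \<le> est x n \<theta>"
proof (induction n arbitrary: \<theta>)
  case (Suc n)
  have w: "0 < w (Suc n)" "w (Suc n) < 1" using weights[of "Suc n"] by auto
  have pos: "0 \<le> est x n \<theta>'" for \<theta>' using Suc[of \<theta>'] by linarith
  have "(\<Prod>i=1..n. 1 - w i) * (1 - w (Suc n)) \<le> est x (Suc n) \<theta>"
    unfolding est_Suc using Suc[of \<theta>] w pos by (intro mult_mono) auto
  moreover have "(\<Prod>i=1..Suc n. 1 - w i) = (\<Prod>i=1..n. 1 - w i) * (1 - w (Suc n))"
    by simp
  ultimately show ?case
    using Suc[of \<theta>] w by simp
qed simp

lemma est_pos: "0 < est x n \<theta>"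
  using est_lower[of n x \<theta>] by linarith

lemma est_nonneg [simp]: "0 \<le> est x n \<theta>"
  using est_pos[of x n \<theta>] by linarith

lemma ex_est_bound: "\<exists>b\<ge>0. \<forall>\<theta>. est x n \<theta> \<le> b"
proof (induction n)
  case (Suc n)
  then obtain b where b: "0 \<le> b" "\<And>\<theta>. est x n \<theta> \<le> b" by blast
  define m where "m = (LINT \<theta>'|G0. est x n \<theta>' * p (x (Suc n)) \<theta>')"
  have m: "0 \<le> m" by (simp add: m_def)
  obtain c where c: "0 \<le> c" "\<And>\<theta>. p (x (Suc n)) \<theta> \<le> c" using ex_p_bound by blast
  have w: "0 < w (Suc n)" "w (Suc n) < 1" using weights[of "Suc n"] by auto
  have "est x (Suc n) \<theta> \<le> b * (1 - w (Suc n) + w (Suc n) * (c / m))" for \<theta>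
    unfolding est_Suc m_def[symmetric] using b c w m
    by (intro mult_mono add_left_mono mult_left_mono divide_right_mono) auto
  moreover have "0 \<le> b * (1 - w (Suc n) + w (Suc n) * (c / m))"
    using b c w m by (intro mult_nonneg_nonneg add_nonneg_nonneg) auto
  ultimately show ?case by blast
qed (auto intro: exI[of _ 1])

lemma measurable_est [measurable (raw)]:
  assumes "f \<in> N \<rightarrow>\<^sub>M PiM I (\<lambda>_. law F)" "g \<in> N \<rightarrow>\<^sub>M borel" and "{1..n} \<subseteq> I"
  shows "(\<lambda>z. est (f z) n (g z)) \<in> borel_measurable N"
proof -
  have "(\<lambda>z. est (fst z) n (snd z)) \<in> borel_measurable (PiM I (\<lambda>_. law F) \<Otimes>\<^sub>M borel)"
    using assms(3)
  proof (induction n)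
    case (Suc n)
    have IH: "(\<lambda>z. est (fst z) n (snd z)) \<in> borel_measurable (PiM I (\<lambda>_. law F) \<Otimes>\<^sub>M borel)"
      by (intro Suc.IH subset_trans[OF _ Suc.prems]) auto
    note [measurable] = IH
    have comp: "(\<lambda>x. x (Suc n)) \<in> PiM I (\<lambda>_. law F) \<rightarrow>\<^sub>M law F"
      using Suc.prems by (intro measurable_component_singleton) auto
    have [measurable]: "(\<lambda>x. x (Suc n)) \<in> PiM I (\<lambda>_. law F) \<rightarrow>\<^sub>M \<nu>"
      using comp unfolding measurable_cong_sets[OF refl sets_law] .
    have [measurable]: "(\<lambda>z. est (fst (fst z)) n (snd z)) \<in>
        borel_measurable ((PiM I (\<lambda>_. law F) \<Otimes>\<^sub>M borel) \<Otimes>\<^sub>M G0)"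
    proof -
      have "(\<lambda>z. (fst (fst z), snd z)) \<in>
          (PiM I (\<lambda>_. law F) \<Otimes>\<^sub>M borel) \<Otimes>\<^sub>M G0 \<rightarrow>\<^sub>M PiM I (\<lambda>_. law F) \<Otimes>\<^sub>M borel"
        by measurable
      from measurable_compose[OF this IH] show ?thesis by simp
    qed
    show ?case unfolding est_Suc by measurable
  qed simp
  from measurable_compose[OF measurable_Pair[OF assms(1,2)] this] show ?thesis
    by simp
qed

lemma est_measure_0 [simp]: "est_measure x 0 = G0"
  by (simp add: est_measure_def density_1)

lemma mix_est_measure: "mixture p (est_measure x n) y = (LINT \<theta>|G0. est x n \<theta> * p y \<theta>)"
  unfolding est_measure_def by (intro mix_density G0) auto

lemma est_Suc':
  "est x (Suc n) \<theta> = est x n \<theta> *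
     (1 - w (Suc n) + w (Suc n) * (p (x (Suc n)) \<theta> / mixture p (est_measure x n) (x (Suc n))))"
  unfolding mix_est_measure by (rule est_Suc)

lemma est_measure_Suc:
  "est_measure x (Suc n) = bayes_step (w (Suc n)) (est_measure x n) (x (Suc n))"
proof -
  have w: "0 < w (Suc n)" "w (Suc n) < 1" using weights[of "Suc n"] by auto
  have pos: "0 \<le> 1 - w (Suc n) + w (Suc n) * (p (x (Suc n)) \<theta> / mixture p (est_measure x n) (x (Suc n)))" for \<theta>
    using w by (intro add_nonneg_nonneg) auto
  have "est_measure x (Suc n) = density G0 (\<lambda>\<theta>. ennreal (est x n \<theta>) *
      ennreal (1 - w (Suc n) + w (Suc n) * (p (x (Suc n)) \<theta> / mixture p (est_measure x n) (x (Suc n)))))"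
    unfolding est_measure_def[of x "Suc n"] est_Suc' ennreal_mult[OF est_nonneg pos] ..
  also have "\<dots> = bayes_step (w (Suc n)) (est_measure x n) (x (Suc n))"
    unfolding bayes_step_def est_measure_def[of x n] by (rule density_density_eq[symmetric]) measurable
  finally show ?thesis .
qed

lemma est_cong:
  assumes "\<And>i. i \<in> {1..n} \<Longrightarrow> x i = y i"
  shows "est x n = est y n"
  using assms
proof (induction n)
  case (Suc n)
  then have "est x n = est y n" "x (Suc n) = y (Suc n)" by auto
  then show ?case by (intro ext) (simp add: est_Suc)
qed simp

text \<open>The density \<open>est x n\<close> is positive with respect to \<open>G0\<close>, which dominates \<open>F\<close>: where the mixture
of the estimate vanishes, \<open>p y\<close> is 0 almost everywhere under \<open>G0\<close>, hence under \<open>F\<close>.\<close>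

lemma mix_est_measure_pos:
  assumes "est_measure x n \<in> borel_prob" and "0 < mixture p F y"
  shows "0 < mixture p (est_measure x n) y"
proof (rule ccontr)
  assume "\<not> 0 < mixture p (est_measure x n) y"
  then have 0: "(LINT \<theta>|G0. est x n \<theta> * p y \<theta>) = 0"
    using mix_nonneg[of "est_measure x n" y] unfolding mix_est_measure by linarith
  obtain b where b: "0 \<le> b" "\<And>\<theta>. est x n \<theta> \<le> b" using ex_est_bound by blast
  obtain c where c: "0 \<le> c" "\<And>\<theta>. p y \<theta> \<le> c" using ex_p_bound by blast
  have "integrable G0 (\<lambda>\<theta>. est x n \<theta> * p y \<theta>)"
    by (rule G0.integrable_const_bound[of _ "b * c"]) (use b c in \<open>auto intro!: mult_mono\<close>)
  then have "AE \<theta> in G0. est x n \<theta> * p y \<theta> = 0"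
    using 0 by (subst (asm) integral_nonneg_eq_0_iff_AE) auto
  then have "AE \<theta> in G0. r \<theta> * p y \<theta> = 0"
    by eventually_elim (use est_pos in \<open>auto simp: less_le\<close>)
  then have "(LINT \<theta>|G0. r \<theta> * p y \<theta>) = (LINT \<theta>|G0. 0)"
    by (intro integral_cong_AE) measurable
  moreover have "mixture p F y = (LINT \<theta>|G0. r \<theta> * p y \<theta>)"
    unfolding F_density by (intro mix_density G0) (auto simp: r_nonneg)
  ultimately have "mixture p F y = 0"
    by simp
  with assms(2) show False by simp
qed

lemma est_measure_in_borel_prob:
  assumes "good x n"
  shows "est_measure x n \<in> borel_prob"
  using assms
proof (induction n)
  case (Suc n)
  then have "est_measure x n \<in> borel_prob" by (auto simp: good_def)
  moreover have "0 < mixture p F (x (Suc n))" using Suc.prems by (auto simp: good_def)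
  ultimately show ?case
    unfolding est_measure_Suc using weights[of "Suc n"]
    by (intro bayes_step_in_borel_prob mix_est_measure_pos) auto
qed (simp add: G0)

lemma nn_integral_r: "(\<integral>\<^sup>+\<theta>. ennreal (r \<theta>) \<partial>G0) = 1"
  using F unfolding F_density by (intro nn_integral_eq_1_if_density_in_borel_prob) auto

lemma nn_integral_est: "good x n \<Longrightarrow> (\<integral>\<^sup>+\<theta>. ennreal (est x n \<theta>) \<partial>G0) = 1"
  using est_measure_in_borel_prob[of x n] unfolding est_measure_def
  by (intro nn_integral_eq_1_if_density_in_borel_prob) auto

lemma prob_space_sample_law: "prob_space (sample_law n)"
  unfolding sample_law_def by (intro prob_space_PiM D.prob_space_axioms)

lemma AE_good: "AE x in sample_law n. good x n"
  unfolding good_def sample_law_def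
  by (intro AE_finite_allI AE_PiM_component[of _ "\<lambda>_. law F"] D.prob_space_axioms AE_mix_pos F) auto

text \<open>Conditioning on the first \<open>n\<close> observations: the last one is integrated out first.\<close>

lemma
  fixes \<Phi> :: "(nat \<Rightarrow> 'x) \<Rightarrow> real"
  assumes \<Phi>: "integrable (sample_law (Suc n)) \<Phi>"
  shows integrable_sample_law_Suc: "integrable (sample_law n) (\<lambda>x. LINT y|law F. \<Phi> (x(Suc n := y)))"
    and integral_sample_law_Suc:
      "(LINT x|sample_law n. LINT y|law F. \<Phi> (x(Suc n := y))) = integral\<^sup>L (sample_law (Suc n)) \<Phi>"
proof -
  interpret Q: prob_space "sample_law n" by (rule prob_space_sample_law)
  interpret pair_sigma_finite "law F" "sample_law n" ..
  have eq: "distr (law F \<Otimes>\<^sub>M sample_law n) (sample_law (Suc n)) (\<lambda>(y, x). x(Suc n := y)) = sample_law (Suc n)"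
    using distr_pair_PiM_eq_PiM[of "{1..n}" "\<lambda>_. law F" "Suc n"] D.prob_space_axioms
    unfolding sample_law_def by (simp add: atLeastAtMostSuc_conv)
  have [measurable]: "(\<lambda>(y, x). x(Suc n := y)) \<in> law F \<Otimes>\<^sub>M sample_law n \<rightarrow>\<^sub>M sample_law (Suc n)"
    unfolding sample_law_def by (simp add: atLeastAtMostSuc_conv case_prod_unfold) measurable
  have [measurable]: "\<Phi> \<in> borel_measurable (sample_law (Suc n))"
    using \<Phi> by simp
  have int: "integrable (law F \<Otimes>\<^sub>M sample_law n) (\<lambda>(y, x). \<Phi> (x(Suc n := y)))"
    using \<Phi> integrable_distr_eq[of "\<lambda>(y, x). x(Suc n := y)" "law F \<Otimes>\<^sub>M sample_law n" "sample_law (Suc n)" \<Phi>]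
    by (simp add: eq[unfolded case_prod_unfold] case_prod_unfold)
  show "integrable (sample_law n) (\<lambda>x. LINT y|law F. \<Phi> (x(Suc n := y)))"
    using integrable_snd[OF int] .
  show "(LINT x|sample_law n. LINT y|law F. \<Phi> (x(Suc n := y))) = integral\<^sup>L (sample_law (Suc n)) \<Phi>"
    using integral_snd[OF int]
      integral_distr[of "\<lambda>(y, x). x(Suc n := y)" "law F \<Otimes>\<^sub>M sample_law n" "sample_law (Suc n)" \<Phi>]
    by (simp add: eq[unfolded case_prod_unfold] case_prod_unfold)
qed

lemma est_update: "est (x(Suc n := y)) n = est x n"
  by (rule est_cong) auto

lemma est_measure_update:
  "est_measure (x(Suc n := y)) (Suc n) = bayes_step (w (Suc n)) (est_measure x n) y"
  unfolding est_measure_Suc by (simp add: est_measure_def est_update)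

lemma measurable_mix_est_measure [measurable (raw)]:
  assumes [measurable]: "f \<in> N \<rightarrow>\<^sub>M sample_law n" "g \<in> N \<rightarrow>\<^sub>M \<nu>"
  shows "(\<lambda>z. mixture p (est_measure (f z) n) (g z)) \<in> borel_measurable N"
proof -
  have [measurable]: "(\<lambda>z. est (f (fst z)) n (snd z)) \<in> borel_measurable (N \<Otimes>\<^sub>M G0)"
    using measurable_compose[OF measurable_fst assms(1)[unfolded sample_law_def]]
    by (rule measurable_est[where I = "{1..n}"]) auto
  show ?thesis unfolding mix_est_measure by measurable
qed

definition risk :: "nat \<Rightarrow> real" where
  "risk n = (LINT x|sample_law n. KL F (est_measure x n))"

lemma integrable_KL_est_measure: "integrable (sample_law n) (\<lambda>x. KL F (est_measure x n))"
proof -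
  interpret Q: prob_space "sample_law n" by (rule prob_space_sample_law)
  show ?thesis
  proof (rule Q.integrable_const_bound[of _ B])
    show "AE x in sample_law n. norm (KL F (est_measure x n)) \<le> B"
      using AE_good by eventually_elim (simp add: est_measure_in_borel_prob F KL_nonneg KL_le_B)
    show "(\<lambda>x. KL F (est_measure x n)) \<in> borel_measurable (sample_law n)"
      unfolding KL_def by measurable
  qed
qed

lemma risk_nonneg: "0 \<le> risk n"
  unfolding risk_def using AE_good[of n]
  by (intro integral_nonneg_AE; eventually_elim) (simp add: est_measure_in_borel_prob F KL_nonneg)

lemma risk_Suc_le:
  "risk (Suc n) \<le> risk n + (w (Suc n))\<^sup>2 / (1 - w (Suc n)) * (1 + B)"
proof -
  interpret Q: prob_space "sample_law n" by (rule prob_space_sample_law)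
  have w: "0 < w (Suc n)" "w (Suc n) < 1" using weights[of "Suc n"] by auto
  have "risk (Suc n) = (LINT x|sample_law n. LINT y|law F. KL F (bayes_step (w (Suc n)) (est_measure x n) y))"
    unfolding risk_def integral_sample_law_Suc[OF integrable_KL_est_measure, symmetric] est_measure_update ..
  also have "\<dots> \<le> (LINT x|sample_law n. KL F (est_measure x n) + (w (Suc n))\<^sup>2 / (1 - w (Suc n)) * (1 + B))"
  proof (rule integral_mono_AE)
    show "integrable (sample_law n) (\<lambda>x. LINT y|law F. KL F (bayes_step (w (Suc n)) (est_measure x n) y))"
      using integrable_sample_law_Suc[OF integrable_KL_est_measure] unfolding est_measure_update .
    show "AE x in sample_law n. (LINT y|law F. KL F (bayes_step (w (Suc n)) (est_measure x n) y))
        \<le> KL F (est_measure x n) + (w (Suc n))\<^sup>2 / (1 - w (Suc n)) * (1 + B)"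
      using AE_good
      by eventually_elim (use w in \<open>intro integral_KL_bayes_step_le F est_measure_in_borel_prob; simp\<close>)
  qed (simp add: integrable_KL_est_measure)
  also have "\<dots> = risk n + (w (Suc n))\<^sup>2 / (1 - w (Suc n)) * (1 + B)"
    using Q.prob_space by (simp add: risk_def integrable_KL_est_measure)
  finally show ?thesis .
qed

text \<open>The drift argument on the parameter space, for a bounded part \<open>s\<close> of the density \<open>r\<close>. Here \<open>b n\<close> is the
expected first-order growth of \<open>L n\<close>, the expected logarithm of the estimate averaged over
the measure \<open>S\<close> with density \<open>s\<close>. Boundedness of \<open>s\<close> keeps \<open>L\<close> bounded above: \<open>ln t \<le> t\<close>, and the
estimate integrates to 1 with respect to \<open>G0\<close>. For \<open>s = r\<close> the bound would be the Kullback-Leibler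
divergence of \<open>F\<close> from \<open>G0\<close>, which may be infinite; hence the truncation.\<close>

lemma ex_truncated_drift:
  assumes s[measurable]: "s \<in> borel_measurable borel" and s0: "\<And>\<theta>. 0 \<le> s \<theta>"
    and sr: "\<And>\<theta>. s \<theta> \<le> r \<theta>" and sM: "\<And>\<theta>. s \<theta> \<le> M"
  shows "\<exists>b L. (\<forall>n. risk n \<le> b n + B * (1 - (LINT \<theta>|G0. s \<theta>))) \<and>
     (\<forall>n. L n + w (Suc n) * b n - (w (Suc n))\<^sup>2 / (1 - w (Suc n)) * (1 + B) \<le> L (Suc n)) \<and>
     (\<forall>n. L n \<le> M)"
proof -
  interpret Q: prob_space "sample_law n" for n by (rule prob_space_sample_law)
  define S where "S = density G0 (\<lambda>\<theta>. ennreal (s \<theta>))"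
  have setsS: "sets S = sets borel"
    by (simp add: S_def sets_G0)
  note [measurable_cong] = setsS
  have spaceS: "space S = UNIV"
    using sets_eq_imp_space_eq[OF setsS] by simp
  have int_s: "integrable G0 s"
    using s0 sM by (intro G0.integrable_const_bound[of _ M]) auto
  have emS: "emeasure S (space S) = ennreal (LINT \<theta>|G0. s \<theta>)"
    using s0 int_s by (simp add: S_def emeasure_density nn_integral_eq_integral cong: nn_integral_cong)
  interpret S: finite_measure S
    by (rule finite_measureI) (simp add: emS)
  have "ennreal (LINT \<theta>|G0. s \<theta>) \<le> ennreal 1"
    using nn_integral_r nn_integral_mono[of G0 "\<lambda>\<theta>. ennreal (s \<theta>)" "\<lambda>\<theta>. ennreal (r \<theta>)"] sr s0 int_s
    by (simp add: nn_integral_eq_integral ennreal_leI)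
  then have mS: "measure S (space S) \<le> 1"
    using emS s0 by (simp add: measure_def)
  have M0: "0 \<le> M" using s0 sM order_trans by blast
  have int_S: "(LINT \<theta>|S. h \<theta>) = (LINT \<theta>|G0. s \<theta> * h \<theta>)"
    if [measurable]: "h \<in> borel_measurable borel" for h :: "'t \<Rightarrow> real"
    unfolding S_def using s0 by (subst integral_density) auto
  define b where "b n = (LINT x|sample_law n. LINT \<theta>|S. gain F (est_measure x n) \<theta> - 1)" for n
  define \<Phi> where "\<Phi> n x = (LINT \<theta>|S. ln (est x n \<theta>))" for n x
  define L where "L n = integral\<^sup>L (sample_law n) (\<Phi> n)" for n
  have int_ln: "integrable S (\<lambda>\<theta>. ln (est x n \<theta>))" for x n
  proof -
    define c where "c = (\<Prod>i=1..n. 1 - w i)"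
    obtain d where d: "\<And>\<theta>. est x n \<theta> \<le> d" using ex_est_bound by blast
    show ?thesis
    proof (rule S.integrable_const_bound[of _ "\<bar>ln c\<bar> + \<bar>ln d\<bar>"], rule AE_I2)
      fix \<theta>
      have "ln c \<le> ln (est x n \<theta>)" "ln (est x n \<theta>) \<le> ln d"
        using est_lower[of n x \<theta>] d[of \<theta>] by (auto simp: c_def intro!: ln_mono)
      then show "norm (ln (est x n \<theta>)) \<le> \<bar>ln c\<bar> + \<bar>ln d\<bar>"
        unfolding real_norm_def by arith
    qed simp
  qed
  \<comment> \<open>The lower bound serves integrability only and may depend on \<open>n\<close>; the upper one must not.\<close>
  have \<Phi>_bounds: "- \<bar>ln (\<Prod>i=1..n. 1 - w i)\<bar> \<le> \<Phi> n x" "\<Phi> n x \<le> M" if "good x n" for n x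
  proof -
    define c where "c = (\<Prod>i=1..n. 1 - w i)"
    have "- \<bar>ln c\<bar> \<le> measure S (space S) * (- \<bar>ln c\<bar>)"
      using mS mult_right_mono[OF mS, of "\<bar>ln c\<bar>"] by simp
    also have "\<dots> = (LINT \<theta>|S. - \<bar>ln c\<bar>)" by simp
    also have "\<dots> \<le> \<Phi> n x"
      unfolding \<Phi>_def
    proof (rule integral_mono[OF _ int_ln])
      fix \<theta>
      have "ln c \<le> ln (est x n \<theta>)"
        using est_lower[of n x \<theta>] by (auto simp: c_def intro!: ln_mono)
      then show "- \<bar>ln c\<bar> \<le> ln (est x n \<theta>)" by arith
    qed simp
    finally show "- \<bar>ln (\<Prod>i=1..n. 1 - w i)\<bar> \<le> \<Phi> n x" by (simp add: c_def)
    obtain d where d: "\<And>\<theta>. est x n \<theta> \<le> d" using ex_est_bound by blast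
    have int_est: "integrable G0 (est x n)"
      using d by (intro G0.integrable_const_bound[of _ d]) auto
    have "(\<integral>\<^sup>+\<theta>. ennreal (est x n \<theta>) \<partial>G0) = 1"
      by (rule nn_integral_est[OF that])
    then have est1: "(LINT \<theta>|G0. est x n \<theta>) = 1"
      by (simp add: integral_eq_nn_integral)
    have "\<Phi> n x \<le> (LINT \<theta>|S. est x n \<theta>)"
      unfolding \<Phi>_def
    proof (rule integral_mono[OF int_ln])
      show "integrable S (est x n)"
        using d by (intro S.integrable_const_bound[of _ d]) auto
      show "ln (est x n \<theta>) \<le> est x n \<theta>" for \<theta>
        using ln_le_minus_one[OF est_pos[of x n \<theta>]] by simp
    qed
    also have "\<dots> = (LINT \<theta>|G0. s \<theta> * est x n \<theta>)"
      by (rule int_S) simp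
    also have "\<dots> \<le> (LINT \<theta>|G0. M * est x n \<theta>)"
    proof (rule integral_mono)
      have "0 \<le> d" using d est_nonneg order_trans by blast
      then show "integrable G0 (\<lambda>\<theta>. s \<theta> * est x n \<theta>)"
        using s0 sM d by (intro G0.integrable_const_bound[of _ "M * d"]) (auto intro!: mult_mono M0)
    qed (use int_est sM in \<open>auto intro: mult_right_mono\<close>)
    also have "\<dots> = M" using est1 by simp
    finally show "\<Phi> n x \<le> M" .
  qed
  have meas\<Phi>: "\<Phi> n \<in> borel_measurable (sample_law n)" for n
  proof -
    have [measurable]: "(\<lambda>z. est (fst z) n (snd z)) \<in> borel_measurable (sample_law n \<Otimes>\<^sub>M S)"
      by (rule measurable_est[where I = "{1..n}"]) (auto simp: sample_law_def)
    show ?thesis unfolding \<Phi>_def[abs_def] by measurable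
  qed
  have int\<Phi>: "integrable (sample_law n) (\<Phi> n)" for n
  proof (rule Q.integrable_const_bound[where B = "\<bar>ln (\<Prod>i=1..n. 1 - w i)\<bar> + M"])
    show "AE x in sample_law n. norm (\<Phi> n x) \<le> \<bar>ln (\<Prod>i=1..n. 1 - w i)\<bar> + M"
      using AE_good
    proof eventually_elim
      case (elim x)
      then show ?case using \<Phi>_bounds[OF elim] M0 unfolding real_norm_def by arith
    qed
  qed (rule meas\<Phi>)
  have "L n \<le> M" for n
  proof -
    have "L n \<le> (LINT x|sample_law n. M)"
      unfolding L_def using AE_good[of n] \<Phi>_bounds(2)
      by (intro integral_mono_AE int\<Phi>) auto
    then show ?thesis using Q.prob_space[of n] by simp
  qed
  have gain_S: "integrable S (gain F G)" "\<bar>LINT \<theta>|S. gain F G \<theta> - 1\<bar> \<le> 1 + B"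
    if G: "G \<in> borel_prob" for G
  proof -
    note gb = gain_bounds[OF F G]
    have [measurable]: "gain F G \<in> borel_measurable borel" by (intro measurable_gain F G)
    show int: "integrable S (gain F G)"
      using gb by (intro S.integrable_const_bound[of _ "1 + B"]) auto
    have "\<bar>LINT \<theta>|S. gain F G \<theta> - 1\<bar> \<le> (LINT \<theta>|S. \<bar>gain F G \<theta> - 1\<bar>)"
      by (rule integral_abs_bound)
    also have "\<dots> \<le> (LINT \<theta>|S. 1 + B)"
    proof (rule integral_mono)
      show "\<bar>gain F G \<theta> - 1\<bar> \<le> 1 + B" for \<theta>
        using gb(2,3)[of \<theta>] one_le_B by arith
    qed (use int in auto)
    also have "\<dots> \<le> 1 * (1 + B)"
      using mS one_le_B by (simp add: mult_right_mono)
    finally show "\<bar>LINT \<theta>|S. gain F G \<theta> - 1\<bar> \<le> 1 + B" by simp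
  qed
  have int_b: "integrable (sample_law n) (\<lambda>x. LINT \<theta>|S. gain F (est_measure x n) \<theta> - 1)" for n
  proof (rule Q.integrable_const_bound[where B = "1 + B"])
    show "AE x in sample_law n. norm (LINT \<theta>|S. gain F (est_measure x n) \<theta> - 1) \<le> 1 + B"
      unfolding real_norm_def
      using AE_good by eventually_elim (rule gain_S(2)[OF est_measure_in_borel_prob])
    show "(\<lambda>x. LINT \<theta>|S. gain F (est_measure x n) \<theta> - 1) \<in> borel_measurable (sample_law n)"
      unfolding gain_def by measurable
  qed
  have "risk n \<le> b n + B * (1 - (LINT \<theta>|G0. s \<theta>))" for n
  proof -
    have "risk n \<le> (LINT x|sample_law n. (LINT \<theta>|S. gain F (est_measure x n) \<theta> - 1) + B * (1 - (LINT \<theta>|G0. s \<theta>)))"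
      unfolding risk_def
    proof (rule integral_mono_AE[OF integrable_KL_est_measure])
      show "AE x in sample_law n. KL F (est_measure x n)
          \<le> (LINT \<theta>|S. gain F (est_measure x n) \<theta> - 1) + B * (1 - (LINT \<theta>|G0. s \<theta>))"
        using AE_good
      proof eventually_elim
        case (elim x)
        note G = est_measure_in_borel_prob[OF elim]
        have "(LINT \<theta>|S. gain F (est_measure x n) \<theta> - 1)
          = (LINT \<theta>|G0. s \<theta> * (gain F (est_measure x n) \<theta> - 1))"
          using measurable_gain[OF F G] by (intro int_S) simp
        then show ?case
          using KL_le_truncated_gain[OF F G G0 measurable_r s s0 sr F_density] by simp
      qed
    qed (use int_b in simp)
    also have "\<dots> = b n + B * (1 - (LINT \<theta>|G0. s \<theta>))"
      using int_b Q.prob_space[of n] by (simp add: b_def)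
    finally show ?thesis .
  qed
  moreover have "L n + w (Suc n) * b n - (w (Suc n))\<^sup>2 / (1 - w (Suc n)) * (1 + B) \<le> L (Suc n)" for n
  proof -
    have w: "0 < w (Suc n)" "w (Suc n) < 1" using weights[of "Suc n"] by auto
    define a where "a = (w (Suc n))\<^sup>2 / (1 - w (Suc n)) * (1 + B)"
    have "L n + w (Suc n) * b n - a
      = (LINT x|sample_law n. \<Phi> n x + w (Suc n) * (LINT \<theta>|S. gain F (est_measure x n) \<theta> - 1) - a)"
      unfolding L_def b_def using int\<Phi> int_b Q.prob_space[of n] by simp
    also have "\<dots> \<le> (LINT x|sample_law n. LINT y|law F. \<Phi> (Suc n) (x(Suc n := y)))"
    proof (rule integral_mono_AE[OF _ integrable_sample_law_Suc[OF int\<Phi>]])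
      show "AE x in sample_law n. \<Phi> n x + w (Suc n) * (LINT \<theta>|S. gain F (est_measure x n) \<theta> - 1) - a
          \<le> (LINT y|law F. \<Phi> (Suc n) (x(Suc n := y)))"
        using AE_good
      proof eventually_elim
        case (elim x)
        note G = est_measure_in_borel_prob[OF elim]
        define h where "h y = (LINT \<theta>|S. ln (1 - w (Suc n) + w (Suc n) * (p y \<theta> / mixture p (est_measure x n) y)))" for y
        have step: "\<Phi> (Suc n) (x(Suc n := y)) = \<Phi> n x + h y" for y
        proof -
          define m where "m = mixture p (est_measure x n) y"
          have m: "0 \<le> m" by (simp add: m_def)
          have m': "mixture p (est_measure (x(Suc n := y)) n) y = m"
            by (simp add: m_def est_measure_def est_update)
          have pos: "0 < 1 - w (Suc n) + w (Suc n) * (p y \<theta> / m)" for \<theta>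
            using w m by (intro add_pos_nonneg) auto
          obtain c where c: "0 \<le> c" "\<And>\<theta>. p y \<theta> \<le> c" using ex_p_bound by blast
          have "integrable S (\<lambda>\<theta>. ln (1 - w (Suc n) + w (Suc n) * (p y \<theta> / m)))"
          proof (rule S.integrable_const_bound[of _ "\<bar>ln (1 - w (Suc n))\<bar> + \<bar>ln (1 + c / m)\<bar>"], rule AE_I2)
            fix \<theta>
            have "w (Suc n) * (p y \<theta> / m) \<le> 1 * (c / m)"
              using w m c by (intro mult_mono divide_right_mono) auto
            then have "ln (1 - w (Suc n) + w (Suc n) * (p y \<theta> / m)) \<le> ln (1 + c / m)"
              using pos[of \<theta>] w by (intro ln_mono) auto
            moreover have "ln (1 - w (Suc n)) \<le> ln (1 - w (Suc n) + w (Suc n) * (p y \<theta> / m))"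
              using w m by (intro ln_mono) auto
            ultimately show "norm (ln (1 - w (Suc n) + w (Suc n) * (p y \<theta> / m)))
                \<le> \<bar>ln (1 - w (Suc n))\<bar> + \<bar>ln (1 + c / m)\<bar>"
              unfolding real_norm_def by arith
          qed measurable
          moreover have "ln (est (x(Suc n := y)) (Suc n) \<theta>)
            = ln (est x n \<theta>) + ln (1 - w (Suc n) + w (Suc n) * (p y \<theta> / m))" for \<theta>
            unfolding est_Suc' using est_pos[of x n \<theta>] pos[of \<theta>] by (simp add: est_update m' ln_mult)
          ultimately show ?thesis
            using int_ln[of x n] by (simp add: \<Phi>_def h_def m_def[symmetric])
        qed
        have "integrable (law F) h" "w (Suc n) * (LINT \<theta>|S. gain F (est_measure x n) \<theta> - 1) - a \<le> (LINT y|law F. h y)"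
          unfolding h_def a_def using w
          by (intro integrable_ln_bayes_step integral_ln_bayes_step_ge F G S.finite_measure_axioms setsS mS; simp)+
        then show ?case
          using D.prob_space by (simp add: step)
      qed
    qed (use int\<Phi> int_b in simp)
    also have "\<dots> = L (Suc n)"
      unfolding L_def by (rule integral_sample_law_Suc[OF int\<Phi>])
    finally show ?thesis by (simp add: a_def)
  qed
  ultimately show ?thesis
    using \<open>\<And>n. L n \<le> M\<close> by blast
qed

text \<open>The truncation levels \<open>min (r \<theta>) k\<close> exhaust the mass of \<open>F\<close> as \<open>k\<close> grows.\<close>

lemma risk_tendsto_0:
  assumes sumw: "filterlim (\<lambda>n. \<Sum>i=1..n. w i) at_top sequentially"
    and sumw2: "summable (\<lambda>i. (w (Suc i))\<^sup>2)"
  shows "risk \<longlonglongrightarrow> 0"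
proof (rule almost_decreasing_tendsto_0[where w = w and a = "\<lambda>n. (w n)\<^sup>2 / (1 - w n) * (1 + B)"])
  show "summable (\<lambda>n. (w (Suc n))\<^sup>2 / (1 - w (Suc n)) * (1 + B))"
  proof (rule summable_mult2, rule summable_comparison_test_ev)
    have "(\<lambda>n. (w (Suc n))\<^sup>2) \<longlonglongrightarrow> 0" by (rule summable_LIMSEQ_zero[OF sumw2])
    then have "\<forall>\<^sub>F n in sequentially. (w (Suc n))\<^sup>2 < 1 / 4"
      by (rule order_tendstoD) simp
    then show "\<forall>\<^sub>F n in sequentially. norm ((w (Suc n))\<^sup>2 / (1 - w (Suc n))) \<le> 2 * (w (Suc n))\<^sup>2"
    proof eventually_elim
      case (elim n)
      have w: "0 < w (Suc n)" "w (Suc n) < 1" using weights[of "Suc n"] by auto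
      \<comment> \<open>Weights close to 1 spoil the factor \<open>1 / (1 - w)\<close> only finitely often.\<close>
      have "w (Suc n) < 1 / 2"
        using elim by (intro power_less_imp_less_base[of "w (Suc n)" 2 "1/2"]) (auto simp: power2_eq_square)
      then have "(w (Suc n))\<^sup>2 / (1 - w (Suc n)) \<le> (w (Suc n))\<^sup>2 / (1 / 2)"
        using w by (intro divide_left_mono) auto
      then show ?case using w by simp
    qed
  qed (use sumw2 in simp)
  show "0 \<le> (w (Suc n))\<^sup>2 / (1 - w (Suc n)) * (1 + B)" for n
    using weights[of "Suc n"] one_le_B by (intro mult_nonneg_nonneg divide_nonneg_pos) auto
  fix \<epsilon> :: real assume "\<epsilon> > 0"
  have r: "integrable G0 r" "(LINT \<theta>|G0. r \<theta>) = 1"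
    using nn_integral_r r_nonneg by (auto intro!: integrableI_nonneg simp: integral_eq_nn_integral)
  have "(\<lambda>k. LINT \<theta>|G0. min (r \<theta>) (real k)) \<longlonglongrightarrow> (LINT \<theta>|G0. r \<theta>)"
  proof (rule integral_dominated_convergence[where w = r])
    show "AE \<theta> in G0. (\<lambda>k. min (r \<theta>) (real k)) \<longlonglongrightarrow> r \<theta>"
    proof (rule AE_I2)
      fix \<theta>
      obtain N where "r \<theta> \<le> real N" using real_arch_simple by blast
      then have "\<forall>\<^sub>F k in sequentially. min (r \<theta>) (real k) = r \<theta>"
        unfolding eventually_sequentially by (intro exI[of _ N]) auto
      then show "(\<lambda>k. min (r \<theta>) (real k)) \<longlonglongrightarrow> r \<theta>"
        by (rule tendsto_eventually)
    qed
    show "AE \<theta> in G0. norm (min (r \<theta>) (real k)) \<le> r \<theta>" for k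
      using r_nonneg by (auto simp: abs_of_nonneg)
  qed (use r in auto)
  then have "(\<lambda>k. B * (1 - (LINT \<theta>|G0. min (r \<theta>) (real k)))) \<longlonglongrightarrow> B * (1 - 1)"
    unfolding r by (intro tendsto_intros)
  then have "\<forall>\<^sub>F k in sequentially. B * (1 - (LINT \<theta>|G0. min (r \<theta>) (real k))) < \<epsilon>"
    using \<open>\<epsilon> > 0\<close> by (intro order_tendstoD) auto
  then obtain k where k: "B * (1 - (LINT \<theta>|G0. min (r \<theta>) (real k))) < \<epsilon>"
    unfolding eventually_sequentially by blast
  obtain b L where b: "\<And>n. risk n \<le> b n + B * (1 - (LINT \<theta>|G0. min (r \<theta>) (real k)))"
    and L: "\<forall>n. L n + w (Suc n) * b n - (w (Suc n))\<^sup>2 / (1 - w (Suc n)) * (1 + B) \<le> L (Suc n)"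
      "\<forall>n. L n \<le> real k"
    using ex_truncated_drift[of "\<lambda>\<theta>. min (r \<theta>) (real k)" "real k"] r_nonneg by auto
  have "\<forall>n. risk n \<le> b n + \<epsilon>"
    using b k by (meson add_left_mono less_imp_le order_trans)
  with L show "\<exists>b L C. (\<forall>n. risk n \<le> b n + \<epsilon>) \<and>
      (\<forall>n. L n + w (Suc n) * b n - (w (Suc n))\<^sup>2 / (1 - w (Suc n)) * (1 + B) \<le> L (Suc n)) \<and> (\<forall>n. L n \<le> C)"
    by blast
qed (use risk_nonneg risk_Suc_le sumw weights in auto)

definition l1_error :: "nat \<Rightarrow> (nat \<Rightarrow> 'x) \<Rightarrow> real" where
  "l1_error n x = (LINT y|\<nu>. \<bar>mixture p F y - mixture p (est_measure x n) y\<bar>)"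

lemma l1_error_nonneg: "0 \<le> l1_error n x"
  by (simp add: l1_error_def)

lemma measurable_l1_error [measurable]: "l1_error n \<in> borel_measurable (sample_law n)"
  unfolding l1_error_def[abs_def] by measurable

lemma integrable_l1_error: "integrable (sample_law n) (l1_error n)"
proof -
  interpret Q: prob_space "sample_law n" by (rule prob_space_sample_law)
  show ?thesis
  proof (rule Q.integrable_const_bound[of _ "2 * (1 + B)"])
    show "AE x in sample_law n. norm (l1_error n x) \<le> 2 * (1 + B)"
      using AE_good
    proof eventually_elim
      case (elim x)
      note G = est_measure_in_borel_prob[OF elim]
      show ?case
        using L1_le_KL[OF F G, of 1] KL_le_B[OF F G] l1_error_nonneg[of n x] by (simp add: l1_error_def)
    qed
  qed measurable
qed

lemma expected_l1_error_tendsto_0: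
  assumes "filterlim (\<lambda>n. \<Sum>i=1..n. w i) at_top sequentially" "summable (\<lambda>i. (w (Suc i))\<^sup>2)"
  shows "(\<lambda>n. LINT x|sample_law n. l1_error n x) \<longlonglongrightarrow> 0"
proof (rule LIMSEQ_I)
  interpret Q: prob_space "sample_law n" for n by (rule prob_space_sample_law)
  fix \<epsilon> :: real assume "\<epsilon> > 0"
  define \<delta> where "\<delta> = \<epsilon> / 8"
  have "\<delta> > 0" using \<open>\<epsilon> > 0\<close> by (simp add: \<delta>_def)
  have "\<forall>\<^sub>F n in sequentially. risk n < \<delta>\<^sup>2"
    using risk_tendsto_0[OF assms] \<open>\<delta> > 0\<close> by (intro order_tendstoD) auto
  then obtain N where N: "\<And>n. n \<ge> N \<Longrightarrow> risk n < \<delta>\<^sup>2"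
    unfolding eventually_sequentially by blast
  have "norm ((LINT x|sample_law n. l1_error n x) - 0) < \<epsilon>" if "n \<ge> N" for n
  proof -
    have "(LINT x|sample_law n. l1_error n x) \<le> (LINT x|sample_law n. 2 * (\<delta> + KL F (est_measure x n) / \<delta>))"
    proof (rule integral_mono_AE[OF integrable_l1_error])
      show "AE x in sample_law n. l1_error n x \<le> 2 * (\<delta> + KL F (est_measure x n) / \<delta>)"
        using AE_good unfolding l1_error_def
        by eventually_elim (intro L1_le_KL F est_measure_in_borel_prob \<open>\<delta> > 0\<close>)
    qed (simp add: integrable_KL_est_measure)
    also have "\<dots> = 2 * (\<delta> + risk n / \<delta>)"
      using Q.prob_space[of n] by (simp add: risk_def integrable_KL_est_measure)
    also have "risk n / \<delta> < \<delta>"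
      using N[OF that] \<open>\<delta> > 0\<close> by (simp add: divide_less_eq power2_eq_square)
    finally have "(LINT x|sample_law n. l1_error n x) < \<epsilon>"
      using \<open>\<epsilon> > 0\<close> by (simp add: \<delta>_def)
    moreover have "0 \<le> (LINT x|sample_law n. l1_error n x)"
      by (simp add: l1_error_nonneg)
    ultimately show ?thesis by simp
  qed
  then show "\<exists>no. \<forall>n\<ge>no. norm ((LINT x|sample_law n. l1_error n x) - 0) < \<epsilon>"
    by blast
qed

end

section \<open>Weak neighbourhoods and the distance of mixtures\<close>

text \<open>A sequence of mixing distributions outside a weak neighbourhood of \<open>F\<close>, whose mixtures tend to that of
\<open>F\<close> in \<open>L\<^sup>1\<close>, cannot exist. It is tight: most of the law with mixing distribution \<open>F\<close> sits on
a compact set of observations, so the same holds eventually along the sequence, and by (A4) parameters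
far away hardly produce such observations. Along a weakly convergent subsequence the mixtures converge
pointwise by (A3), so by Fatou's lemma the limit has the mixture of \<open>F\<close>, and by (A2) it is \<open>F\<close>.\<close>

lemma weak_neighbourhood_contains_l1_ball:
  fixes \<nu> :: "'x::polish_space measure"
    and p :: "'x \<Rightarrow> 't::{metric_space, second_countable_topology} \<Rightarrow> real"
  assumes model: "mixture_model \<nu> p" and sets_nu: "sets \<nu> = sets borel"
    and ident: "inj_on (\<lambda>F. density \<nu> (\<lambda>x. ennreal (mixture p F x))) borel_prob"
    and escape: "\<And>\<epsilon> X0. \<epsilon> > 0 \<Longrightarrow> compact X0 \<Longrightarrow>
       \<exists>\<Theta>0. compact \<Theta>0 \<and> (\<forall>\<theta>. \<theta> \<notin> \<Theta>0 \<longrightarrow> (LINT x:X0|\<nu>. p x \<theta>) < \<epsilon>)"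
    and F: "F \<in> borel_prob" and U: "openin weak_topology U" "F \<in> U"
  obtains \<epsilon> where "\<epsilon> > 0"
    "\<And>G. G \<in> borel_prob \<Longrightarrow> (LINT x|\<nu>. \<bar>mixture p F x - mixture p G x\<bar>) < \<epsilon> \<Longrightarrow> G \<in> U"
proof -
  interpret mixture_model \<nu> p by (rule model)
  define l1_dist where "l1_dist F G = (LINT x|\<nu>. \<bar>mixture p F x - mixture p G x\<bar>)" for F G
  note [measurable_cong] = sets_nu
  have "\<exists>\<epsilon>>0. \<forall>G\<in>borel_prob. l1_dist F G < \<epsilon> \<longrightarrow> G \<in> U"
  proof (rule ccontr)
    assume contr: "\<not> ?thesis"
    have "\<exists>G. G \<in> borel_prob \<and> l1_dist F G < 1 / real (Suc k) \<and> G \<notin> U" for k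
      using contr by (metis divide_pos_pos of_nat_0_less_iff zero_less_Suc zero_less_one)
    then obtain G where G: "\<And>k. G k \<in> borel_prob" and close: "\<And>k. l1_dist F (G k) < 1 / real (Suc k)"
      and out: "\<And>k. G k \<notin> U"
      by metis
    note [measurable] = F G
    have tight: "\<exists>K. compact K \<and> (\<forall>\<^sub>F n in sequentially. 1 - \<eta> \<le> measure (G n) K)" if "\<eta> > 0" for \<eta>
    proof -
      interpret D: prob_space "law F" by (rule prob_space_law[OF F])
      have "emeasure (law F) UNIV = (SUP K \<in> {K. K \<subseteq> UNIV \<and> compact K}. emeasure (law F) K)"
        by (rule inner_regular) (auto simp: sets_nu)
      moreover have "emeasure (law F) UNIV = 1"
        using D.emeasure_space_1 sets_eq_imp_space_eq[OF sets_nu] by simp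
      moreover have "ennreal (1 - \<eta> / 3) < 1"
        using \<open>\<eta> > 0\<close> by (simp add: ennreal_less_one_iff)
      ultimately have "ennreal (1 - \<eta> / 3) < (SUP K \<in> {K. K \<subseteq> UNIV \<and> compact K}. emeasure (law F) K)"
        by (simp only:)
      then obtain X0 where X0: "compact X0" "ennreal (1 - \<eta> / 3) < emeasure (law F) X0"
        unfolding less_SUP_iff by blast
      then have massF: "1 - \<eta> / 3 < measure (law F) X0"
        unfolding D.emeasure_eq_measure by (metis ennreal_leI not_le)
      have [measurable]: "X0 \<in> sets borel" using compact_imp_closed[OF X0(1)] by simp
      obtain K where K: "compact K" "\<And>\<theta>. \<theta> \<notin> K \<Longrightarrow> (LINT x:X0|\<nu>. p x \<theta>) < \<eta> / 3"
        using escape[of "\<eta> / 3" X0] X0 \<open>\<eta> > 0\<close> by auto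
      have [measurable]: "K \<in> sets borel" using compact_imp_closed[OF K(1)] by simp
      have mass: "measure (law F) X0 - 1 / real (Suc k) - \<eta> / 3 \<le> measure (G k) K" for k
      proof -
        interpret GK: prob_space "G k" by (rule borel_probD[OF G])
        interpret DG: prob_space "law (G k)" by (rule prob_space_law[OF G])
        note [measurable_cong] = borel_probD(2)[OF G[of k]]
        have intp: "integrable \<nu> (\<lambda>x. p x \<theta>)" for \<theta>
          using integrable_mix[OF return_in_borel_prob[of \<theta>]] unfolding mix_return[abs_def] .
        have esc: "(\<integral>\<^sup>+x. indicator X0 x * ennreal (p x \<theta>) \<partial>\<nu>) \<le> indicator K \<theta> + ennreal (\<eta> / 3)" for \<theta>
        proof (cases "\<theta> \<in> K")
          case True
          have "(\<integral>\<^sup>+x. indicator X0 x * ennreal (p x \<theta>) \<partial>\<nu>) \<le> (\<integral>\<^sup>+x. ennreal (p x \<theta>) \<partial>\<nu>)"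
            by (intro nn_integral_mono) (simp add: indicator_def)
          then show ?thesis using True by (simp add: nn_integral_p add_increasing2)
        next
          case False
          have "(\<integral>\<^sup>+x. indicator X0 x * ennreal (p x \<theta>) \<partial>\<nu>) = (\<integral>\<^sup>+x. ennreal (indicator X0 x * p x \<theta>) \<partial>\<nu>)"
            by (intro nn_integral_cong) (simp add: indicator_def)
          also have "\<dots> = ennreal (LINT x:X0|\<nu>. p x \<theta>)"
            unfolding set_lebesgue_integral_def real_scaleR_def
            using integrable_mult_indicator[of X0 \<nu>, OF _ intp] by (intro nn_integral_eq_integral) (auto simp: sets_nu)
          also have "\<dots> \<le> ennreal (\<eta> / 3)"
            using K(2)[OF False] by (intro ennreal_leI) simp
          finally show ?thesis by (simp add: add_increasing)
        qed
        have "emeasure (law (G k)) X0 = (\<integral>\<^sup>+x. indicator X0 x * ennreal (mixture p (G k) x) \<partial>\<nu>)"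
          unfolding law_def by (subst emeasure_density) (auto simp: sets_nu mult.commute)
        also have "\<dots> = (\<integral>\<^sup>+\<theta>. (\<integral>\<^sup>+x. indicator X0 x * ennreal (p x \<theta>) \<partial>\<nu>) \<partial>G k)"
          by (rule nn_integral_mix_mult[OF G]) measurable
        also have "\<dots> \<le> (\<integral>\<^sup>+\<theta>. indicator K \<theta> + ennreal (\<eta> / 3) \<partial>G k)"
          by (intro nn_integral_mono esc)
        also have "\<dots> = emeasure (G k) K + ennreal (\<eta> / 3)"
          by (simp add: nn_integral_add GK.emeasure_space_1)
        finally have "measure (law (G k)) X0 \<le> measure (G k) K + \<eta> / 3"
          using \<open>\<eta> > 0\<close> unfolding DG.emeasure_eq_measure GK.emeasure_eq_measure
          by (subst (asm) ennreal_plus[symmetric]) (auto simp del: ennreal_plus)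
        moreover have "measure (law F) X0 - measure (law (G k)) X0 \<le> l1_dist F (G k)"
        proof -
          have law_measure: "measure (law H) X0 = (LINT x|\<nu>. mixture p H x * indicator X0 x)" if H: "H \<in> borel_prob" for H
            using integral_law[OF H, of "indicator X0"] sets_eq_imp_space_eq[OF sets_nu] by simp
          have int: "integrable \<nu> (\<lambda>x. mixture p H x * indicator X0 x)" if H: "H \<in> borel_prob" for H
            by (intro integrable_real_mult_indicator integrable_mix H) (simp add: sets_nu)
          have "measure (law F) X0 - measure (law (G k)) X0
            = (LINT x|\<nu>. mixture p F x * indicator X0 x - mixture p (G k) x * indicator X0 x)"
            using int F G by (simp add: law_measure)
          also have "\<dots> \<le> (LINT x|\<nu>. \<bar>mixture p F x - mixture p (G k) x\<bar>)"
          proof (rule integral_mono)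
            show "mixture p F x * indicator X0 x - mixture p (G k) x * indicator X0 x
                \<le> \<bar>mixture p F x - mixture p (G k) x\<bar>" for x
              using abs_ge_self[of "mixture p F x - mixture p (G k) x"] by (simp add: indicator_def)
          qed (use int F G integrable_mix in auto)
          finally show ?thesis by (simp add: l1_dist_def)
        qed
        ultimately show ?thesis using close[of k] by simp
      qed
      have "(\<lambda>k. 1 / real (Suc k)) \<longlonglongrightarrow> 0"
        using LIMSEQ_inverse_real_of_nat by (simp add: inverse_eq_divide)
      then have "\<forall>\<^sub>F k in sequentially. 1 / real (Suc k) < \<eta> / 3"
        using \<open>\<eta> > 0\<close> by (intro order_tendstoD) auto
      then have "\<forall>\<^sub>F k in sequentially. 1 - \<eta> \<le> measure (G k) K"
      proof eventually_elim
        case (elim k)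
        then show ?case using mass[of k] massF by linarith
      qed
      with K show ?thesis by blast
    qed
    obtain s N where s: "strict_mono (s :: nat \<Rightarrow> nat)" and N: "N \<in> borel_prob"
      and conv: "\<And>g :: 't \<Rightarrow> real. continuous_on UNIV g \<Longrightarrow> bounded (range g) \<Longrightarrow>
         (\<lambda>n. LINT \<theta>|G (s n). g \<theta>) \<longlonglongrightarrow> (LINT \<theta>|N. g \<theta>)"
      using prokhorov_subsequence[of G] G tight by metis
    note [measurable] = N
    have "(\<integral>\<^sup>+x. ennreal \<bar>mixture p F x - mixture p N x\<bar> \<partial>\<nu>)
      = (\<integral>\<^sup>+x. liminf (\<lambda>n. ennreal \<bar>mixture p F x - mixture p (G (s n)) x\<bar>) \<partial>\<nu>)"
    proof (rule nn_integral_cong)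
      fix x
      have "(\<lambda>n. mixture p (G (s n)) x) \<longlonglongrightarrow> mixture p N x"
        unfolding mixture_def using cont[of x] by (intro conv) auto
      then have "(\<lambda>n. ennreal \<bar>mixture p F x - mixture p (G (s n)) x\<bar>) \<longlonglongrightarrow> ennreal \<bar>mixture p F x - mixture p N x\<bar>"
        by (intro tendsto_intros)
      then show "ennreal \<bar>mixture p F x - mixture p N x\<bar>
          = liminf (\<lambda>n. ennreal \<bar>mixture p F x - mixture p (G (s n)) x\<bar>)"
        by (intro lim_imp_Liminf[symmetric]) auto
    qed
    also have "\<dots> \<le> liminf (\<lambda>n. \<integral>\<^sup>+x. ennreal \<bar>mixture p F x - mixture p (G (s n)) x\<bar> \<partial>\<nu>)"
      by (rule nn_integral_liminf) measurable
    also have "\<dots> = 0"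
    proof (rule lim_imp_Liminf)
      have eq: "(\<integral>\<^sup>+x. ennreal \<bar>mixture p F x - mixture p (G (s n)) x\<bar> \<partial>\<nu>) = ennreal (l1_dist F (G (s n)))" for n
        unfolding l1_dist_def using F G integrable_mix by (intro nn_integral_eq_integral) auto
      have "(\<lambda>k. l1_dist F (G k)) \<longlonglongrightarrow> 0"
      proof (rule tendsto_sandwich[of "\<lambda>_. 0" _ _ "\<lambda>k. 1 / real (Suc k)"])
        show "(\<lambda>k. 1 / real (Suc k)) \<longlonglongrightarrow> 0"
          using LIMSEQ_inverse_real_of_nat by (simp add: inverse_eq_divide)
        show "\<forall>\<^sub>F k in sequentially. l1_dist F (G k) \<le> 1 / real (Suc k)"
          using close by (intro always_eventually) (auto intro: less_imp_le)
      qed (auto simp: l1_dist_def)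
      from LIMSEQ_subseq_LIMSEQ[OF this s]
      show "(\<lambda>n. \<integral>\<^sup>+x. ennreal \<bar>mixture p F x - mixture p (G (s n)) x\<bar> \<partial>\<nu>) \<longlonglongrightarrow> 0"
        unfolding eq using tendsto_ennrealI[of "\<lambda>n. l1_dist F (G (s n))" 0] by (simp add: o_def)
    qed simp
    finally have "(\<integral>\<^sup>+x. ennreal \<bar>mixture p F x - mixture p N x\<bar> \<partial>\<nu>) = 0"
      by simp
    then have "AE x in \<nu>. mixture p N x = mixture p F x"
      by (subst (asm) nn_integral_0_iff_AE) auto
    then have "density \<nu> (\<lambda>x. ennreal (mixture p N x)) = density \<nu> (\<lambda>x. ennreal (mixture p F x))"
      by (intro density_cong) auto
    then have "N = F"
      using inj_onD[OF ident _ N F] by simp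
    then have "limitin weak_topology (\<lambda>n. G (s n)) F sequentially"
      using limitin_weak_topology[of "\<lambda>n. G (s n)" F] G F conv by blast
    then have "\<forall>\<^sub>F n in sequentially. G (s n) \<in> U"
      using U by (auto simp: limitin_def)
    then obtain n where "G (s n) \<in> U"
      unfolding eventually_sequentially by blast
    with out show False by blast
  qed
  then show ?thesis
    using that unfolding l1_dist_def by blast
qed

section \<open>The permutation-averaged estimate\<close>

context recursive_mixture
begin

text \<open>Averaging over arrangements \<open>x s\<close> of the data is harmless, because mixtures depend linearly on
the mixing distribution and the \<open>L\<^sup>1\<close> distance is convex.\<close>

lemma
  fixes x :: "'i \<Rightarrow> nat \<Rightarrow> 'x"
  assumes S: "finite S" "S \<noteq> {}" and good: "\<And>s. s \<in> S \<Longrightarrow> good (x s) n"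
  defines "A \<equiv> density G0 (\<lambda>\<theta>. ennreal (1 / real (card S) * (\<Sum>s\<in>S. est (x s) n \<theta>)))"
  shows average_in_borel_prob: "A \<in> borel_prob"
    and average_l1_error_le:
      "(LINT y|\<nu>. \<bar>mixture p F y - mixture p A y\<bar>) \<le> 1 / real (card S) * (\<Sum>s\<in>S. l1_error n (x s))"
proof -
  have card: "0 < real (card S)" using S by (simp add: card_gt_0_iff)
  have in_prob: "est_measure (x s) n \<in> borel_prob" if "s \<in> S" for s
    by (intro est_measure_in_borel_prob good that)
  have one: "(\<integral>\<^sup>+\<theta>. ennreal (est (x s) n \<theta>) \<partial>G0) = 1" if "s \<in> S" for s
    by (intro nn_integral_est good that)
  have "(\<integral>\<^sup>+\<theta>. ennreal (1 / real (card S) * (\<Sum>s\<in>S. est (x s) n \<theta>)) \<partial>G0)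
    = (\<integral>\<^sup>+\<theta>. ennreal (1 / real (card S)) * (\<Sum>s\<in>S. ennreal (est (x s) n \<theta>)) \<partial>G0)"
    by (intro nn_integral_cong, subst ennreal_mult) (auto simp: sum_nonneg)
  also have "\<dots> = ennreal (1 / real (card S)) * (\<Sum>s\<in>S. 1)"
    by (simp add: nn_integral_cmult nn_integral_sum one del: sum_ennreal)
  also have "\<dots> = 1"
    using card by (simp add: ennreal_of_nat_eq_real_of_nat ennreal_mult[symmetric])
  finally show A: "A \<in> borel_prob"
    unfolding A_def by (intro density_in_borel_prob G0) auto
  have mixA: "mixture p A y = 1 / real (card S) * (\<Sum>s\<in>S. mixture p (est_measure (x s) n) y)" for y
  proof -
    obtain c where c: "0 \<le> c" "\<And>\<theta>. p y \<theta> \<le> c" using ex_p_bound by blast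
    have int: "integrable G0 (\<lambda>\<theta>. est (x s) n \<theta> * p y \<theta>)" for s
    proof -
      obtain b where b: "0 \<le> b" "\<And>\<theta>. est (x s) n \<theta> \<le> b" using ex_est_bound by blast
      show ?thesis
        by (rule G0.integrable_const_bound[of _ "b * c"]) (use b c in \<open>auto intro!: mult_mono\<close>)
    qed
    have "mixture p A y = (LINT \<theta>|G0. 1 / real (card S) * (\<Sum>s\<in>S. est (x s) n \<theta>) * p y \<theta>)"
      unfolding A_def by (intro mix_density G0) (auto intro!: sum_nonneg divide_nonneg_nonneg)
    also have "\<dots> = (LINT \<theta>|G0. 1 / real (card S) * (\<Sum>s\<in>S. est (x s) n \<theta> * p y \<theta>))"
      by (simp add: sum_distrib_right)
    also have "\<dots> = 1 / real (card S) * (\<Sum>s\<in>S. mixture p (est_measure (x s) n) y)"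
      using int by (simp add: mix_est_measure)
    finally show ?thesis .
  qed
  have intF: "integrable \<nu> (\<lambda>y. \<bar>mixture p F y - mixture p H y\<bar>)" if "H \<in> borel_prob" for H
    using F that integrable_mix by auto
  have "(LINT y|\<nu>. \<bar>mixture p F y - mixture p A y\<bar>)
    \<le> (LINT y|\<nu>. 1 / real (card S) * (\<Sum>s\<in>S. \<bar>mixture p F y - mixture p (est_measure (x s) n) y\<bar>))"
  proof (rule integral_mono[OF intF[OF A]])
    show "integrable \<nu> (\<lambda>y. 1 / real (card S) * (\<Sum>s\<in>S. \<bar>mixture p F y - mixture p (est_measure (x s) n) y\<bar>))"
      using intF in_prob by (intro integrable_mult_right Bochner_Integration.integrable_sum) auto
    fix y
    have "mixture p F y - mixture p A y
      = 1 / real (card S) * (\<Sum>s\<in>S. mixture p F y - mixture p (est_measure (x s) n) y)"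
      unfolding mixA using card by (simp add: sum_subtractf field_simps)
    then show "\<bar>mixture p F y - mixture p A y\<bar>
      \<le> 1 / real (card S) * (\<Sum>s\<in>S. \<bar>mixture p F y - mixture p (est_measure (x s) n) y\<bar>)"
      using card by (simp add: abs_mult divide_right_mono sum_abs)
  qed
  also have "\<dots> = 1 / real (card S) * (\<Sum>s\<in>S. l1_error n (x s))"
    using intF in_prob by (simp add: l1_error_def Bochner_Integration.integral_sum)
  finally show "(LINT y|\<nu>. \<bar>mixture p F y - mixture p A y\<bar>) \<le> 1 / real (card S) * (\<Sum>s\<in>S. l1_error n (x s))" .
qed

lemma l1_error_cong:
  assumes "\<And>i. i \<in> {1..n} \<Longrightarrow> x i = y i"
  shows "l1_error n x = l1_error n y"
  using est_cong[OF assms] by (simp add: l1_error_def est_measure_def)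

text \<open>Independent and identically distributed observations have the same joint law in every order.\<close>

lemma
  fixes P :: "'w measure" and X :: "nat \<Rightarrow> 'w \<Rightarrow> 'x"
  assumes P: "prob_space P" and indep: "prob_space.indep_vars P (\<lambda>_. \<nu>) X {1..}"
    and distr: "\<And>i. i \<ge> 1 \<Longrightarrow> distr P \<nu> (X i) = law F"
    and s: "s permutes {1..n}" and n: "n \<ge> 1"
  shows integrable_l1_error_permuted: "integrable P (\<lambda>\<omega>. l1_error n ((\<lambda>i. X i \<omega>) \<circ> s))"
    and integral_l1_error_permuted:
      "(LINT \<omega>|P. l1_error n ((\<lambda>i. X i \<omega>) \<circ> s)) = (LINT x|sample_law n. l1_error n x)"
proof -
  interpret P: prob_space P by (rule P)
  have rv: "X i \<in> P \<rightarrow>\<^sub>M \<nu>" if "i \<in> {1..n}" for i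
    using indep that by (auto simp: P.indep_vars_def)
  then have rvF: "X i \<in> P \<rightarrow>\<^sub>M law F" if "i \<in> {1..n}" for i
    using that unfolding measurable_cong_sets[OF refl sets_law] by blast
  have sI: "s i \<in> {1..n}" if "i \<in> {1..n}" for i
    using s that by (rule permutes_in_image[THEN iffD2])
  define T where "T \<omega> = (\<lambda>i\<in>{1..n}. X i \<omega>)" for \<omega>
  define R where "R x = (\<lambda>i\<in>{1..n}. x (s i))" for x :: "nat \<Rightarrow> 'x"
  have T: "T \<in> P \<rightarrow>\<^sub>M sample_law n"
    unfolding T_def[abs_def] sample_law_def using rvF by (intro measurable_restrict)
  have R: "R \<in> sample_law n \<rightarrow>\<^sub>M sample_law n"
    unfolding R_def[abs_def] sample_law_def
    using sI by (intro measurable_restrict measurable_component_singleton)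
  have "P.indep_vars (\<lambda>_. \<nu>) X {1..n}"
    using indep by (rule P.indep_vars_subset) auto
  then have "distr P (PiM {1..n} (\<lambda>_. \<nu>)) T = PiM {1..n} (\<lambda>i. distr P \<nu> (X i))"
    unfolding T_def[abs_def] using rv n by (subst (asm) P.indep_vars_iff_distr_eq_PiM') auto
  also have "\<dots> = sample_law n"
    unfolding sample_law_def using distr by (intro PiM_cong) auto
  also have "distr P (PiM {1..n} (\<lambda>_. \<nu>)) T = distr P (sample_law n) T"
    unfolding sample_law_def by (intro distr_cong sets_PiM_cong) auto
  finally have distrT: "distr P (sample_law n) T = sample_law n" .
  have distrR: "distr (sample_law n) (sample_law n) R = sample_law n"
    unfolding sample_law_def R_def[abs_def]
    using distr_PiM_reindex[of "{1..n}" "\<lambda>_. law F" s "{1..n}"] sI permutes_inj_on[OF s] D.prob_space_axioms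
    by auto
  have "distr P (sample_law n) (R \<circ> T) = sample_law n"
    using distr_distr[OF R T] by (simp add: distrT distrR)
  moreover have "l1_error n ((\<lambda>i. X i \<omega>) \<circ> s) = l1_error n ((R \<circ> T) \<omega>)" for \<omega>
    using sI by (intro l1_error_cong) (auto simp: R_def T_def)
  ultimately show "integrable P (\<lambda>\<omega>. l1_error n ((\<lambda>i. X i \<omega>) \<circ> s))"
      "(LINT \<omega>|P. l1_error n ((\<lambda>i. X i \<omega>) \<circ> s)) = (LINT x|sample_law n. l1_error n x)"
    using integrable_l1_error[of n] integrable_distr_eq[OF measurable_comp[OF T R] measurable_l1_error]
      integral_distr[OF measurable_comp[OF T R] measurable_l1_error]
    by simp_all
qed

end

text \<open>Passing from the dominating measure \<open>\<mu>\<close> to the initial distribution only divides all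
estimates by \<open>f0\<close>.\<close>

lemma rec_est_eq_density_times:
  fixes p :: "'x \<Rightarrow> 't \<Rightarrow> real"
  assumes [measurable]: "\<And>y. p y \<in> borel_measurable \<mu>" "f0 \<in> borel_measurable \<mu>"
    and f0: "\<And>\<theta>. 0 \<le> f0 \<theta>"
  shows "rec_est p (density \<mu> (\<lambda>\<theta>. ennreal (f0 \<theta>))) w (\<lambda>_. 1) x n \<in> borel_measurable \<mu> \<and>
    rec_est p \<mu> w f0 x n = (\<lambda>\<theta>. f0 \<theta> * rec_est p (density \<mu> (\<lambda>\<theta>. ennreal (f0 \<theta>))) w (\<lambda>_. 1) x n \<theta>)"
proof (induction n)
  case (Suc n)
  let ?\<rho> = "rec_est p (density \<mu> (\<lambda>\<theta>. ennreal (f0 \<theta>))) w (\<lambda>_. 1) x n"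
  have [measurable]: "?\<rho> \<in> borel_measurable \<mu>" using Suc by blast
  have "(LINT \<theta>|density \<mu> (\<lambda>\<theta>. ennreal (f0 \<theta>)). p (x (Suc n)) \<theta> * ?\<rho> \<theta>)
    = (LINT \<theta>|\<mu>. p (x (Suc n)) \<theta> * (f0 \<theta> * ?\<rho> \<theta>))"
    using f0 by (subst integral_density) (auto simp: algebra_simps)
  with Suc show ?case
    by (auto simp: fun_eq_iff algebra_simps)
qed simp

theorem theorem5:
  fixes \<nu> :: "'x::polish_space measure"
    and \<mu> :: "'t::{metric_space, second_countable_topology} measure"
    and p :: "'x \<Rightarrow> 't \<Rightarrow> real"
    and f f0 :: "'t \<Rightarrow> real"
    and w :: "nat \<Rightarrow> real"
    and P :: "'w measure"
    and X :: "nat \<Rightarrow> 'w \<Rightarrow> 'x"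
  assumes nu: "sigma_finite_measure \<nu>" "sets \<nu> = sets borel"
    and mu: "sigma_finite_measure \<mu>" "sets \<mu> = sets borel"
    and sampling_density: "\<And>\<theta>. is_density \<nu> (\<lambda>x. p x \<theta>)"
    and mixing_density: "is_density \<mu> f"
    and initial_density: "is_density \<mu> f0"
    and initial_support: "absolutely_continuous (density \<mu> f0) (density \<mu> f)"
    and weights: "\<And>i. i \<ge> 1 \<Longrightarrow> 0 < w i \<and> w i < 1"
    and P: "prob_space P"
    and indep: "prob_space.indep_vars P (\<lambda>_. \<nu>) X {1..}"
    and distr: "\<And>i. i \<ge> 1 \<Longrightarrow> distributed P \<nu> (X i) (\<lambda>x. ennreal (LINT \<theta>|\<mu>. p x \<theta> * f \<theta>))"
    and A1: "filterlim (\<lambda>n. \<Sum>i=1..n. w i) at_top sequentially"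
            "summable (\<lambda>i. (w (Suc i))\<^sup>2)"
    and A2: "inj_on (\<lambda>F. density \<nu> (\<lambda>x. ennreal (mixture p F x))) borel_prob"
    and A3: "\<And>x. bounded (range (p x)) \<and> continuous_on UNIV (p x)"
    and A4: "\<And>\<epsilon> X0. \<epsilon> > 0 \<Longrightarrow> compact X0 \<Longrightarrow>
               \<exists>\<Theta>0. compact \<Theta>0 \<and> (\<forall>\<theta>. \<theta> \<notin> \<Theta>0 \<longrightarrow> (LINT x:X0|\<nu>. p x \<theta>) < \<epsilon>)"
    and A5: "\<exists>B::real. \<forall>\<theta>1 \<theta>2 \<theta>3.
               (\<integral>\<^sup>+x. (ennreal (p x \<theta>1) / ennreal (p x \<theta>2))\<^sup>2 * ennreal (p x \<theta>3) \<partial>\<nu>) < ennreal B"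
  shows "tendsto_in_prob P weak_topology
           (\<lambda>n \<omega>. density \<mu> (\<lambda>\<theta>. ennreal (perm_avg_est p \<mu> w f0 (\<lambda>i. X i \<omega>) n \<theta>)))
           (density \<mu> (\<lambda>\<theta>. ennreal (f \<theta>)))"
proof -
  note [measurable_cong] = mu(2) and sets_nu = nu(2)
  have model: "mixture_model \<nu> p"
    using nu sampling_density A3 by (intro mixture_model.intro)
  obtain B :: real where B: "\<And>\<theta>1 \<theta>2 \<theta>3.
      (\<integral>\<^sup>+x. (ennreal (p x \<theta>1) / ennreal (p x \<theta>2))\<^sup>2 * ennreal (p x \<theta>3) \<partial>\<nu>) < ennreal B"
    using A5 by blast
  interpret bounded_ratio_model \<nu> p B
    using model B by (intro bounded_ratio_model.intro bounded_ratio_model_axioms.intro less_imp_le)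
  have f[measurable]: "f \<in> borel_measurable \<mu>" "f0 \<in> borel_measurable \<mu>"
    and f_nn: "\<And>\<theta>. 0 \<le> f \<theta>" "\<And>\<theta>. 0 \<le> f0 \<theta>"
    and f1: "(\<integral>\<^sup>+\<theta>. ennreal (f \<theta>) \<partial>\<mu>) = 1" "(\<integral>\<^sup>+\<theta>. ennreal (f0 \<theta>) \<partial>\<mu>) = 1"
    using mixing_density initial_density by (auto simp: is_density_def)
  define F where "F = density \<mu> (\<lambda>\<theta>. ennreal (f \<theta>))"
  define G0 where "G0 = density \<mu> (\<lambda>\<theta>. ennreal (f0 \<theta>))"
  \<comment> \<open>The value 0 of \<open>r\<close> where \<open>f0\<close> vanishes is right up to null sets, by absolute continuity.\<close>
  define r where "r \<theta> = f \<theta> / f0 \<theta>" for \<theta>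
  have borel_prob_density: "density \<mu> (\<lambda>\<theta>. ennreal (g \<theta>)) \<in> borel_prob"
    if "g \<in> borel_measurable \<mu>" "(\<integral>\<^sup>+\<theta>. ennreal (g \<theta>) \<partial>\<mu>) = 1" for g :: "'t \<Rightarrow> real"
    using that mu(2)
    by (auto simp: borel_prob_def intro!: prob_spaceI simp: emeasure_density cong: nn_integral_cong)
  have F: "F \<in> borel_prob" and G0: "G0 \<in> borel_prob"
    unfolding F_def G0_def using f f1 by (auto intro!: borel_prob_density)
  have F_density: "F = density G0 (\<lambda>\<theta>. ennreal (r \<theta>))"
  proof -
    have "{\<theta> \<in> space \<mu>. f0 \<theta> = 0} \<in> null_sets G0"
      unfolding G0_def using f_nn by (subst null_sets_density_iff) auto
    then have "{\<theta> \<in> space \<mu>. f0 \<theta> = 0} \<in> null_sets F"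
      using initial_support unfolding absolutely_continuous_def F_def G0_def by blast
    then have "AE \<theta> in \<mu>. \<theta> \<in> {\<theta> \<in> space \<mu>. f0 \<theta> = 0} \<longrightarrow> ennreal (f \<theta>) = 0"
      unfolding F_def by (subst (asm) null_sets_density_iff) auto
    then have "AE \<theta> in \<mu>. ennreal (f \<theta>) = ennreal (f0 \<theta>) * ennreal (r \<theta>)"
      using AE_space
    proof eventually_elim
      case (elim \<theta>)
      then show ?case
        using f_nn[of \<theta>] by (cases "f0 \<theta> = 0") (auto simp: r_def ennreal_mult[symmetric])
    qed
    then have "F = density \<mu> (\<lambda>\<theta>. ennreal (f0 \<theta>) * ennreal (r \<theta>))"
      unfolding F_def r_def by (intro density_cong) auto
    also have "\<dots> = density G0 (\<lambda>\<theta>. ennreal (r \<theta>))"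
      unfolding G0_def r_def by (intro density_density_eq[symmetric]) auto
    finally show ?thesis .
  qed
  have "r \<in> borel_measurable borel"
    unfolding r_def[abs_def] by measurable
  moreover have "\<And>\<theta>. 0 \<le> r \<theta>"
    using f_nn by (simp add: r_def)
  ultimately interpret recursive_mixture \<nu> p B F G0 r w
    using F G0 F_density weights
    by (intro recursive_mixture.intro recursive_mixture_axioms.intro bounded_ratio_model_axioms)
  interpret P: prob_space P by (rule P)
  have mixF: "mixture p F x = (LINT \<theta>|\<mu>. p x \<theta> * f \<theta>)" for x
    unfolding F_def mixture_def using f_nn by (subst integral_density) (auto simp: mult.commute)
  have rv: "X i \<in> P \<rightarrow>\<^sub>M \<nu>" and distrX: "distr P \<nu> (X i) = law F" if "i \<ge> 1" for i
    using distr[OF that] unfolding law_def mixF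
    by (auto simp: distributed_def)
  have AE_good_X: "AE \<omega> in P. \<forall>i\<in>{1..n}. 0 < mixture p F (X i \<omega>)" for n
  proof (intro AE_finite_allI)
    fix i assume i: "i \<in> {1..n}"
    have [measurable]: "X i \<in> P \<rightarrow>\<^sub>M \<nu>" using i rv by simp
    have "AE x in distr P \<nu> (X i). 0 < mixture p F x"
      using AE_mix_pos[OF F F] i by (subst distrX) auto
    then show "AE \<omega> in P. 0 < mixture p F (X i \<omega>)"
      by (subst (asm) AE_distr_iff) auto
  qed simp
  define E where "E n \<omega> = 1 / fact n * (\<Sum>s | s permutes {1..n}. l1_error n ((\<lambda>i. X i \<omega>) \<circ> s))" for n \<omega>
  have card_perm: "real (card {s. s permutes {1..n}}) = fact n" for n
    using card_permutations[of "{1..n}" n] by simp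
  have fin_perm: "finite {s. s permutes {1..n}}" "{s. s permutes {1..n}} \<noteq> {}" for n :: nat
    using finite_permutations[of "{1..n}"] permutes_id[of "{1..n}"] by blast+
  have density_G0: "density \<mu> (\<lambda>\<theta>. ennreal (f0 \<theta>) * ennreal (g \<theta>)) = density G0 (\<lambda>\<theta>. ennreal (g \<theta>))"
    if [measurable]: "g \<in> borel_measurable borel" for g :: "'t \<Rightarrow> real"
    unfolding G0_def by (intro density_density_eq[symmetric]) measurable
  have perm_avg: "density \<mu> (\<lambda>\<theta>. ennreal (perm_avg_est p \<mu> w f0 x n \<theta>))
    = density G0 (\<lambda>\<theta>. ennreal (1 / real (card {s. s permutes {1..n}}) * (\<Sum>s | s permutes {1..n}. est (x \<circ> s) n \<theta>)))"
    for x n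
  proof -
    have "rec_est p \<mu> w f0 y n = (\<lambda>\<theta>. f0 \<theta> * est y n \<theta>)" for y
      using rec_est_eq_density_times[of p \<mu> f0 w y n] f f_nn
      by (simp add: est_def G0_def[symmetric])
    then have "perm_avg_est p \<mu> w f0 x n
      = (\<lambda>\<theta>. f0 \<theta> * (1 / real (card {s. s permutes {1..n}}) * (\<Sum>s | s permutes {1..n}. est (x \<circ> s) n \<theta>)))"
      unfolding fun_eq_iff perm_avg_est_def card_perm by (simp add: sum_distrib_left algebra_simps)
    moreover have "0 \<le> 1 / real (card {s. s permutes {1..n}}) * (\<Sum>s | s permutes {1..n}. est (x \<circ> s) n \<theta>)" for \<theta>
      by (intro mult_nonneg_nonneg sum_nonneg) auto
    ultimately have "density \<mu> (\<lambda>\<theta>. ennreal (perm_avg_est p \<mu> w f0 x n \<theta>))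
      = density \<mu> (\<lambda>\<theta>. ennreal (f0 \<theta>) * ennreal (1 / real (card {s. s permutes {1..n}}) * (\<Sum>s | s permutes {1..n}. est (x \<circ> s) n \<theta>)))"
      by (simp only: ennreal_mult[OF f_nn(2)])
    also have "\<dots> = density G0 (\<lambda>\<theta>. ennreal (1 / real (card {s. s permutes {1..n}}) * (\<Sum>s | s permutes {1..n}. est (x \<circ> s) n \<theta>)))"
      by (rule density_G0) measurable
    finally show ?thesis .
  qed
  have E_int: "integrable P (E n)" "(LINT \<omega>|P. E n \<omega>) = (LINT x|sample_law n. l1_error n x)" if "n \<ge> 1" for n
  proof -
    note int = integrable_l1_error_permuted[OF P indep distrX _ that]
      and expect = integral_l1_error_permuted[OF P indep distrX _ that]
    show "integrable P (E n)"
      unfolding E_def[abs_def] by (intro integrable_mult_right Bochner_Integration.integrable_sum int) simp_all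
    have "(LINT \<omega>|P. E n \<omega>) = 1 / fact n * (\<Sum>s | s permutes {1..n}. LINT \<omega>|P. l1_error n ((\<lambda>i. X i \<omega>) \<circ> s))"
      unfolding E_def using int by (subst integral_mult_right_zero, subst Bochner_Integration.integral_sum) auto
    also have "\<dots> = 1 / fact n * (\<Sum>s | s permutes {1..n}. LINT x|sample_law n. l1_error n x)"
      by (intro arg_cong[where f = "\<lambda>t. 1 / fact n * t"] sum.cong refl expect) simp_all
    also have "\<dots> = (LINT x|sample_law n. l1_error n x)"
      unfolding sum_constant card_perm by simp
    finally show "(LINT \<omega>|P. E n \<omega>) = (LINT x|sample_law n. l1_error n x)" .
  qed
  show ?thesis
    unfolding tendsto_in_prob_def topspace_weak_topology F_def[symmetric]
  proof (intro conjI allI impI F)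
    fix U :: "'t measure set" assume U: "openin weak_topology U \<and> F \<in> U"
    obtain \<epsilon> where "\<epsilon> > 0" and \<epsilon>: "\<And>G. G \<in> borel_prob \<Longrightarrow>
        (LINT x|\<nu>. \<bar>mixture p F x - mixture p G x\<bar>) < \<epsilon> \<Longrightarrow> G \<in> U"
      using weak_neighbourhood_contains_l1_ball[OF model sets_nu A2 A4 F, of U] U by blast
    define bad where "bad n = {\<omega> \<in> space P. \<not> (\<forall>i\<in>{1..n}. 0 < mixture p F (X i \<omega>))}" for n
    \<comment> \<open>The value at 0 does not affect the limit. Outside \<open>bad n\<close> the averaged error \<open>E n\<close> bounds the distance to \<open>F\<close>.\<close>
    define A where "A n = (if n = 0 then space P else {\<omega> \<in> space P. \<epsilon> \<le> E n \<omega>} \<union> bad n)" for n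
    have bad_null: "bad n \<in> null_sets P" for n
    proof -
      have [measurable]: "X i \<in> P \<rightarrow>\<^sub>M \<nu>" if "i \<in> {1..n}" for i using rv that by simp
      have "bad n \<in> sets P" unfolding bad_def by measurable
      with AE_good_X[of n] show ?thesis
        unfolding bad_def by (subst (asm) AE_iff_null) auto
    qed
    have [measurable]: "bad n \<in> sets P" for n using bad_null by blast
    have E_meas: "{\<omega> \<in> space P. \<epsilon> \<le> E n \<omega>} \<in> sets P" if "n \<ge> 1" for n
    proof -
      have [measurable]: "E n \<in> borel_measurable P" using E_int(1)[OF that] by simp
      show ?thesis by measurable
    qed
    have "A n \<in> sets P" for n
      using E_meas[of n] by (auto simp: A_def)
    moreover have "{\<omega> \<in> space P. density \<mu> (\<lambda>\<theta>. ennreal (perm_avg_est p \<mu> w f0 (\<lambda>i. X i \<omega>) n \<theta>)) \<notin> U} \<subseteq> A n" for n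
    proof (rule subsetI, rule ccontr)
      fix \<omega> assume \<omega>: "\<omega> \<in> {\<omega> \<in> space P. density \<mu> (\<lambda>\<theta>. ennreal (perm_avg_est p \<mu> w f0 (\<lambda>i. X i \<omega>) n \<theta>)) \<notin> U}"
        and "\<omega> \<notin> A n"
      then have pos: "\<forall>i\<in>{1..n}. 0 < mixture p F (X i \<omega>)" and small: "E n \<omega> < \<epsilon>"
        by (auto simp: A_def bad_def split: if_splits)
      have good: "good ((\<lambda>i. X i \<omega>) \<circ> s) n" if "s \<in> {s. s permutes {1..n}}" for s
        unfolding good_def o_def using pos that permutes_in_image[of s "{1..n}"] by blast
      have "density \<mu> (\<lambda>\<theta>. ennreal (perm_avg_est p \<mu> w f0 (\<lambda>i. X i \<omega>) n \<theta>)) \<in> U"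
        unfolding perm_avg
      proof (rule \<epsilon>[OF average_in_borel_prob[OF fin_perm good] le_less_trans[OF average_l1_error_le[OF fin_perm good]]])
        show "1 / real (card {s. s permutes {1..n}}) * (\<Sum>s | s permutes {1..n}. l1_error n ((\<lambda>i. X i \<omega>) \<circ> s)) < \<epsilon>"
          using small unfolding E_def card_perm .
      qed
      with \<omega> show False by simp
    qed
    moreover have "(\<lambda>n. measure P (A n)) \<longlonglongrightarrow> 0"
    proof (rule tendsto_sandwich[of "\<lambda>_. 0" _ _ "\<lambda>n. (LINT x|sample_law n. l1_error n x) / \<epsilon>"])
      show "\<forall>\<^sub>F n in sequentially. measure P (A n) \<le> (LINT x|sample_law n. l1_error n x) / \<epsilon>"
        using eventually_ge_at_top[of 1]
      proof eventually_elim
        case (elim n)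
        have "measure P (A n) = measure P {\<omega> \<in> space P. \<epsilon> \<le> E n \<omega>}"
          using elim bad_null[of n] E_meas[OF elim] by (simp add: A_def measure_Un_null_set)
        also have "\<dots> \<le> (LINT \<omega>|P. E n \<omega>) / \<epsilon>"
        proof (rule integral_Markov_inequality_measure[OF E_int(1)[OF elim], where A = "{}"])
          show "AE \<omega> in P. 0 \<le> E n \<omega>"
            unfolding E_def by (intro AE_I2 mult_nonneg_nonneg sum_nonneg l1_error_nonneg) simp
        qed (use \<open>\<epsilon> > 0\<close> in auto)
        finally show ?case by (simp add: E_int(2)[OF elim])
      qed
      show "(\<lambda>n. (LINT x|sample_law n. l1_error n x) / \<epsilon>) \<longlonglongrightarrow> 0"
        using tendsto_divide[OF expected_l1_error_tendsto_0[OF A1] tendsto_const[of \<epsilon>]] \<open>\<epsilon> > 0\<close> by simp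
    qed auto
    ultimately show "\<exists>A. (\<forall>n. A n \<in> sets P \<and>
        {\<omega> \<in> space P. density \<mu> (\<lambda>\<theta>. ennreal (perm_avg_est p \<mu> w f0 (\<lambda>i. X i \<omega>) n \<theta>)) \<notin> U} \<subseteq> A n) \<and>
        (\<lambda>n. measure P (A n)) \<longlonglongrightarrow> 0"
      by blast
  qed
qed

end
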